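(* Let $dG_0$ and $dG_1$ be pointed simple matroids, and let $P_d(dG_0,dG_1)$ be their pointed parallel connection. Then $\mathcal{A}_d(P_d(dG_0,dG_1))$ is isomorphic, as a graded algebra, to $\mathcal{A}_d(dG_0)\otimes\mathcal{A}_d(dG_1)$.
   Context: For a simple matroid $G$ on a finite ground set $E$, let $\mathcal{E}=\Lambda(e_i : i\in E)$ be the graded exterior algebra over $\mathbb{C}$ with generators $e_i$ of degree one. For an ordered tuple $S=(i_1,\ldots,i_p)$ write $e_S=e_{i_1}\wedge\cdots\wedge e_{i_p}$ and define $\partial:\mathcal{E}^p\to\mathcal{E}^{p-1}$ by $\partial(e_{i_1}\wedge\cdots\wedge e_{i_p})=\sum_{k=1}^p(-1)^{k-1}e_{i_1}\wedge\cdots\wedge\widehat{e_{i_k}}\wedge\cdots\wedge e_{i_p}$. Let $\mathcal{I}$ be the ideal generated by $\{\partial e_S : S\text{ dependent in }G\}$ and $\mathcal{A}(G)=\mathcal{E}/\mathcal{I}$ the Orlik-Solomon algebra, with $a_i$ the image of $e_i$. A pointed matroid $dG$ is a simple matroid $G$ on a ground set $\{0,\ldots,n\}$ with base point $0$; its Orlik-Solomon algebra $\mathcal{A}_d(dG)$ is the subalgebra of $\mathcal{A}(G)$ generated by $a_1-a_0,\ldots,a_n-a_0$. The pointed parallel connection $P_d(dG_0,dG_1)$ is the (unique up to isomorphism) pointed matroid of largest rank which is a union of pointed submatroids isomorphic to $dG_0$ and $dG_1$ whose ground sets intersect only in the base point; equivalently, its ground set is the union of the ground sets of $G_0$ and $G_1$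 with the two base points identified to a single base point $p$, and its circuits are the circuits of $G_0$, the circuits of $G_1$, and the sets $(C_0\setminus\{p\})\cup(C_1\setminus\{p\})$ with $C_i$ a circuit of $G_i$ containing $p$. The tensor product of graded algebras is graded in the usual way. *)

theory Defs
  imports
    "HOL-Library.Poly_Mapping"
    "HOL-Algebra.Module"
    "HOL-Algebra.QuotRing"
    "HOL-Algebra.Subrings"
    Complex_Main
begin

section \<open>Pointed simple matroids\<close>

record 'a matroid =
  ground :: "'a set"
  indep :: "'a set set"

definition is_matroid :: "'a matroid \<Rightarrow> bool" where
  "is_matroid G \<longleftrightarrow>
     finite (ground G) \<and>
     indep G \<subseteq> Pow (ground G) \<and>
     {} \<in> indep G \<and>
     (\<forall>X Y. X \<in> indep G \<longrightarrow> Y \<subseteq> X \<longrightarrow> Y \<in> indep G) \<and>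
     (\<forall>X Y. X \<in> indep G \<longrightarrow> Y \<in> indep G \<longrightarrow> card X < card Y \<longrightarrow>
        (\<exists>y \<in> Y - X. insert y X \<in> indep G))"

text \<open>Simple: no loops and no parallel pairs (the case \<open>x = y\<close> excludes the loops).\<close>

definition simple_matroid :: "'a matroid \<Rightarrow> bool" where
  "simple_matroid G \<longleftrightarrow> is_matroid G \<and>
     (\<forall>x \<in> ground G. \<forall>y \<in> ground G. {x, y} \<in> indep G)"

definition circuits :: "'a matroid \<Rightarrow> 'a set set" where
  "circuits G = {C. C \<subseteq> ground G \<and> C \<notin> indep G \<and> (\<forall>D. D \<subset> C \<longrightarrow> D \<in> indep G)}"

text \<open>The base point of a pointed matroid is always the element \<open>0\<close>.\<close>

definition pointed_matroid :: "nat matroid \<Rightarrow> bool" where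
  "pointed_matroid G \<longleftrightarrow> simple_matroid G \<and> (\<exists>n. ground G = {0..n})"

text \<open>
  The pointed parallel connection is determined only up to isomorphism, so it is given as a
  predicate on \<open>P\<close>. The maps \<open>f0\<close> and \<open>f1\<close> are the inclusions of the two
  ground sets into their union along the base points.
\<close>

definition pointed_parallel_connection :: "nat matroid \<Rightarrow> nat matroid \<Rightarrow> nat matroid \<Rightarrow> bool" where
  "pointed_parallel_connection G0 G1 P \<longleftrightarrow>
     pointed_matroid P \<and>
     (\<exists>f0 f1.
        inj_on f0 (ground G0) \<and> inj_on f1 (ground G1) \<and> f0 0 = 0 \<and> f1 0 = 0 \<and>
        ground P = f0 ` ground G0 \<union> f1 ` ground G1 \<and>
        f0 ` ground G0 \<inter> f1 ` ground G1 = {0} \<and>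
        circuits P =
          (\<lambda>C. f0 ` C) ` circuits G0 \<union> (\<lambda>C. f1 ` C) ` circuits G1 \<union>
          {(f0 ` C0 - {0}) \<union> (f1 ` C1 - {0}) | C0 C1.
             C0 \<in> circuits G0 \<and> 0 \<in> C0 \<and> C1 \<in> circuits G1 \<and> 0 \<in> C1})"


section \<open>Graded complex algebras\<close>

text \<open>
  The field \<open>homog A p\<close> is the homogeneous component of degree \<open>p\<close>. The multiplication
  need not be commutative.
\<close>

record 'v graded_algebra = "(complex, 'v) module" +
  homog :: "nat \<Rightarrow> 'v set"

definition graded_algebra_iso ::
  "'v graded_algebra \<Rightarrow> 'w graded_algebra \<Rightarrow> ('v \<Rightarrow> 'w) set" where
  "graded_algebra_iso A B =
     {h \<in> ring_iso A B.
        (\<forall>c. \<forall>x \<in> carrier A. h (c \<odot>\<^bsub>A\<^esub> x) = c \<odot>\<^bsub>B\<^esub> h x) \<and>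
        (\<forall>p. h ` homog A p = homog B p)}"

definition graded_algebra_isomorphic :: "'v graded_algebra \<Rightarrow> 'w graded_algebra \<Rightarrow> bool" where
  "graded_algebra_isomorphic A B \<longleftrightarrow> graded_algebra_iso A B \<noteq> {}"

text \<open>The scalar multiplication on cosets follows the pattern of \<^const>\<open>rcoset_mult\<close>.\<close>

definition quotient_algebra :: "'v graded_algebra \<Rightarrow> 'v set \<Rightarrow> 'v set graded_algebra" where
  "quotient_algebra A I =
     \<lparr>carrier = carrier (A Quot I), mult = mult (A Quot I), one = one (A Quot I),
      zero = zero (A Quot I), add = add (A Quot I),
      smult = (\<lambda>c X. \<Union>x\<in>X. I +>\<^bsub>A\<^esub> (c \<odot>\<^bsub>A\<^esub> x)),
      homog = (\<lambda>p. (\<lambda>x. I +>\<^bsub>A\<^esub> x) ` homog A p)\<rparr>"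

lemma ring_quotient_algebra:
  assumes "ideal I A" shows "ring (quotient_algebra A I)"
proof -
  interpret Q: ring "A Quot I" by (rule ideal.quotient_is_ring[OF assms])
  have s: "carrier (quotient_algebra A I) = carrier (A Quot I)"
    "mult (quotient_algebra A I) = mult (A Quot I)" "one (quotient_algebra A I) = one (A Quot I)"
    "zero (quotient_algebra A I) = zero (A Quot I)" "add (quotient_algebra A I) = add (A Quot I)"
    by (simp_all add: quotient_algebra_def)
  show ?thesis
  proof (rule ringI)
    show "abelian_group (quotient_algebra A I)"
      by (rule abelian_groupI)
         (auto simp: s Q.add.m_assoc Q.add.m_comm Q.add.m_lcomm intro: Q.l_neg)
    show "Group.monoid (quotient_algebra A I)"
      by (rule Group.monoidI) (auto simp: s Q.m_assoc)
  qed (auto simp: s Q.l_distr Q.r_distr)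
qed

definition generated_subalgebra :: "'v graded_algebra \<Rightarrow> 'v set \<Rightarrow> 'v graded_algebra" where
  "generated_subalgebra A S =
     (let B = \<Inter>{B. subring B A \<and> (\<forall>c. \<forall>x \<in> B. c \<odot>\<^bsub>A\<^esub> x \<in> B) \<and> S \<subseteq> B}
      in A\<lparr>carrier := B, homog := (\<lambda>p. homog A p \<inter> B)\<rparr>)"


section \<open>Formal linear combinations\<close>

definition scale_comb :: "complex \<Rightarrow> ('k \<Rightarrow>\<^sub>0 complex) \<Rightarrow> ('k \<Rightarrow>\<^sub>0 complex)" where
  "scale_comb c f = Poly_Mapping.map (\<lambda>x. c * x) f"

lemma lookup_scale_comb: "Poly_Mapping.lookup (scale_comb c f) k = c * Poly_Mapping.lookup f k"
  by (simp add: scale_comb_def Poly_Mapping.map.rep_eq when_def)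

interpretation comb: vector_space scale_comb
  by unfold_locales
     (auto intro!: poly_mapping_eqI simp: lookup_scale_comb lookup_add algebra_simps)

text \<open>
  The bilinear extension of the product \<open>x \<cdot> y = s x y m(x, y)\<close> of basis elements, where
  \<open>s x y\<close> is a scalar.
\<close>

definition comb_mult ::
  "('k \<Rightarrow> 'k \<Rightarrow> 'k) \<Rightarrow> ('k \<Rightarrow> 'k \<Rightarrow> complex) \<Rightarrow>
   ('k \<Rightarrow>\<^sub>0 complex) \<Rightarrow> ('k \<Rightarrow>\<^sub>0 complex) \<Rightarrow> ('k \<Rightarrow>\<^sub>0 complex)" where
  "comb_mult m s f g =
     (\<Sum>x \<in> Poly_Mapping.keys f. \<Sum>y \<in> Poly_Mapping.keys g.
        Poly_Mapping.single (m x y) (s x y * Poly_Mapping.lookup f x * Poly_Mapping.lookup g y))"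

lemma comb_mult_superset:
  assumes "finite A" "finite B" "Poly_Mapping.keys f \<subseteq> A" "Poly_Mapping.keys g \<subseteq> B"
  shows "comb_mult m s f g =
     (\<Sum>x \<in> A. \<Sum>y \<in> B.
        Poly_Mapping.single (m x y) (s x y * Poly_Mapping.lookup f x * Poly_Mapping.lookup g y))"
proof -
  have "(\<Sum>y \<in> B. Poly_Mapping.single (m x y) (s x y * Poly_Mapping.lookup f x * Poly_Mapping.lookup g y))
     = (\<Sum>y \<in> Poly_Mapping.keys g. Poly_Mapping.single (m x y) (s x y * Poly_Mapping.lookup f x * Poly_Mapping.lookup g y))" for x
    by (rule sum.mono_neutral_right) (use assms in \<open>auto simp: in_keys_iff\<close>)
  moreover have "(\<Sum>x \<in> A. \<Sum>y \<in> Poly_Mapping.keys g. Poly_Mapping.single (m x y) (s x y * Poly_Mapping.lookup f x * Poly_Mapping.lookup g y))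
     = comb_mult m s f g" unfolding comb_mult_def
    by (rule sum.mono_neutral_right) (use assms in \<open>auto simp: in_keys_iff\<close>)
  ultimately show ?thesis by simp
qed

lemma comb_mult_add_left: "comb_mult m s (f + f') g = comb_mult m s f g + comb_mult m s f' g"
proof -
  let ?A = "Poly_Mapping.keys f \<union> Poly_Mapping.keys f'"
  have "Poly_Mapping.keys (f + f') \<subseteq> ?A" by (rule keys_add)
  then show ?thesis
    by (simp add: comb_mult_superset[where A="?A" and B="Poly_Mapping.keys g"] lookup_add
        algebra_simps sum.distrib single_add)
qed

lemma comb_mult_add_right: "comb_mult m s g (f + f') = comb_mult m s g f + comb_mult m s g f'"
proof -
  let ?A = "Poly_Mapping.keys f \<union> Poly_Mapping.keys f'"
  have "Poly_Mapping.keys (f + f') \<subseteq> ?A" by (rule keys_add)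
  then show ?thesis
    by (simp add: comb_mult_superset[where B="?A" and A="Poly_Mapping.keys g"] lookup_add
        algebra_simps sum.distrib single_add)
qed

lemma comb_mult_single:
  "comb_mult m s (Poly_Mapping.single x a) (Poly_Mapping.single y b) =
   Poly_Mapping.single (m x y) (s x y * a * b)"
  by (simp add: comb_mult_superset[where A="{x}" and B="{y}"])

lemma comb_induct [case_names single add]:
  fixes f :: "'k \<Rightarrow>\<^sub>0 complex"
  assumes "\<And>k v. P (Poly_Mapping.single k v)" "\<And>f g. P f \<Longrightarrow> P g \<Longrightarrow> P (f + g)"
  shows "P f"
proof (induct f rule: update_induct)
  case const
  then show ?case using assms(1)[of undefined 0] by simp
next
  case (update f a b)
  have "Poly_Mapping.update a b f = f + Poly_Mapping.single a b"
    using update by (intro poly_mapping_eqI)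
      (auto simp: lookup_update lookup_add lookup_single in_keys_iff when_def)
  then show ?case using update assms by simp
qed


section \<open>The exterior algebra\<close>

text \<open>
  The tensor algebra of the vector space with basis \<open>E\<close>: its basis consists of the words
  over \<open>E\<close>, multiplied by concatenation and graded by length.
\<close>

definition tensor_algebra :: "'a set \<Rightarrow> ('a list \<Rightarrow>\<^sub>0 complex) graded_algebra" where
  "tensor_algebra E =
     \<lparr>carrier = {f. Poly_Mapping.keys f \<subseteq> {w. set w \<subseteq> E}},
      mult = comb_mult (@) (\<lambda>_ _. 1), one = Poly_Mapping.single [] 1,
      zero = 0, add = (+), smult = scale_comb,
      homog = (\<lambda>p. {f. Poly_Mapping.keys f \<subseteq> {w. set w \<subseteq> E \<and> length w = p}})\<rparr>"

text \<open>
  \<^const>\<open>genideal\<close> is an intersection over all ideals, and \<^const>\<open>ideal\<close> includes that the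
  ambient structure is a ring; it is the generated ideal only once this is known.
\<close>

lemma tensor_mult_assoc:
  fixes f g h :: "'a list \<Rightarrow>\<^sub>0 complex"
  defines "c \<equiv> comb_mult (@) (\<lambda>_ _. 1)"
  shows "c (c f g) h = c f (c g h)"
proof (induct f rule: comb_induct)
  case (single x a)
  show ?case
  proof (induct g rule: comb_induct)
    case (single y b)
    show ?case
    proof (induct h rule: comb_induct)
      case (single z d) show ?case by (simp add: c_def comb_mult_single mult.assoc)
    qed (simp add: c_def comb_mult_add_left comb_mult_add_right)
  qed (simp add: c_def comb_mult_add_left comb_mult_add_right)
qed (simp add: c_def comb_mult_add_left comb_mult_add_right)

lemma ring_tensor_algebra: "ring (tensor_algebra E)"
proof (rule ringI)
  show "abelian_group (tensor_algebra E)"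
  proof (rule abelian_groupI)
    fix x assume "x \<in> carrier (tensor_algebra E)"
    then show "\<exists>y\<in>carrier (tensor_algebra E). y \<oplus>\<^bsub>tensor_algebra E\<^esub> x = \<zero>\<^bsub>tensor_algebra E\<^esub>"
      by (intro bexI[of _ "- x"]) (auto simp: tensor_algebra_def)
  qed (use keys_add in \<open>fastforce simp: tensor_algebra_def\<close>)+
  show "Group.monoid (tensor_algebra E)"
  proof (rule Group.monoidI)
    fix f g assume "f \<in> carrier (tensor_algebra E)" "g \<in> carrier (tensor_algebra E)"
    then have fg: "Poly_Mapping.keys f \<subseteq> {w. set w \<subseteq> E}" "Poly_Mapping.keys g \<subseteq> {w. set w \<subseteq> E}"
      by (auto simp: tensor_algebra_def)
    have "Poly_Mapping.keys (comb_mult (@) (\<lambda>_ _. 1) f g) \<subseteq>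
       (\<Union>x\<in>Poly_Mapping.keys f. \<Union>y\<in>Poly_Mapping.keys g. {x @ y})"
      unfolding comb_mult_def
      by (intro order_trans[OF keys_sum] UN_mono order_refl) (simp add: keys_single)
    with fg show "f \<otimes>\<^bsub>tensor_algebra E\<^esub> g \<in> carrier (tensor_algebra E)"
      by (fastforce simp: tensor_algebra_def)
  next
    show "\<one>\<^bsub>tensor_algebra E\<^esub> \<in> carrier (tensor_algebra E)"
      by (simp add: tensor_algebra_def keys_single)
  next
    fix f show "\<one>\<^bsub>tensor_algebra E\<^esub> \<otimes>\<^bsub>tensor_algebra E\<^esub> f = f"
      unfolding tensor_algebra_def
      by (induct f rule: comb_induct) (simp_all add: comb_mult_single comb_mult_add_right)
    show "f \<otimes>\<^bsub>tensor_algebra E\<^esub> \<one>\<^bsub>tensor_algebra E\<^esub> = f"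
      unfolding tensor_algebra_def
      by (induct f rule: comb_induct) (simp_all add: comb_mult_single comb_mult_add_left)
  qed (simp add: tensor_algebra_def tensor_mult_assoc)
qed (simp_all add: tensor_algebra_def comb_mult_add_left comb_mult_add_right)

definition exterior_ideal :: "'a set \<Rightarrow> ('a list \<Rightarrow>\<^sub>0 complex) set" where
  "exterior_ideal E =
     genideal (tensor_algebra E)
       {v \<otimes>\<^bsub>tensor_algebra E\<^esub> v | v. v \<in> homog (tensor_algebra E) 1}"

lemma ideal_exterior_ideal: "ideal (exterior_ideal E) (tensor_algebra E)"
  unfolding exterior_ideal_def
proof (rule ring.genideal_ideal[OF ring_tensor_algebra])
  interpret T: ring "tensor_algebra E" by (rule ring_tensor_algebra)
  have "homog (tensor_algebra E) 1 \<subseteq> carrier (tensor_algebra E)" by (auto simp: tensor_algebra_def)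
  then show "{v \<otimes>\<^bsub>tensor_algebra E\<^esub> v | v. v \<in> homog (tensor_algebra E) 1} \<subseteq> carrier (tensor_algebra E)"
    by blast
qed

definition exterior_algebra :: "'a set \<Rightarrow> ('a list \<Rightarrow>\<^sub>0 complex) set graded_algebra" where
  "exterior_algebra E = quotient_algebra (tensor_algebra E) (exterior_ideal E)"

lemma ring_exterior_algebra: "ring (exterior_algebra E)"
  unfolding exterior_algebra_def by (rule ring_quotient_algebra[OF ideal_exterior_ideal])

definition ext_gen :: "'a set \<Rightarrow> 'a \<Rightarrow> ('a list \<Rightarrow>\<^sub>0 complex) set" where
  "ext_gen E i = exterior_ideal E +>\<^bsub>tensor_algebra E\<^esub> Poly_Mapping.single [i] 1"

text \<open>The element \<open>e_S\<close> for a tuple \<open>S\<close>.\<close>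

definition ext_monom :: "'a set \<Rightarrow> 'a list \<Rightarrow> ('a list \<Rightarrow>\<^sub>0 complex) set" where
  "ext_monom E S =
     foldr (\<lambda>i x. ext_gen E i \<otimes>\<^bsub>exterior_algebra E\<^esub> x) S \<one>\<^bsub>exterior_algebra E\<^esub>"

text \<open>
  The element \<open>\<partial> e_S\<close>. Positions in a list are counted from \<open>0\<close>, so the sign
  is \<open>(-1)^k\<close> here.
\<close>

definition ext_boundary :: "'a set \<Rightarrow> 'a list \<Rightarrow> ('a list \<Rightarrow>\<^sub>0 complex) set" where
  "ext_boundary E S =
     (\<Oplus>\<^bsub>exterior_algebra E\<^esub>k \<in> {..<length S}.
        (- 1) ^ k \<odot>\<^bsub>exterior_algebra E\<^esub> ext_monom E (take k S @ drop (Suc k) S))"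


section \<open>Orlik-Solomon algebras\<close>

definition os_ideal :: "'a matroid \<Rightarrow> ('a list \<Rightarrow>\<^sub>0 complex) set set" where
  "os_ideal G =
     genideal (exterior_algebra (ground G))
       {ext_boundary (ground G) S | S.
          distinct S \<and> set S \<subseteq> ground G \<and> set S \<notin> indep G}"

definition orlik_solomon :: "'a matroid \<Rightarrow> ('a list \<Rightarrow>\<^sub>0 complex) set set graded_algebra" where
  "orlik_solomon G = quotient_algebra (exterior_algebra (ground G)) (os_ideal G)"

definition os_gen :: "'a matroid \<Rightarrow> 'a \<Rightarrow> ('a list \<Rightarrow>\<^sub>0 complex) set set" where
  "os_gen G i = os_ideal G +>\<^bsub>exterior_algebra (ground G)\<^esub> ext_gen (ground G) i"

definition pointed_orlik_solomon ::
  "nat matroid \<Rightarrow> (nat list \<Rightarrow>\<^sub>0 complex) set set graded_algebra" where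
  "pointed_orlik_solomon G =
     generated_subalgebra (orlik_solomon G)
       {os_gen G i \<ominus>\<^bsub>orlik_solomon G\<^esub> os_gen G 0 | i. i \<in> ground G \<and> i \<noteq> 0}"


section \<open>The tensor product of graded algebras\<close>

text \<open>
  The tensor product is the direct sum of the spaces \<open>A_i \<otimes> B_j\<close>, with \<open>A_i \<otimes> B_j\<close>
  in degree \<open>i + j\<close>. The key \<open>(i, a, j, b)\<close> stands for the pure tensor \<open>a \<otimes> b\<close>
  of homogeneous elements of degrees \<open>i\<close> and \<open>j\<close>; the degrees are recorded because
  \<open>0\<close> is homogeneous of every degree. The product follows the usual sign convention
  \<open>(a \<otimes> b) (a' \<otimes> b') = (-1)^(deg b * deg a') (a a') \<otimes> (b b')\<close>.
\<close>

definition tensor_keys ::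
  "'v graded_algebra \<Rightarrow> 'w graded_algebra \<Rightarrow> (nat \<times> 'v \<times> nat \<times> 'w) set" where
  "tensor_keys A B = {(i, a, j, b). a \<in> homog A i \<and> b \<in> homog B j}"

definition pre_tensor ::
  "'v graded_algebra \<Rightarrow> 'w graded_algebra \<Rightarrow>
   ((nat \<times> 'v \<times> nat \<times> 'w) \<Rightarrow>\<^sub>0 complex) graded_algebra" where
  "pre_tensor A B =
     \<lparr>carrier = {f. Poly_Mapping.keys f \<subseteq> tensor_keys A B},
      mult = comb_mult
        (\<lambda>(i, a, j, b) (i', a', j', b'). (i + i', a \<otimes>\<^bsub>A\<^esub> a', j + j', b \<otimes>\<^bsub>B\<^esub> b'))
        (\<lambda>(i, a, j, b) (i', a', j', b'). (- 1) ^ (j * i')),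
      one = Poly_Mapping.single (0, \<one>\<^bsub>A\<^esub>, 0, \<one>\<^bsub>B\<^esub>) 1,
      zero = 0, add = (+), smult = scale_comb,
      homog = (\<lambda>p. {f. Poly_Mapping.keys f \<subseteq> {(i, a, j, b) \<in> tensor_keys A B. i + j = p}})\<rparr>"

abbreviation pure_tensor ::
  "nat \<Rightarrow> 'v \<Rightarrow> nat \<Rightarrow> 'w \<Rightarrow> ((nat \<times> 'v \<times> nat \<times> 'w) \<Rightarrow>\<^sub>0 complex)" where
  "pure_tensor i a j b \<equiv> Poly_Mapping.single (i, a, j, b) 1"

definition tensor_relations ::
  "'v graded_algebra \<Rightarrow> 'w graded_algebra \<Rightarrow> ((nat \<times> 'v \<times> nat \<times> 'w) \<Rightarrow>\<^sub>0 complex) set" where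
  "tensor_relations A B =
     {pure_tensor i (a \<oplus>\<^bsub>A\<^esub> a') j b - pure_tensor i a j b - pure_tensor i a' j b | i a a' j b.
        a \<in> homog A i \<and> a' \<in> homog A i \<and> b \<in> homog B j} \<union>
     {pure_tensor i a j (b \<oplus>\<^bsub>B\<^esub> b') - pure_tensor i a j b - pure_tensor i a j b' | i a j b b'.
        a \<in> homog A i \<and> b \<in> homog B j \<and> b' \<in> homog B j} \<union>
     {pure_tensor i (c \<odot>\<^bsub>A\<^esub> a) j b - scale_comb c (pure_tensor i a j b) | c i a j b.
        a \<in> homog A i \<and> b \<in> homog B j} \<union>
     {pure_tensor i a j (c \<odot>\<^bsub>B\<^esub> b) - scale_comb c (pure_tensor i a j b) | c i a j b.
        a \<in> homog A i \<and> b \<in> homog B j}"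

text \<open>
  For graded algebras \<open>A\<close> and \<open>B\<close>, a basis element times a relation is, up to sign,
  again a relation, so that the linear span of the
  relations is a two-sided ideal.
\<close>

definition graded_tensor ::
  "'v graded_algebra \<Rightarrow> 'w graded_algebra \<Rightarrow>
   ((nat \<times> 'v \<times> nat \<times> 'w) \<Rightarrow>\<^sub>0 complex) set graded_algebra" where
  "graded_tensor A B =
     quotient_algebra (pre_tensor A B) (comb.span (tensor_relations A B))"

end

theory Submission
  imports Defs "HOL-Library.Multiset"
begin

text \<open>
  Put \<open>x\<^sub>i = a\<^sub>i - a\<^sub>0\<close>. The boundary of a monomial does not change when all generators are
  shifted by the same element, so \<open>a\<^sub>i \<mapsto> x\<^sub>i\<close> defines an endomorphism of the Orlik-Solomon
  algebra; it kills \<open>a\<^sub>0\<close> and is the identity on the pointed subalgebra.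
  For the same reason \<open>a\<^sub>0 \<mapsto> 0\<close>, \<open>a\<^sub>i \<mapsto> x\<^sub>i \<otimes> 1\<close> or \<open>1 \<otimes> x\<^sub>i\<close> defines a homomorphism from the
  Orlik-Solomon algebra of the parallel connection to the tensor product. It suffices to check
  circuits: those of the two factors are clear, and if \<open>0 \<in> C\<^sub>i\<close>, then the boundary of
  \<open>C\<^sub>i\<close> is sent, up to sign, to the monomial of \<open>C\<^sub>i - {0}\<close>, so that both terms of the Leibniz
  rule for the glued circuit vanish. Restricted to the pointed subalgebra, this homomorphism is
  inverse to \<open>u \<otimes> v \<mapsto> \<alpha>(u) \<beta>(v)\<close>, where \<open>\<alpha>\<close> and \<open>\<beta>\<close> are induced by the
  inclusions of the ground sets.
\<close>

section \<open>Graded algebras and their homomorphisms\<close>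

text \<open>The pointed algebra is given as a subalgebra, without a presentation, so a map out of it
  cannot be defined by prescribing values on its generators. Every homomorphism therefore starts at
  a full Orlik-Solomon algebra or at the tensor product, both of which have a universal property,
  and is restricted afterwards. One composition is then compared on pure tensors, the other on
  generators, so that neither a basis nor a dimension count enters. The second obstacle is the
  grading. That the sum of the components \<open>homog A p\<close> is direct is not part of
  \<open>galgebra\<close>, while a pure tensor records the degrees of its factors. Hence
  \<open>u\<close> tensored with 1 depends a priori on the degree assigned to \<open>u\<close>, and
  the inclusion of a factor into the tensor product is a family of maps indexed by the degree
  (\<open>graded_map\<close>). The lemma \<open>hom_eq_graded_map\<close> identifies such a family
  with an honest homomorphism on the full algebra.\<close>

locale galgebra = ring A for A :: "'v graded_algebra" (structure) +
  assumes smult_closed [simp, intro]: "x \<in> carrier A \<Longrightarrow> c \<odot> x \<in> carrier A"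
    and smult_r_distr: "x \<in> carrier A \<Longrightarrow> y \<in> carrier A \<Longrightarrow> c \<odot> (x \<oplus> y) = c \<odot> x \<oplus> c \<odot> y"
    and smult_l_distr: "x \<in> carrier A \<Longrightarrow> (c + d) \<odot> x = c \<odot> x \<oplus> d \<odot> x"
    and smult_assoc1: "x \<in> carrier A \<Longrightarrow> (c * d) \<odot> x = c \<odot> (d \<odot> x)"
    and smult_one [simp]: "x \<in> carrier A \<Longrightarrow> 1 \<odot> x = x"
    and smult_mult_left: "x \<in> carrier A \<Longrightarrow> y \<in> carrier A \<Longrightarrow> (c \<odot> x) \<otimes> y = c \<odot> (x \<otimes> y)"
    and smult_mult_right: "x \<in> carrier A \<Longrightarrow> y \<in> carrier A \<Longrightarrow> x \<otimes> (c \<odot> y) = c \<odot> (x \<otimes> y)"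
    and homog_carrier: "x \<in> homog A p \<Longrightarrow> x \<in> carrier A"
    and homog_zero [simp]: "\<zero> \<in> homog A p"
    and homog_add: "x \<in> homog A p \<Longrightarrow> y \<in> homog A p \<Longrightarrow> x \<oplus> y \<in> homog A p"
    and homog_smult: "x \<in> homog A p \<Longrightarrow> c \<odot> x \<in> homog A p"
    and homog_one [simp]: "\<one> \<in> homog A 0"
    and homog_mult: "x \<in> homog A p \<Longrightarrow> y \<in> homog A q \<Longrightarrow> x \<otimes> y \<in> homog A (p + q)"
begin

lemma smult_zero_left [simp]: "x \<in> carrier A \<Longrightarrow> 0 \<odot> x = \<zero>"
  using smult_l_distr[of x 0 0] add.l_cancel_one'[of "0 \<odot> x" "0 \<odot> x"] by simp

lemma smult_zero_right [simp]: "c \<odot> \<zero> = \<zero>"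
  using smult_assoc1[of "\<zero>" c 0] by simp

lemma minus_eq_smult: "x \<in> carrier A \<Longrightarrow> \<ominus> x = (- 1) \<odot> x"
  using smult_l_distr[of x 1 "- 1"] by (intro minus_equality) (simp_all add: a_comm)

lemma smult_smult: "x \<in> carrier A \<Longrightarrow> c \<odot> (d \<odot> x) = (c * d) \<odot> x"
  by (simp add: smult_assoc1)

lemma add_smult_minus [simp]: "x \<in> carrier A \<Longrightarrow> x \<oplus> (- 1) \<odot> x = \<zero>"
  "x \<in> carrier A \<Longrightarrow> (- 1) \<odot> x \<oplus> x = \<zero>"
  by (simp_all add: minus_eq_smult[symmetric] r_neg l_neg)

lemma finsum_smult:
  assumes "finite F" "g \<in> F \<rightarrow> carrier A"
  shows "c \<odot> (\<Oplus>k\<in>F. g k) = (\<Oplus>k\<in>F. c \<odot> g k)"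
  using assms
proof (induct F)
  case (insert k F)
  then have "g \<in> F \<rightarrow> carrier A" "g k \<in> carrier A" by auto
  with insert show ?case by (simp add: smult_r_distr Pi_iff)
qed simp

lemma homog_finsum:
  assumes "finite F" "\<And>k. k \<in> F \<Longrightarrow> g k \<in> homog A p"
  shows "(\<Oplus>k\<in>F. g k) \<in> homog A p"
  using assms
proof (induct F)
  case (insert k F)
  then have "g \<in> F \<rightarrow> carrier A" "g k \<in> carrier A" using homog_carrier by auto
  with insert show ?case by (simp add: homog_add)
qed simp

text \<open>The scalar 2 is invertible. This is how anticommutation alone yields vanishing
  squares.\<close>

lemma smult_eq_self_neg:
  assumes "x \<in> carrier A" "x = (- 1) \<odot> x" shows "x = \<zero>"
proof -
  have "2 \<odot> x = x \<oplus> x" using assms(1) smult_l_distr[of x 1 1] by simp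
  also have "\<dots> = \<zero>" using assms(2) add_smult_minus(1)[OF assms(1)] by simp
  finally have "(1/2) \<odot> (2 \<odot> x) = \<zero>" by simp
  then show ?thesis using assms(1) by (simp add: smult_smult)
qed

end

definition galgebra_hom :: "'v graded_algebra \<Rightarrow> 'w graded_algebra \<Rightarrow> ('v \<Rightarrow> 'w) set" where
  "galgebra_hom A B =
     {h \<in> ring_hom A B.
        (\<forall>c. \<forall>x \<in> carrier A. h (c \<odot>\<^bsub>A\<^esub> x) = c \<odot>\<^bsub>B\<^esub> h x) \<and>
        (\<forall>p. \<forall>x \<in> homog A p. h x \<in> homog B p)}"

lemma galgebra_homD:
  assumes "h \<in> galgebra_hom A B"
  shows "x \<in> carrier A \<Longrightarrow> h x \<in> carrier B"
    and "x \<in> carrier A \<Longrightarrow> y \<in> carrier A \<Longrightarrow> h (x \<otimes>\<^bsub>A\<^esub> y) = h x \<otimes>\<^bsub>B\<^esub> h y"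
    and "x \<in> carrier A \<Longrightarrow> y \<in> carrier A \<Longrightarrow> h (x \<oplus>\<^bsub>A\<^esub> y) = h x \<oplus>\<^bsub>B\<^esub> h y"
    and "h \<one>\<^bsub>A\<^esub> = \<one>\<^bsub>B\<^esub>"
    and "x \<in> carrier A \<Longrightarrow> h (c \<odot>\<^bsub>A\<^esub> x) = c \<odot>\<^bsub>B\<^esub> h x"
    and "x \<in> homog A p \<Longrightarrow> h x \<in> homog B p"
  using assms by (auto simp: galgebra_hom_def ring_hom_def)

lemma galgebra_hom_zero:
  assumes "galgebra A" "galgebra B" "h \<in> galgebra_hom A B"
  shows "h \<zero>\<^bsub>A\<^esub> = \<zero>\<^bsub>B\<^esub>"
proof -
  interpret A: galgebra A by fact
  interpret B: galgebra B by fact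
  have "h (0 \<odot>\<^bsub>A\<^esub> \<zero>\<^bsub>A\<^esub>) = 0 \<odot>\<^bsub>B\<^esub> h \<zero>\<^bsub>A\<^esub>"
    using galgebra_homD(5)[OF assms(3) A.zero_closed] .
  then show ?thesis using galgebra_homD(1)[OF assms(3) A.zero_closed] by simp
qed

lemma galgebra_hom_minus:
  assumes "galgebra A" "galgebra B" "h \<in> galgebra_hom A B" "x \<in> carrier A" "y \<in> carrier A"
  shows "h (x \<ominus>\<^bsub>A\<^esub> y) = h x \<ominus>\<^bsub>B\<^esub> h y"
proof -
  interpret A: galgebra A by fact
  interpret B: galgebra B by fact
  show ?thesis using assms(4,5) galgebra_homD[OF assms(3)]
    by (simp add: A.minus_eq B.minus_eq A.minus_eq_smult B.minus_eq_smult)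
qed

lemma galgebra_hom_comp:
  assumes "g \<in> galgebra_hom A B" "h \<in> galgebra_hom B C"
  shows "h \<circ> g \<in> galgebra_hom A C"
  using assms unfolding galgebra_hom_def by (auto simp: ring_hom_def Pi_iff)

section \<open>Algebras with a multiplicative basis\<close>

text \<open>A monoid algebra twisted by the scalars \<open>s\<close>. The tensor algebra (words,
  trivial twist) and \<open>pre_tensor\<close> (sign twist) are both instances, so the algebra laws
  are checked only once.\<close>

definition comb_algebra ::
  "'k set \<Rightarrow> ('k \<Rightarrow> 'k \<Rightarrow> 'k) \<Rightarrow> ('k \<Rightarrow> 'k \<Rightarrow> complex) \<Rightarrow> 'k \<Rightarrow> ('k \<Rightarrow> nat) \<Rightarrow>
   ('k \<Rightarrow>\<^sub>0 complex) graded_algebra" where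
  "comb_algebra K m s e d =
     \<lparr>carrier = {f. Poly_Mapping.keys f \<subseteq> K}, monoid.mult = comb_mult m s,
      one = Poly_Mapping.single e 1, zero = 0, add = (+), smult = scale_comb,
      homog = (\<lambda>p. {f. Poly_Mapping.keys f \<subseteq> {k \<in> K. d k = p}})\<rparr>"

text \<open>A version of \<open>comb_induct\<close> that never leaves \<open>K\<close>; the laws for
  \<open>m\<close> and \<open>s\<close> are available only on \<open>K\<close>.\<close>

lemma comb_supported_induct [consumes 1, case_names zero single add]:
  fixes f :: "'k \<Rightarrow>\<^sub>0 complex"
  assumes "Poly_Mapping.keys f \<subseteq> K"
    and "P 0"
    and "\<And>k v. k \<in> K \<Longrightarrow> P (Poly_Mapping.single k v)"
    and "\<And>f g. Poly_Mapping.keys f \<subseteq> K \<Longrightarrow> Poly_Mapping.keys g \<subseteq> K \<Longrightarrow> P f \<Longrightarrow> P g \<Longrightarrow> P (f + g)"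
  shows "P f"
  using assms(1)
proof (induct f rule: update_induct)
  case const
  show ?case by (rule assms(2))
next
  case (update f a b)
  have eq: "Poly_Mapping.update a b f = f + Poly_Mapping.single a b"
    using update by (intro poly_mapping_eqI)
      (auto simp: lookup_update lookup_add lookup_single in_keys_iff when_def)
  have keys: "Poly_Mapping.keys (Poly_Mapping.update a b f) = insert a (Poly_Mapping.keys f)"
    using update by (auto simp: in_keys_iff lookup_update split: if_splits)
  have "Poly_Mapping.keys (Poly_Mapping.single a b) \<subseteq> K" "a \<in> K" "Poly_Mapping.keys f \<subseteq> K"
    using update(4) keys by (auto simp: keys_single)
  then show ?case unfolding eq using assms(3,4) update by blast
qed

lemma keys_scale_comb: "Poly_Mapping.keys (scale_comb c f) \<subseteq> Poly_Mapping.keys f"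
  by (auto simp: in_keys_iff lookup_scale_comb)

lemma scale_comb_single: "scale_comb c (Poly_Mapping.single k v) = Poly_Mapping.single k (c * v)"
  by (intro poly_mapping_eqI) (auto simp: lookup_scale_comb lookup_single when_def)

lemma comb_mult_zero_left [simp]: "comb_mult m s 0 g = 0"
  and comb_mult_zero_right [simp]: "comb_mult m s g 0 = 0"
  by (simp_all add: comb_mult_def)

lemma comb_mult_scale_left: "comb_mult m s (scale_comb c f) g = scale_comb c (comb_mult m s f g)"
proof (induct f rule: comb_induct)
  case (single x a)
  show ?case
    by (induct g rule: comb_induct)
       (simp_all add: scale_comb_single comb_mult_single comb_mult_add_right comb.scale_right_distrib
          mult_ac)
qed (simp_all add: comb.scale_right_distrib comb_mult_add_left)

lemma comb_mult_scale_right: "comb_mult m s f (scale_comb c g) = scale_comb c (comb_mult m s f g)"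
proof (induct f rule: comb_induct)
  case (single x a)
  show ?case
    by (induct g rule: comb_induct)
       (simp_all add: scale_comb_single comb_mult_single comb_mult_add_right comb.scale_right_distrib
          mult_ac)
qed (simp_all add: comb.scale_right_distrib comb_mult_add_left)

lemma keys_comb_mult:
  "Poly_Mapping.keys (comb_mult m s f g) \<subseteq>
     (\<lambda>(x, y). m x y) ` (Poly_Mapping.keys f \<times> Poly_Mapping.keys g)"
proof -
  have "Poly_Mapping.keys (comb_mult m s f g) \<subseteq>
     (\<Union>x\<in>Poly_Mapping.keys f. \<Union>y\<in>Poly_Mapping.keys g. {m x y})"
    unfolding comb_mult_def
    by (intro order_trans[OF keys_sum] UN_mono order_refl) (simp add: keys_single)
  then show ?thesis by auto
qed

text \<open>The assumption \<open>s_cocycle\<close> is the 2-cocycle identity, which is what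
  associativity says about the coefficients of a product of three basis elements.\<close>

locale comb_algebra_data =
  fixes K :: "'k set" and m :: "'k \<Rightarrow> 'k \<Rightarrow> 'k" and s :: "'k \<Rightarrow> 'k \<Rightarrow> complex"
    and e :: 'k and d :: "'k \<Rightarrow> nat"
  assumes m_in: "x \<in> K \<Longrightarrow> y \<in> K \<Longrightarrow> m x y \<in> K"
    and m_assoc: "x \<in> K \<Longrightarrow> y \<in> K \<Longrightarrow> z \<in> K \<Longrightarrow> m (m x y) z = m x (m y z)"
    and s_cocycle: "x \<in> K \<Longrightarrow> y \<in> K \<Longrightarrow> z \<in> K \<Longrightarrow> s x y * s (m x y) z = s y z * s x (m y z)"
    and e_in: "e \<in> K"
    and m_unit: "x \<in> K \<Longrightarrow> m e x = x" "x \<in> K \<Longrightarrow> m x e = x"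
    and s_unit: "x \<in> K \<Longrightarrow> s e x = 1" "x \<in> K \<Longrightarrow> s x e = 1"
    and d_unit: "d e = 0"
    and d_m: "x \<in> K \<Longrightarrow> y \<in> K \<Longrightarrow> d (m x y) = d x + d y"
begin

lemma assoc:
  assumes f: "Poly_Mapping.keys f \<subseteq> K" and g: "Poly_Mapping.keys g \<subseteq> K" and h: "Poly_Mapping.keys h \<subseteq> K"
  shows "comb_mult m s (comb_mult m s f g) h = comb_mult m s f (comb_mult m s g h)"
  using f
proof (induct f rule: comb_supported_induct)
  case (single x a)
  note x = single
  show ?case using g
  proof (induct g rule: comb_supported_induct)
    case (single y b)
    note y = single
    show ?case using h
    proof (induct h rule: comb_supported_induct)
      case (single z c)
      have "s (m x y) z * (s x y * a * b) * c = s x (m y z) * a * (s y z * b * c)"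
        using arg_cong[OF s_cocycle[OF x y single], of "\<lambda>t. t * (a * b * c)"]
        by (simp only: mult_ac)
      then show ?case
        unfolding comb_mult_single m_assoc[OF x y single] by (rule arg_cong)
    qed (simp_all add: comb_mult_add_right)
  qed (simp_all add: comb_mult_add_left comb_mult_add_right)
qed (simp_all add: comb_mult_add_left comb_mult_add_right)

lemma one_left:
  assumes f: "Poly_Mapping.keys f \<subseteq> K"
  shows "comb_mult m s (Poly_Mapping.single e 1) f = f"
  using f by (induct f rule: comb_supported_induct)
    (simp_all add: comb_mult_single comb_mult_add_right m_unit s_unit)

lemma one_right:
  assumes f: "Poly_Mapping.keys f \<subseteq> K"
  shows "comb_mult m s f (Poly_Mapping.single e 1) = f"
  using f by (induct f rule: comb_supported_induct)
    (simp_all add: comb_mult_single comb_mult_add_left m_unit s_unit)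

lemma mult_keys:
  assumes "Poly_Mapping.keys f \<subseteq> {k \<in> K. Q k}" "Poly_Mapping.keys g \<subseteq> {k \<in> K. R k}"
    and "\<And>x y. x \<in> K \<Longrightarrow> y \<in> K \<Longrightarrow> Q x \<Longrightarrow> R y \<Longrightarrow> T (m x y)"
  shows "Poly_Mapping.keys (comb_mult m s f g) \<subseteq> {k \<in> K. T k}"
proof
  fix k assume "k \<in> Poly_Mapping.keys (comb_mult m s f g)"
  then obtain x y where "k = m x y" "x \<in> Poly_Mapping.keys f" "y \<in> Poly_Mapping.keys g"
    using keys_comb_mult[of m s f g] by auto
  with assms show "k \<in> {k \<in> K. T k}" by (auto intro!: m_in)
qed

lemma mult_carrier:
  assumes "Poly_Mapping.keys f \<subseteq> K" "Poly_Mapping.keys g \<subseteq> K"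
  shows "Poly_Mapping.keys (comb_mult m s f g) \<subseteq> K"
  using mult_keys[of f "\<lambda>_. True" g "\<lambda>_. True" "\<lambda>_. True"] assms by simp

lemma ring_comb_algebra: "ring (comb_algebra K m s e d)" (is "ring ?C")
proof -
  have carrier: "f \<in> carrier ?C \<longleftrightarrow> Poly_Mapping.keys f \<subseteq> K" for f
    by (simp add: comb_algebra_def)
  have ops: "monoid.mult ?C = comb_mult m s" "one ?C = Poly_Mapping.single e 1" "zero ?C = 0" "add ?C = (+)"
    by (simp_all add: comb_algebra_def)
  have add_closed: "f + g \<in> carrier ?C" if "f \<in> carrier ?C" "g \<in> carrier ?C" for f g
    using that keys_add[of f g] by (auto simp: carrier)
  show ?thesis
  proof (rule ringI)
    show "abelian_group ?C"
    proof (rule abelian_groupI)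
      fix x assume "x \<in> carrier ?C"
      then have "- x \<in> carrier ?C" by (simp add: carrier)
      then show "\<exists>y\<in>carrier ?C. y \<oplus>\<^bsub>?C\<^esub> x = \<zero>\<^bsub>?C\<^esub>"
        unfolding ops by (intro bexI[of _ "- x"]) simp_all
    qed (simp_all add: ops add_closed add_ac, simp add: carrier)
    show "Group.monoid ?C"
      by (rule Group.monoidI)
         (use e_in in \<open>simp_all add: ops carrier mult_carrier assoc one_left one_right keys_single\<close>)
  qed (simp_all add: ops comb_mult_add_left comb_mult_add_right)
qed

lemma galgebra_comb_algebra: "galgebra (comb_algebra K m s e d)"
proof -
  let ?C = "comb_algebra K m s e d"
  interpret ring ?C by (rule ring_comb_algebra)
  have carrier: "f \<in> carrier ?C \<longleftrightarrow> Poly_Mapping.keys f \<subseteq> K" for f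
    by (simp add: comb_algebra_def)
  have homog: "f \<in> homog ?C p \<longleftrightarrow> Poly_Mapping.keys f \<subseteq> {k \<in> K. d k = p}" for f p
    by (simp add: comb_algebra_def)
  have ops: "monoid.mult ?C = comb_mult m s" "one ?C = Poly_Mapping.single e 1" "zero ?C = 0" "add ?C = (+)"
    "smult ?C = scale_comb"
    by (simp_all add: comb_algebra_def)
  show ?thesis
  proof unfold_locales
    fix f g p assume "f \<in> homog ?C p" "g \<in> homog ?C p"
    then show "f \<oplus>\<^bsub>?C\<^esub> g \<in> homog ?C p"
      using keys_add[of f g] unfolding homog ops by blast
  next
    fix f c p assume "f \<in> homog ?C p"
    then show "c \<odot>\<^bsub>?C\<^esub> f \<in> homog ?C p"
      using keys_scale_comb[of c f] unfolding homog ops by blast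
  next
    fix f c assume "f \<in> carrier ?C"
    then show "c \<odot>\<^bsub>?C\<^esub> f \<in> carrier ?C"
      using keys_scale_comb[of c f] unfolding carrier ops by blast
  next
    fix f g p q assume "f \<in> homog ?C p" "g \<in> homog ?C q"
    then show "f \<otimes>\<^bsub>?C\<^esub> g \<in> homog ?C (p + q)"
      unfolding homog ops by (rule mult_keys) (simp add: d_m)
  next
    fix f p assume "f \<in> homog ?C p"
    then show "f \<in> carrier ?C" unfolding carrier homog by blast
  next
    show "\<zero>\<^bsub>?C\<^esub> \<in> homog ?C p" for p unfolding homog ops by simp
    show "\<one>\<^bsub>?C\<^esub> \<in> homog ?C 0" unfolding homog ops by (simp add: keys_single e_in d_unit)
  qed (simp_all add: ops comb.scale_right_distrib comb.scale_left_distrib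
        comb_mult_scale_left comb_mult_scale_right)
qed

end

definition lin_ext :: "'v graded_algebra \<Rightarrow> ('k \<Rightarrow> 'v) \<Rightarrow> ('k \<Rightarrow>\<^sub>0 complex) \<Rightarrow> 'v" where
  "lin_ext B g f = (\<Oplus>\<^bsub>B\<^esub>k\<in>Poly_Mapping.keys f. Poly_Mapping.lookup f k \<odot>\<^bsub>B\<^esub> g k)"

context galgebra
begin

lemma lin_ext_superset:
  assumes "finite F" "Poly_Mapping.keys f \<subseteq> F" "g \<in> F \<rightarrow> carrier A"
  shows "lin_ext A g f = (\<Oplus>k\<in>F. Poly_Mapping.lookup f k \<odot> g k)"
  unfolding lin_ext_def
  by (rule add.finprod_mono_neutral_cong_left) (use assms in \<open>auto simp: in_keys_iff Pi_iff\<close>)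

lemma lin_ext_closed:
  assumes "Poly_Mapping.keys f \<subseteq> K" "g \<in> K \<rightarrow> carrier A"
  shows "lin_ext A g f \<in> carrier A"
  unfolding lin_ext_def by (rule finsum_closed) (use assms in auto)

lemma lin_ext_add:
  assumes "Poly_Mapping.keys f \<subseteq> K" "Poly_Mapping.keys f' \<subseteq> K" "g \<in> K \<rightarrow> carrier A"
  shows "lin_ext A g (f + f') = lin_ext A g f \<oplus> lin_ext A g f'"
proof -
  let ?F = "Poly_Mapping.keys f \<union> Poly_Mapping.keys f'"
  have g: "g \<in> ?F \<rightarrow> carrier A" using assms by auto
  have "lin_ext A g (f + f') = (\<Oplus>k\<in>?F. Poly_Mapping.lookup (f + f') k \<odot> g k)"
    by (rule lin_ext_superset) (use g keys_add[of f f'] in auto)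
  also have "\<dots> = (\<Oplus>k\<in>?F. Poly_Mapping.lookup f k \<odot> g k \<oplus> Poly_Mapping.lookup f' k \<odot> g k)"
    by (rule finsum_cong') (use g in \<open>auto simp: lookup_add smult_l_distr Pi_iff\<close>)
  also have "\<dots> = lin_ext A g f \<oplus> lin_ext A g f'"
    using g by (simp add: lin_ext_superset[of ?F] finsum_addf Pi_iff)
  finally show ?thesis .
qed

lemma lin_ext_scale:
  assumes "Poly_Mapping.keys f \<subseteq> K" "g \<in> K \<rightarrow> carrier A"
  shows "lin_ext A g (scale_comb c f) = c \<odot> lin_ext A g f"
proof -
  let ?F = "Poly_Mapping.keys f"
  have g: "g \<in> ?F \<rightarrow> carrier A" using assms by auto
  have "lin_ext A g (scale_comb c f) = (\<Oplus>k\<in>?F. Poly_Mapping.lookup (scale_comb c f) k \<odot> g k)"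
    by (rule lin_ext_superset) (use g keys_scale_comb[of c f] in auto)
  also have "\<dots> = (\<Oplus>k\<in>?F. c \<odot> (Poly_Mapping.lookup f k \<odot> g k))"
    by (rule finsum_cong') (use g in \<open>auto simp: lookup_scale_comb smult_smult Pi_iff\<close>)
  also have "\<dots> = c \<odot> lin_ext A g f"
    unfolding lin_ext_def by (rule finsum_smult[symmetric]) (use g in auto)
  finally show ?thesis .
qed

lemma lin_ext_single:
  assumes "g k \<in> carrier A" shows "lin_ext A g (Poly_Mapping.single k c) = c \<odot> g k"
  using assms by (subst lin_ext_superset[of "{k}"]) (auto simp: finsum_singleton)

lemma lin_ext_zero [simp]: "lin_ext A g 0 = \<zero>"
  by (simp add: lin_ext_def)

lemma lin_ext_diff:
  assumes "Poly_Mapping.keys f \<subseteq> K" "Poly_Mapping.keys f' \<subseteq> K" "g \<in> K \<rightarrow> carrier A"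
  shows "lin_ext A g (f - f') = lin_ext A g f \<ominus> lin_ext A g f'"
proof -
  have "f - f' = f + scale_comb (- 1) f'"
    by (intro poly_mapping_eqI) (simp add: lookup_minus lookup_add lookup_scale_comb)
  moreover have "Poly_Mapping.keys (scale_comb (- 1) f') \<subseteq> K"
    using keys_scale_comb[of "- 1" f'] assms(2) by (rule order_trans)
  ultimately show ?thesis
    by (simp only: lin_ext_add[OF assms(1) _ assms(3)] lin_ext_scale[OF assms(2,3)]
      minus_eq minus_eq_smult[OF lin_ext_closed[OF assms(2,3)]])
qed

text \<open>Both sides of the multiplicativity law are bilinear, so it has to be known only on basis
  elements, where it is \<open>g_mult\<close>.\<close>

lemma lin_ext_hom:
  assumes "comb_algebra_data K m s e d"
    and g: "\<And>k. k \<in> K \<Longrightarrow> g k \<in> homog A (d k)"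
    and g_mult: "\<And>x y. x \<in> K \<Longrightarrow> y \<in> K \<Longrightarrow> s x y \<odot> g (m x y) = g x \<otimes> g y"
    and g_one: "g e = \<one>"
  shows "lin_ext A g \<in> galgebra_hom (comb_algebra K m s e d) A"
proof -
  interpret C: comb_algebra_data K m s e d by fact
  have gc: "g \<in> K \<rightarrow> carrier A" using g homog_carrier by blast
  have single: "lin_ext A g (Poly_Mapping.single k c) = c \<odot> g k" if "k \<in> K" for k c
    using that gc by (intro lin_ext_single) auto
  have mult: "lin_ext A g (comb_mult m s f f') = lin_ext A g f \<otimes> lin_ext A g f'"
    if f: "Poly_Mapping.keys f \<subseteq> K" and f': "Poly_Mapping.keys f' \<subseteq> K" for f f'
    using f
  proof (induct f rule: comb_supported_induct)
    case zero
    then show ?case by (simp add: lin_ext_closed[OF f' gc])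
  next
    case (single x a)
    note x = single
    show ?case using f'
    proof (induct f' rule: comb_supported_induct)
      case zero
      then show ?case using x gc by (simp add: lin_ext_single Pi_iff)
    next
      case (single y b)
      have gxy: "g x \<in> carrier A" "g y \<in> carrier A" "g (m x y) \<in> carrier A"
        using x single gc C.m_in by auto
      have "(s x y * a * b) \<odot> g (m x y) = (a * b) \<odot> (s x y \<odot> g (m x y))"
        using gxy by (simp add: smult_smult mult_ac)
      also have "\<dots> = (a \<odot> g x) \<otimes> (b \<odot> g y)"
        using gxy x single by (simp add: g_mult smult_mult_left smult_mult_right smult_smult mult.commute)
      finally show ?case using gxy by (simp add: comb_mult_single lin_ext_single)
    next
      case (add f' f'')
      have "Poly_Mapping.keys (Poly_Mapping.single x a) \<subseteq> K" using x by (simp add: keys_single)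
      with add show ?case
        by (simp add: comb_mult_add_right lin_ext_add[OF _ _ gc] C.mult_carrier
            lin_ext_closed[OF _ gc] r_distr)
    qed
  next
    case (add f1 f2)
    then show ?case
      by (simp add: comb_mult_add_left lin_ext_add[OF _ _ gc] C.mult_carrier f'
          lin_ext_closed[OF _ gc] l_distr)
  qed
  have homog: "lin_ext A g f \<in> homog A p" if "Poly_Mapping.keys f \<subseteq> {k \<in> K. d k = p}" for f p
    unfolding lin_ext_def by (rule homog_finsum) (use that g in \<open>auto intro!: homog_smult\<close>)
  show ?thesis
    unfolding galgebra_hom_def ring_hom_def comb_algebra_def
    using C.e_in by (auto simp: mult lin_ext_add[OF _ _ gc] lin_ext_scale[OF _ gc] single g_one
        homog lin_ext_closed[OF _ gc])
qed

end

section \<open>Quotients and subalgebras\<close>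

locale galgebra_ideal = galgebra + idl: ideal I A for I
begin

abbreviation quotient (\<open>Q\<close>) where "quotient \<equiv> quotient_algebra A I"

lemma quotient_carrier: "carrier Q = (\<lambda>x. I +> x) ` carrier A"
  unfolding quotient_algebra_def FactRing_def A_RCOSETS_def' by auto

lemma quotient_homog: "homog Q p = (\<lambda>x. I +> x) ` homog A p"
  by (simp add: quotient_algebra_def)

lemma quotient_mult: "x \<in> carrier A \<Longrightarrow> y \<in> carrier A \<Longrightarrow> (I +> x) \<otimes>\<^bsub>Q\<^esub> (I +> y) = I +> x \<otimes> y"
  by (simp add: quotient_algebra_def FactRing_def idl.rcoset_mult_add)

lemma quotient_add: "x \<in> carrier A \<Longrightarrow> y \<in> carrier A \<Longrightarrow> (I +> x) \<oplus>\<^bsub>Q\<^esub> (I +> y) = I +> (x \<oplus> y)"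
  by (simp add: quotient_algebra_def FactRing_def idl.a_rcos_sum)

lemma quotient_one: "\<one>\<^bsub>Q\<^esub> = I +> \<one>"
  by (simp add: quotient_algebra_def FactRing_def)

lemma quotient_zero: "\<zero>\<^bsub>Q\<^esub> = I +> \<zero>"
  using idl.a_subset by (simp add: quotient_algebra_def FactRing_def)

lemma coset_mem:
  assumes "x \<in> carrier A" "y \<in> I +> x" obtains i where "i \<in> I" "y = i \<oplus> x"
  using assms unfolding a_r_coset_def' by auto

lemma coset_add: "x \<in> carrier A \<Longrightarrow> i \<in> I \<Longrightarrow> I +> (i \<oplus> x) = I +> x"
  by (rule a_repr_independence[symmetric]) (auto simp: a_r_coset_def' idl.a_subgroup)

text \<open>A ring ideal is automatically a subspace, because scaling by \<open>c\<close> is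
  multiplication by \<open>c\<close> times the unit.\<close>

lemma smult_mem: "i \<in> I \<Longrightarrow> c \<odot> i \<in> I"
  using idl.I_l_closed[of i "c \<odot> \<one>"] by (simp add: smult_mult_left idl.Icarr)

text \<open>Scaling a coset is defined as a union over its representatives. All members of this
  union are the same coset, as representatives differ by elements of \<open>I\<close>, which is
  closed under scaling.\<close>

lemma quotient_smult:
  assumes x: "x \<in> carrier A"
  shows "c \<odot>\<^bsub>Q\<^esub> (I +> x) = I +> c \<odot> x"
proof -
  have "I +> c \<odot> y = I +> c \<odot> x" if y: "y \<in> I +> x" for y
  proof -
    from x y obtain i where i: "i \<in> I" "y = i \<oplus> x" by (rule coset_mem)
    then have "c \<odot> y = c \<odot> i \<oplus> c \<odot> x" using x by (simp add: smult_r_distr idl.Icarr)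
    with i x show ?thesis by (simp add: coset_add smult_mem)
  qed
  moreover have "x \<in> I +> x" using x by (rule idl.a_rcos_self)
  ultimately have "(\<Union>y\<in>I +> x. I +> c \<odot> y) = I +> c \<odot> x" by (intro UN_constant_eq ballI)
  then show ?thesis by (simp add: quotient_algebra_def)
qed

lemma galgebra_quotient: "galgebra Q"
proof -
  interpret Q: ring Q by (rule ring_quotient_algebra) (rule idl.ideal_axioms)
  note simps = quotient_mult quotient_add quotient_one quotient_zero quotient_smult
  show ?thesis
    by unfold_locales
      (auto simp: quotient_carrier quotient_homog simps smult_r_distr smult_l_distr smult_assoc1
        smult_mult_left smult_mult_right homog_carrier
        intro!: imageI homog_add homog_smult homog_mult)
qed

lemma quotient_proj: "(\<lambda>x. I +> x) \<in> galgebra_hom A Q"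
  unfolding galgebra_hom_def ring_hom_def
  by (auto simp: quotient_carrier quotient_homog quotient_mult quotient_add quotient_one quotient_smult)

lemma coset_zero: "i \<in> I \<Longrightarrow> I +> i = \<zero>\<^bsub>Q\<^esub>"
  using coset_add[of "\<zero>" i] by (simp add: quotient_zero idl.Icarr)

lemma quotient_lift:
  assumes B: "galgebra B" and h: "h \<in> galgebra_hom A B" and I: "\<And>x. x \<in> I \<Longrightarrow> h x = \<zero>\<^bsub>B\<^esub>"
  obtains k where "k \<in> galgebra_hom Q B" "\<And>x. x \<in> carrier A \<Longrightarrow> k (I +> x) = h x"
proof -
  interpret B: galgebra B by fact
  note hD = galgebra_homD[OF h]
  \<comment> \<open>Any representative in \<open>carrier A\<close> serves: \<open>h\<close> vanishes
    on \<open>I\<close> and is therefore constant on the coset.\<close>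
  define k where "k X = h (SOME x. x \<in> carrier A \<and> X = I +> x)" for X
  have k: "k (I +> x) = h x" if x: "x \<in> carrier A" for x
  proof -
    define y where "y = (SOME y. y \<in> carrier A \<and> I +> x = I +> y)"
    have "y \<in> carrier A \<and> I +> x = I +> y"
      unfolding y_def by (rule someI[of _ x]) (simp add: x)
    then have y: "y \<in> carrier A" "I +> x = I +> y" by auto
    then have "y \<in> I +> x" using idl.a_rcos_self[of y] by simp
    with x obtain i where "i \<in> I" "y = i \<oplus> x" by (rule coset_mem)
    then have "h y = h x" using x by (simp add: hD I idl.Icarr)
    then show ?thesis unfolding k_def y_def .
  qed
  have "k \<in> galgebra_hom Q B"
    unfolding galgebra_hom_def ring_hom_def
    by (auto simp: quotient_carrier quotient_homog quotient_mult quotient_add quotient_one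
        quotient_smult k hD homog_carrier)
  then show thesis using k by (rule that)
qed

end

text \<open>The kernel of \<open>h\<close> is an ideal, so it contains the generated ideal once it
  contains the generators.\<close>

lemma galgebra_hom_genideal:
  assumes A: "galgebra A" and B: "galgebra B" and h: "h \<in> galgebra_hom A B"
    and S: "S \<subseteq> carrier A" "\<And>x. x \<in> S \<Longrightarrow> h x = \<zero>\<^bsub>B\<^esub>" and x: "x \<in> genideal A S"
  shows "h x = \<zero>\<^bsub>B\<^esub>"
proof -
  interpret A: galgebra A by fact
  interpret B: galgebra B by fact
  have "ring_hom_ring A B h"
    using h by (intro ring_hom_ringI2 A.ring_axioms B.ring_axioms) (simp add: galgebra_hom_def)
  then have "ideal (a_kernel A B h) A" by (rule ring_hom_ring.kernel_is_ideal)
  moreover have "S \<subseteq> a_kernel A B h" using S by (auto simp: a_kernel_def')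
  ultimately have "genideal A S \<subseteq> a_kernel A B h" by (rule A.genideal_minimal)
  with x show ?thesis by (auto simp: a_kernel_def')
qed

context galgebra
begin

text \<open>Negation is scaling by -1, so closure under it follows from closure under scalars. The
  right-hand side is a list of plain closure conditions, which makes intersections easy to
  handle.\<close>

lemma subalgebra_iff:
  "subring B A \<and> (\<forall>c. \<forall>x\<in>B. c \<odot> x \<in> B) \<longleftrightarrow>
     B \<subseteq> carrier A \<and> \<one> \<in> B \<and> (\<forall>c. \<forall>x\<in>B. c \<odot> x \<in> B) \<and>
     (\<forall>x\<in>B. \<forall>y\<in>B. x \<otimes> y \<in> B) \<and> (\<forall>x\<in>B. \<forall>y\<in>B. x \<oplus> y \<in> B)"
  (is "?L \<longleftrightarrow> ?R")
proof
  assume L: ?L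
  then have "subring B A" ..
  with L show ?R using subringE(1,3,6,7)[of B A] by blast
next
  assume R: ?R
  have "subring B A"
  proof (rule subringI)
    fix x assume x: "x \<in> B"
    with R have "\<ominus> x = (- 1) \<odot> x" by (intro minus_eq_smult) blast
    with R x show "\<ominus> x \<in> B" by simp
  qed (use R in blast)+
  with R show ?L by blast
qed

end

locale galgebra_generated = galgebra +
  fixes S assumes S: "S \<subseteq> carrier A"
begin

abbreviation generated (\<open>D\<close>) where "generated \<equiv> generated_subalgebra A S"

lemma generated_simps [simp]:
  "monoid.mult D = monoid.mult A" "one D = one A" "zero D = zero A" "add D = add A" "smult D = smult A"
  "homog D p = homog A p \<inter> carrier D"
  by (simp_all add: generated_subalgebra_def Let_def)

lemma generated_carrier:
  "carrier D = \<Inter>{B. (subring B A \<and> (\<forall>c. \<forall>x \<in> B. c \<odot> x \<in> B)) \<and> S \<subseteq> B}"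
  by (simp add: generated_subalgebra_def Let_def)

text \<open>The elements of \<open>A\<close> with property \<open>P\<close> form a subalgebra
  containing \<open>S\<close>, hence one of the sets in the intersection. About its elements only
  membership in \<open>A\<close> is known, which is why the cases assume no more than that.\<close>

lemma generated_induct [consumes 1, case_names gen one smult mult add]:
  assumes "x \<in> carrier D"
    and "\<And>x. x \<in> S \<Longrightarrow> P x"
    and "P \<one>"
    and "\<And>c x. x \<in> carrier A \<Longrightarrow> P x \<Longrightarrow> P (c \<odot> x)"
    and "\<And>x y. x \<in> carrier A \<Longrightarrow> y \<in> carrier A \<Longrightarrow> P x \<Longrightarrow> P y \<Longrightarrow> P (x \<otimes> y)"
    and "\<And>x y. x \<in> carrier A \<Longrightarrow> y \<in> carrier A \<Longrightarrow> P x \<Longrightarrow> P y \<Longrightarrow> P (x \<oplus> y)"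
  shows "P x"
proof -
  have "subring {x \<in> carrier A. P x} A \<and> (\<forall>c. \<forall>x \<in> {x \<in> carrier A. P x}. c \<odot> x \<in> {x \<in> carrier A. P x})"
    unfolding subalgebra_iff using assms(3-6) by simp
  moreover have "S \<subseteq> {x \<in> carrier A. P x}" using assms(2) S by auto
  ultimately show ?thesis using assms(1) unfolding generated_carrier by auto
qed

lemma generated_subset: "carrier D \<subseteq> carrier A"
proof
  fix x assume "x \<in> carrier D"
  then show "x \<in> carrier A" by (induct rule: generated_induct) (use S in auto)
qed

lemma generated_closed:
  "x \<in> S \<Longrightarrow> x \<in> carrier D" "\<one> \<in> carrier D" "\<zero> \<in> carrier D"
  "x \<in> carrier D \<Longrightarrow> c \<odot> x \<in> carrier D"
  "x \<in> carrier D \<Longrightarrow> y \<in> carrier D \<Longrightarrow> x \<otimes> y \<in> carrier D"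
  "x \<in> carrier D \<Longrightarrow> y \<in> carrier D \<Longrightarrow> x \<oplus> y \<in> carrier D"
proof -
  show one: "\<one> \<in> carrier D"
    unfolding generated_carrier subalgebra_iff by blast
  show smult: "c \<odot> x \<in> carrier D" if "x \<in> carrier D" for c x
    using that unfolding generated_carrier subalgebra_iff by blast
  show "\<zero> \<in> carrier D" using smult[OF one, of 0] by simp
qed (unfold generated_carrier subalgebra_iff, blast+)

lemma galgebra_generated: "galgebra D"
proof -
  note in_A = subsetD[OF generated_subset]
  note closed = generated_closed(2-6)
  have inv: "\<exists>y\<in>carrier D. y \<oplus> x = \<zero>" if "x \<in> carrier D" for x
    using that closed(3)[of x "- 1"] in_A by (intro bexI[of _ "(- 1) \<odot> x"]) auto
  have "ring D"
  proof (rule ringI)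
    show "abelian_group D"
      by (rule abelian_groupI) (use inv in \<open>auto simp: closed in_A a_assoc intro: a_comm\<close>)
    show "Group.monoid D"
      by (rule Group.monoidI) (auto simp: closed in_A m_assoc)
  qed (auto simp: in_A l_distr r_distr)
  then show ?thesis
    unfolding galgebra_def galgebra_axioms_def
    by (auto simp: closed in_A smult_r_distr smult_l_distr smult_assoc1
        smult_mult_left smult_mult_right homog_carrier homog_add homog_smult homog_mult)
qed

end

section \<open>Monomials and boundaries\<close>

definition gmonom :: "'v graded_algebra \<Rightarrow> ('i \<Rightarrow> 'v) \<Rightarrow> 'i list \<Rightarrow> 'v" where
  "gmonom A x S = foldr (\<lambda>i y. x i \<otimes>\<^bsub>A\<^esub> y) S \<one>\<^bsub>A\<^esub>"

lemma gmonom_simps [simp]: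
  "gmonom A x [] = \<one>\<^bsub>A\<^esub>" "gmonom A x (i # S) = x i \<otimes>\<^bsub>A\<^esub> gmonom A x S"
  by (simp_all add: gmonom_def)

text \<open>A formal expression in the tuple, evaluated at an arbitrary family \<open>x\<close>; no
  boundary operator on \<open>A\<close> itself has to exist. The recursion is the Leibniz rule for
  splitting off the first entry, and \<open>gboundary_finsum\<close> recovers the alternating
  sum.\<close>

primrec gboundary :: "'v graded_algebra \<Rightarrow> ('i \<Rightarrow> 'v) \<Rightarrow> 'i list \<Rightarrow> 'v" where
  "gboundary A x [] = \<zero>\<^bsub>A\<^esub>"
| "gboundary A x (i # S) = gmonom A x S \<oplus>\<^bsub>A\<^esub> (- 1) \<odot>\<^bsub>A\<^esub> (x i \<otimes>\<^bsub>A\<^esub> gboundary A x S)"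

lemma gmonom_map: "gmonom A x (map f S) = gmonom A (x \<circ> f) S"
  by (induct S) auto

lemma gboundary_map: "gboundary A x (map f S) = gboundary A (x \<circ> f) S"
  by (induct S) (auto simp: gmonom_map o_def)

lemma gmonom_cong: "(\<And>i. i \<in> set S \<Longrightarrow> x i = y i) \<Longrightarrow> gmonom A x S = gmonom A y S"
  by (induct S) auto

lemma gboundary_cong: "(\<And>i. i \<in> set S \<Longrightarrow> x i = y i) \<Longrightarrow> gboundary A x S = gboundary A y S"
proof (induct S)
  case (Cons i S)
  then show ?case using gmonom_cong[of S x y A] by simp
qed simp

context galgebra
begin

lemma gmonom_closed [simp]: "x \<in> set S \<rightarrow> carrier A \<Longrightarrow> gmonom A x S \<in> carrier A"
  by (induct S) auto

lemma gboundary_closed [simp]: "x \<in> set S \<rightarrow> carrier A \<Longrightarrow> gboundary A x S \<in> carrier A"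
  by (induct S) auto

lemma gmonom_homog: "x \<in> set S \<rightarrow> homog A 1 \<Longrightarrow> gmonom A x S \<in> homog A (length S)"
proof (induct S)
  case (Cons i S)
  then show ?case using homog_mult[of "x i" 1 "gmonom A x S" "length S"] by simp
qed simp

lemma gmonom_append:
  "x \<in> set S \<rightarrow> carrier A \<Longrightarrow> x \<in> set S' \<rightarrow> carrier A \<Longrightarrow>
    gmonom A x (S @ S') = gmonom A x S \<otimes> gmonom A x S'"
  by (induct S) (auto simp: m_assoc)

text \<open>The Leibniz rule; the sign comes from passing the boundary across the entries of
  \<open>S\<close>.\<close>

lemma gboundary_append:
  assumes "x \<in> set S \<rightarrow> carrier A" "x \<in> set S' \<rightarrow> carrier A"
  shows "gboundary A x (S @ S') = gboundary A x S \<otimes> gmonom A x S' \<oplus>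
           (- 1) ^ length S \<odot> (gmonom A x S \<otimes> gboundary A x S')"
  using assms
proof (induct S)
  case (Cons i S)
  then have c: "x i \<in> carrier A" "gmonom A x S \<in> carrier A" "gboundary A x S \<in> carrier A"
    "gmonom A x S' \<in> carrier A" "gboundary A x S' \<in> carrier A"
    and xs: "x \<in> set S \<rightarrow> carrier A"
    by auto
  then show ?case
    by (simp add: Cons(1)[OF xs Cons(3)] gmonom_append[OF xs Cons(3)] smult_r_distr l_distr r_distr
        smult_mult_left smult_mult_right smult_smult m_assoc a_assoc)
qed simp

lemma gboundary_finsum:
  assumes "x \<in> set S \<rightarrow> carrier A"
  shows "gboundary A x S =
    (\<Oplus>k\<in>{..<length S}. (- 1) ^ k \<odot> gmonom A x (take k S @ drop (Suc k) S))"
  using assms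
proof (induct S)
  case (Cons i S)
  define g where "g k = (- 1) ^ k \<odot> gmonom A x (take k S @ drop (Suc k) S)" for k
  define G where "G k = (- 1) ^ k \<odot> gmonom A x (take k (i # S) @ drop (Suc k) (i # S))" for k
  have xi: "x i \<in> carrier A" and xs: "x \<in> set S \<rightarrow> carrier A" using Cons by auto
  have m: "gmonom A x (take k S @ drop (Suc k) S) \<in> carrier A" for k
    by (rule gmonom_closed) (use xs in \<open>auto dest: in_set_takeD in_set_dropD\<close>)
  have g: "g k \<in> carrier A" for k unfolding g_def using m by simp
  have G0: "G 0 = gmonom A x S" using xs by (simp add: G_def)
  \<comment> \<open>Deleting position \<open>Suc k\<close> of \<open>i # S\<close> keeps
    \<open>i\<close> in front of the deletion of position \<open>k\<close> from \<open>S\<close>;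
    the extra sign is the shift of the position by one.\<close>
  have GS: "G (Suc k) = (- 1) \<odot> (x i \<otimes> g k)" for k
    using m xi by (simp add: G_def g_def smult_mult_right smult_smult)
  have Gc: "G k \<in> carrier A" for k
    by (cases k) (use G0 GS g xi xs in auto)
  have "(\<Oplus>k\<in>{..<length (i # S)}. G k) = (\<Oplus>k\<in>insert 0 (Suc ` {..<length S}). G k)"
    by (simp add: lessThan_Suc_eq_insert_0)
  also have "\<dots> = G 0 \<oplus> (\<Oplus>k\<in>Suc ` {..<length S}. G k)"
    by (rule finsum_insert) (auto simp: Gc)
  also have "(\<Oplus>k\<in>Suc ` {..<length S}. G k) = (\<Oplus>k\<in>{..<length S}. G (Suc k))"
    by (rule finsum_reindex) (auto simp: Gc)
  also have "\<dots> = (- 1) \<odot> (x i \<otimes> (\<Oplus>k\<in>{..<length S}. g k))"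
    unfolding GS using g xi by (subst finsum_smult[symmetric], simp, simp, subst finsum_rdistr) auto
  finally show ?case using Cons(1)[OF xs] unfolding G_def[symmetric] g_def[symmetric] by (simp add: G0)
qed simp

end

lemma galgebra_hom_gmonom:
  assumes "galgebra A" "h \<in> galgebra_hom A B" "x \<in> set S \<rightarrow> carrier A"
  shows "h (gmonom A x S) = gmonom B (h \<circ> x) S"
proof -
  interpret galgebra A by fact
  show ?thesis using assms(3) by (induct S) (auto simp: galgebra_homD[OF assms(2)])
qed

lemma galgebra_hom_gboundary:
  assumes "galgebra A" "galgebra B" "h \<in> galgebra_hom A B" "x \<in> set S \<rightarrow> carrier A"
  shows "h (gboundary A x S) = gboundary B (h \<circ> x) S"
proof -
  interpret galgebra A by fact
  show ?thesis using assms(4)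
    by (induct S) (auto simp: galgebra_homD[OF assms(3)] galgebra_hom_zero[OF assms(1-3)]
        galgebra_hom_gmonom[OF assms(1,3)])
qed

section \<open>Calculus of monomials and boundaries in an anticommuting family of degree one\<close>

locale anticommuting = galgebra A for A :: "'v graded_algebra" (structure) +
  fixes E and x :: "'i \<Rightarrow> 'v"
  assumes deg_1: "i \<in> E \<Longrightarrow> x i \<in> homog A 1"
    and anticomm: "i \<in> E \<Longrightarrow> j \<in> E \<Longrightarrow> x i \<otimes> x j = (- 1) \<odot> (x j \<otimes> x i)"
begin

abbreviation "mnm \<equiv> gmonom A x"
abbreviation "bd \<equiv> gboundary A x"

lemma x_closed [simp]: "i \<in> E \<Longrightarrow> x i \<in> carrier A"
  using deg_1 homog_carrier by blast

lemma x_funcset [simp]: "F \<subseteq> E \<Longrightarrow> x \<in> F \<rightarrow> carrier A"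
  by auto

lemma square_zero: "i \<in> E \<Longrightarrow> x i \<otimes> x i = \<zero>"
  using anticomm[of i i] by (intro smult_eq_self_neg) auto

lemma square_zero_left: "i \<in> E \<Longrightarrow> y \<in> carrier A \<Longrightarrow> x i \<otimes> (x i \<otimes> y) = \<zero>"
  using square_zero[of i] m_assoc[of "x i" "x i" y] by simp

lemma anticomm_left:
  "i \<in> E \<Longrightarrow> j \<in> E \<Longrightarrow> y \<in> carrier A \<Longrightarrow> x i \<otimes> (x j \<otimes> y) = (- 1) \<odot> (x j \<otimes> (x i \<otimes> y))"
  using anticomm[of i j] m_assoc[of "x i" "x j" y] m_assoc[of "x j" "x i" y]
  by (simp add: smult_mult_left)

lemma mon_closed [simp]: "set S \<subseteq> E \<Longrightarrow> mnm S \<in> carrier A"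
  and bd_closed [simp]: "set S \<subseteq> E \<Longrightarrow> bd S \<in> carrier A"
  by simp_all

lemma comm_mon: "i \<in> E \<Longrightarrow> set S \<subseteq> E \<Longrightarrow> x i \<otimes> mnm S = (- 1) ^ length S \<odot> (mnm S \<otimes> x i)"
proof (induct S)
  case (Cons j S)
  then have "x i \<otimes> mnm (j # S) = (- 1) \<odot> (x j \<otimes> (x i \<otimes> mnm S))"
    by (simp add: anticomm_left)
  with Cons show ?case by (simp add: smult_mult_right smult_smult m_assoc)
qed simp

lemma mon_mult_comm:
  "set S \<subseteq> E \<Longrightarrow> set S' \<subseteq> E \<Longrightarrow>
    mnm S \<otimes> mnm S' = (- 1) ^ (length S * length S') \<odot> (mnm S' \<otimes> mnm S)"
proof (induct S)
  case (Cons i S)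
  then have "mnm (i # S) \<otimes> mnm S' = (- 1) ^ (length S * length S') \<odot> ((x i \<otimes> mnm S') \<otimes> mnm S)"
    by (simp add: m_assoc smult_mult_right)
  also have "\<dots> = ((- 1) ^ (length S * length S') * (- 1) ^ length S') \<odot> (mnm S' \<otimes> mnm (i # S))"
    using Cons by (simp add: comm_mon smult_mult_left smult_smult m_assoc)
  finally show ?case by (simp add: power_add mult.commute)
qed simp

text \<open>Expanding twice gives \<open>x l\<close> times \<open>mnm S\<close>, minus
  \<open>x k\<close> times \<open>mnm S\<close>, plus \<open>x k\<close> times \<open>x l\<close>
  times \<open>bd S\<close>, which is antisymmetric in \<open>k\<close> and
  \<open>l\<close>.\<close>

lemma bd_swap:
  assumes "i \<in> E" "j \<in> E" "set S \<subseteq> E"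
  shows "bd (i # j # S) = (- 1) \<odot> bd (j # i # S)"
proof -
  have c: "x i \<in> carrier A" "x j \<in> carrier A" "mnm S \<in> carrier A" "bd S \<in> carrier A"
    using assms by auto
  have "bd (k # l # S) = x l \<otimes> mnm S \<oplus> (- 1) \<odot> (x k \<otimes> mnm S) \<oplus> x k \<otimes> (x l \<otimes> bd S)"
    if "k \<in> E" "l \<in> E" for k l
    using that c by (simp add: r_distr smult_r_distr smult_mult_right smult_smult a_assoc)
  then show ?thesis
    using assms c anticomm_left[of j i "bd S"]
    by (simp add: smult_r_distr smult_smult a_ac)
qed

text \<open>Monomial and boundary are treated together because the boundary of \<open>j # S\<close>
  contains the monomial of \<open>S\<close>; the induction for one needs the other with the same
  sign.\<close>

lemma move_to_front:
  "set (S1 @ i # S2) \<subseteq> E \<Longrightarrow>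
    mnm (S1 @ i # S2) = (- 1) ^ length S1 \<odot> mnm (i # S1 @ S2) \<and>
    bd (S1 @ i # S2) = (- 1) ^ length S1 \<odot> bd (i # S1 @ S2)"
proof (induct S1)
  case (Cons j S1)
  let ?c = "(- 1) ^ length S1"
  have E: "i \<in> E" "j \<in> E" "set (S1 @ S2) \<subseteq> E" "set (i # S1 @ S2) \<subseteq> E"
    and IH: "mnm (S1 @ i # S2) = ?c \<odot> mnm (i # S1 @ S2)"
      "bd (S1 @ i # S2) = ?c \<odot> bd (i # S1 @ S2)"
    using Cons by auto
  have "mnm ((j # S1) @ i # S2) = ?c \<odot> (x j \<otimes> (x i \<otimes> mnm (S1 @ S2)))"
    using E(1-3) unfolding append_Cons gmonom_simps(2) IH by (simp add: smult_mult_right)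
  also have "\<dots> = (- 1) ^ length (j # S1) \<odot> mnm (i # (j # S1) @ S2)"
    using E(1-3) by (simp add: anticomm_left[of j i] smult_smult mult.commute)
  finally have mnm: "mnm ((j # S1) @ i # S2) = (- 1) ^ length (j # S1) \<odot> mnm (i # (j # S1) @ S2)" .
  have "bd ((j # S1) @ i # S2) = ?c \<odot> bd (j # i # S1 @ S2)"
    using mon_closed[OF E(4)] bd_closed[OF E(4)] E(2)
    unfolding append_Cons gboundary.simps(2)[of _ _ j] IH
    by (simp add: smult_r_distr smult_mult_right smult_smult mult.commute del: gmonom_simps gboundary.simps)
  also have "\<dots> = (- 1) ^ length (j # S1) \<odot> bd (i # (j # S1) @ S2)"
    using E bd_closed[of "i # j # S1 @ S2"] unfolding bd_swap[OF E(2,1,3)]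
    by (simp add: smult_smult mult.commute del: gboundary.simps)
  finally show ?case using mnm by blast
qed simp

text \<open>Once the second \<open>i\<close> stands next to the first, swapping the two changes the
  sign but not the tuple.\<close>

lemma bd_repeated:
  assumes "i \<in> set S" "set S \<subseteq> E"
  shows "bd (i # S) = \<zero>"
proof -
  obtain S1 S2 where S: "S = S1 @ i # S2" using assms(1) by (meson split_list)
  have E: "i \<in> E" "set (S1 @ S2) \<subseteq> E" using assms S by auto
  have "bd (i # S) = (- 1) ^ length (i # S1) \<odot> bd (i # i # S1 @ S2)"
    using move_to_front[of "i # S1" i S2] assms S by simp
  also have "bd (i # i # S1 @ S2) = \<zero>"
    using E bd_swap[of i i "S1 @ S2"] by (intro smult_eq_self_neg bd_closed) auto
  finally show ?thesis by simp
qed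

text \<open>For an entry \<open>i\<close> of \<open>S\<close> the boundary of \<open>i # S\<close>
  vanishes by repetition, and unfolding it says that the monomial of \<open>S\<close> is
  \<open>x i\<close> times the boundary of \<open>S\<close>. A nonempty \<open>S\<close> is needed
  to supply \<open>i\<close>: the empty tuple has boundary 0 but monomial 1.\<close>

lemma mon_eq_zero:
  assumes "bd S = \<zero>" "S \<noteq> []" "set S \<subseteq> E"
  shows "mnm S = \<zero>"
proof -
  obtain i where i: "i \<in> set S" using assms(2) by (cases S) auto
  with assms have "x i \<in> carrier A" by auto
  then show ?thesis using bd_repeated[OF i assms(3)] assms by simp
qed

text \<open>The scalar is the sign of the rearrangement. Only vanishing is of interest, so it
  suffices that one scalar serves both the monomial and the boundary, and its value is not
  recorded.\<close>

lemma bd_mset: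
  "mset S = mset S' \<Longrightarrow> set S \<subseteq> E \<Longrightarrow> \<exists>c. mnm S = c \<odot> mnm S' \<and> bd S = c \<odot> bd S'"
proof (induct S arbitrary: S')
  case Nil
  then show ?case by (intro exI[of _ 1]) simp
next
  case (Cons i T)
  have "i \<in> set S'" using Cons(2) by (metis list.set_intros(1) set_mset_mset)
  then obtain S1 S2 where S': "S' = S1 @ i # S2" by (meson split_list)
  have sets: "set (S1 @ S2) = set T"
    using Cons(2) S' by (intro mset_eq_setD) simp
  then have E: "i \<in> E" "set T \<subseteq> E" "set (S1 @ S2) \<subseteq> E" using Cons(3) by auto
  have "mset T = mset (S1 @ S2)" using Cons(2) S' by simp
  from Cons(1)[OF this E(2)] obtain c where c: "mnm T = c \<odot> mnm (S1 @ S2)" "bd T = c \<odot> bd (S1 @ S2)"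
    by blast
  let ?d = "(- 1) ^ length S1"
  have d: "mnm (i # S1 @ S2) = ?d \<odot> mnm S'" "bd (i # S1 @ S2) = ?d \<odot> bd S'"
    using move_to_front[of S1 i S2] mon_closed[of "i # S1 @ S2"] bd_closed[of "i # S1 @ S2"] E S'
    by (simp_all add: smult_smult power_mult_distrib[symmetric] del: gmonom_simps gboundary.simps)
  have "mnm (i # T) = c \<odot> mnm (i # S1 @ S2)"
    using E c by (simp add: smult_mult_right)
  moreover have "bd (i # T) = c \<odot> bd (i # S1 @ S2)"
    using E c by (simp add: smult_mult_right smult_r_distr smult_smult mult.commute)
  moreover have "mnm S' \<in> carrier A" "bd S' \<in> carrier A" using E S' by auto
  ultimately have "mnm (i # T) = (c * ?d) \<odot> mnm S'" "bd (i # T) = (c * ?d) \<odot> bd S'"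
    unfolding d by (simp_all add: smult_smult)
  then show ?case by blast
qed

text \<open>This reduces dependent sets to circuits. Up to a scalar \<open>S\<close> is
  \<open>C\<close> followed by the remaining entries, and in the Leibniz rule one term contains the
  boundary of \<open>C\<close>, the other its monomial, which vanishes by
  \<open>mon_eq_zero\<close>.\<close>

lemma bd_superset:
  assumes "bd C = \<zero>" "C \<noteq> []" "distinct C" "distinct S" "set C \<subseteq> set S" "set S \<subseteq> E"
  shows "bd S = \<zero>"
proof -
  define R where "R = filter (\<lambda>i. i \<notin> set C) S"
  have E: "set C \<subseteq> E" "set R \<subseteq> E" using assms unfolding R_def by auto
  have "mset S = mset (C @ R)"
    by (rule set_eq_iff_mset_eq_distinct[THEN iffD1]) (use assms in \<open>auto simp: R_def\<close>)
  from bd_mset[OF this assms(6)] obtain c where "bd S = c \<odot> bd (C @ R)" by blast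
  moreover have "bd (C @ R) = \<zero>"
    using E by (simp add: gboundary_append assms(1) mon_eq_zero[OF assms(1,2) E(1)])
  ultimately show ?thesis by simp
qed

text \<open>Invariance of the boundary cannot be proved alone by induction, since the recursion also
  involves the shifted monomial. The latter equals \<open>bd (b # S)\<close>, written out here;
  terms with two factors \<open>x b\<close> vanish.\<close>

lemma shift:
  assumes b: "b \<in> E" and S: "set S \<subseteq> E"
  defines "y \<equiv> \<lambda>i. x i \<oplus> (- 1) \<odot> x b"
  shows "gmonom A y S = mnm S \<oplus> (- 1) \<odot> (x b \<otimes> bd S) \<and> gboundary A y S = bd S"
  using S
proof (induct S)
  case Nil
  then show ?case using b by simp
next
  case (Cons i S)
  have c: "x i \<in> carrier A" "x b \<in> carrier A" "mnm S \<in> carrier A" "bd S \<in> carrier A"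
    and i: "i \<in> E" using Cons b by auto
  have IH: "gmonom A y S = mnm S \<oplus> (- 1) \<odot> (x b \<otimes> bd S)" "gboundary A y S = bd S" using Cons by auto
  have oi: "x i \<otimes> (x b \<otimes> bd S) = (- 1) \<odot> (x b \<otimes> (x i \<otimes> bd S))"
    using anticomm_left[OF i b c(4)] .
  have oo: "x b \<otimes> (x b \<otimes> bd S) = \<zero>" using b c(4) by (rule square_zero_left)
  have yi: "y i = x i \<oplus> (- 1) \<odot> x b" by (simp add: y_def)
  \<comment> \<open>One copy of this product comes from the formula for the shifted monomial, the
    other from the summand \<open>x b\<close> in \<open>y i\<close>, with opposite signs.\<close>
  have cancel: "x b \<otimes> bd S \<oplus> ((- 1) \<odot> (x b \<otimes> bd S) \<oplus> z) = z" if "z \<in> carrier A" for z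
    using c that by (simp add: a_assoc[symmetric])
  have "gboundary A y (i # S) = bd (i # S)"
    using c by (simp add: IH yi l_distr r_distr smult_r_distr smult_mult_left smult_mult_right smult_smult a_ac cancel)
  moreover have "gmonom A y (i # S) = mnm (i # S) \<oplus> (- 1) \<odot> (x b \<otimes> bd (i # S))"
    using c by (simp add: IH yi l_distr r_distr smult_r_distr smult_mult_left smult_mult_right smult_smult
        a_ac oi oo)
  ultimately show ?case by simp
qed

lemma anticommuting_shift:
  assumes b: "b \<in> E"
  shows "anticommuting A E (\<lambda>i. x i \<oplus> (- 1) \<odot> x b)"
proof unfold_locales
  fix i assume i: "i \<in> E"
  then show "x i \<oplus> (- 1) \<odot> x b \<in> homog A 1" using b by (intro homog_add homog_smult deg_1)
  fix j assume j: "j \<in> E"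
  have c: "x i \<in> carrier A" "x j \<in> carrier A" "x b \<in> carrier A" using i j b by auto
  show "(x i \<oplus> (- 1) \<odot> x b) \<otimes> (x j \<oplus> (- 1) \<odot> x b) = (- 1) \<odot> ((x j \<oplus> (- 1) \<odot> x b) \<otimes> (x i \<oplus> (- 1) \<odot> x b))"
    using c anticomm[OF i j] anticomm[OF i b] anticomm[OF j b] square_zero[OF b]
    by (simp add: l_distr r_distr smult_r_distr smult_mult_left smult_mult_right smult_smult a_ac)
qed

end

section \<open>The exterior and Orlik-Solomon algebras\<close>

lemma tensor_algebra_data: "comb_algebra_data {w. set w \<subseteq> E} (@) (\<lambda>_ _. 1) [] length"
  by unfold_locales auto

lemma tensor_algebra_eq:
  "tensor_algebra E = comb_algebra {w. set w \<subseteq> E} (@) (\<lambda>_ _. 1) [] length"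
  by (simp add: tensor_algebra_def comb_algebra_def)

lemma galgebra_tensor: "galgebra (tensor_algebra E)"
  unfolding tensor_algebra_eq
  by (rule comb_algebra_data.galgebra_comb_algebra[OF tensor_algebra_data])

text \<open>
  In degree \<open>p\<close> the monomials of length \<open>p\<close> span; this is phrased as an induction principle.
\<close>

definition monom_spanned :: "'v graded_algebra \<Rightarrow> 'i set \<Rightarrow> ('i \<Rightarrow> 'v) \<Rightarrow> bool" where
  "monom_spanned A E x \<longleftrightarrow>
     (\<forall>p P. P \<zero>\<^bsub>A\<^esub> \<longrightarrow> (\<forall>w. set w \<subseteq> E \<longrightarrow> length w = p \<longrightarrow> P (gmonom A x w)) \<longrightarrow>
        (\<forall>c. \<forall>u \<in> homog A p. P u \<longrightarrow> P (c \<odot>\<^bsub>A\<^esub> u)) \<longrightarrow>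
        (\<forall>u \<in> homog A p. \<forall>v \<in> homog A p. P u \<longrightarrow> P v \<longrightarrow> P (u \<oplus>\<^bsub>A\<^esub> v)) \<longrightarrow>
        (\<forall>u \<in> homog A p. P u))"

lemma monom_spanned_induct [consumes 2, case_names zero monom smult add]:
  assumes "monom_spanned A E x" "u \<in> homog A p"
    and "P \<zero>\<^bsub>A\<^esub>"
    and "\<And>w. set w \<subseteq> E \<Longrightarrow> length w = p \<Longrightarrow> P (gmonom A x w)"
    and "\<And>c u. u \<in> homog A p \<Longrightarrow> P u \<Longrightarrow> P (c \<odot>\<^bsub>A\<^esub> u)"
    and "\<And>u v. u \<in> homog A p \<Longrightarrow> v \<in> homog A p \<Longrightarrow> P u \<Longrightarrow> P v \<Longrightarrow> P (u \<oplus>\<^bsub>A\<^esub> v)"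
  shows "P u"
  using assms(1)[unfolded monom_spanned_def, rule_format, of P p u] assms(2-) by blast

text \<open>The predicate on \<open>B\<close> is pulled back along \<open>h\<close>. Surjectivity is
  required degree by degree, because the induction on the preimage has to take place in the same
  degree.\<close>

lemma monom_spanned_hom:
  assumes A: "galgebra A" and B: "galgebra B" and h: "h \<in> galgebra_hom A B"
    and onto: "\<And>p. homog B p \<subseteq> h ` homog A p"
    and span: "monom_spanned A E x" and x: "x \<in> E \<rightarrow> carrier A"
  shows "monom_spanned B E (h \<circ> x)"
  unfolding monom_spanned_def
proof (intro allI impI ballI)
  fix p P v
  assume P_zero: "P \<zero>\<^bsub>B\<^esub>"
    and P_monom: "\<forall>w. set w \<subseteq> E \<longrightarrow> length w = p \<longrightarrow> P (gmonom B (h \<circ> x) w)"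
    and P_smult: "\<forall>c. \<forall>u\<in>homog B p. P u \<longrightarrow> P (c \<odot>\<^bsub>B\<^esub> u)"
    and P_add: "\<forall>u\<in>homog B p. \<forall>v\<in>homog B p. P u \<longrightarrow> P v \<longrightarrow> P (u \<oplus>\<^bsub>B\<^esub> v)"
    and v: "v \<in> homog B p"
  interpret A: galgebra A by fact
  obtain u where u: "u \<in> homog A p" "v = h u" using onto v by blast
  have "P (h u)" using span u(1)
  proof (induct rule: monom_spanned_induct)
    case zero
    then show ?case using P_zero by (simp add: galgebra_hom_zero[OF A B h])
  next
    case (monom w)
    have "x \<in> set w \<rightarrow> carrier A" using monom x by auto
    then have "h (gmonom A x w) = gmonom B (h \<circ> x) w" by (rule galgebra_hom_gmonom[OF A h])
    then show ?case using monom P_monom by simp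
  next
    case (smult c u)
    then show ?case
      using P_smult galgebra_homD(6)[OF h] by (simp add: galgebra_homD(5)[OF h] A.homog_carrier)
  next
    case (add u v)
    then show ?case
      using P_add galgebra_homD(6)[OF h]
      by (simp add: galgebra_homD(3)[OF h] A.homog_carrier)
  qed
  then show "P v" using u by simp
qed

lemma tensor_gmonom:
  "gmonom (tensor_algebra E) (\<lambda>i. Poly_Mapping.single [i] 1) w = Poly_Mapping.single w 1"
  by (induct w) (simp_all add: tensor_algebra_def comb_mult_single)

lemma tensor_gen: "i \<in> E \<Longrightarrow> Poly_Mapping.single [i] 1 \<in> homog (tensor_algebra E) 1"
  by (simp add: tensor_algebra_def keys_single)

lemma tensor_monom_spanned:
  "monom_spanned (tensor_algebra E) E (\<lambda>i. Poly_Mapping.single [i] 1)"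
  unfolding monom_spanned_def tensor_gmonom
proof (intro allI impI ballI)
  fix p P u
  assume P_zero: "P \<zero>\<^bsub>tensor_algebra E\<^esub>"
    and P_monom: "\<forall>w. set w \<subseteq> E \<longrightarrow> length w = p \<longrightarrow> P (Poly_Mapping.single w (1::complex))"
    and P_smult: "\<forall>c. \<forall>u\<in>homog (tensor_algebra E) p. P u \<longrightarrow> P (c \<odot>\<^bsub>tensor_algebra E\<^esub> u)"
    and P_add: "\<forall>u\<in>homog (tensor_algebra E) p. \<forall>v\<in>homog (tensor_algebra E) p.
      P u \<longrightarrow> P v \<longrightarrow> P (u \<oplus>\<^bsub>tensor_algebra E\<^esub> v)"
    and u: "u \<in> homog (tensor_algebra E) p"
  let ?K = "{w. set w \<subseteq> E \<and> length w = p}"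
  have homog: "f \<in> homog (tensor_algebra E) p \<longleftrightarrow> Poly_Mapping.keys f \<subseteq> ?K" for f
    by (simp add: tensor_algebra_def)
  have "Poly_Mapping.keys u \<subseteq> ?K" using u homog by blast
  then show "P u"
  proof (induct u rule: comb_supported_induct)
    case zero
    then show ?case using P_zero by (simp add: tensor_algebra_def)
  next
    case (single w v)
    then have "P (Poly_Mapping.single w 1)" "Poly_Mapping.single w 1 \<in> homog (tensor_algebra E) p"
      using P_monom homog by (simp_all add: keys_single)
    then have "P (v \<odot>\<^bsub>tensor_algebra E\<^esub> Poly_Mapping.single w 1)" using P_smult by blast
    then show ?case by (simp add: tensor_algebra_def scale_comb_single)
  next
    case (add f g)
    then have "P (f \<oplus>\<^bsub>tensor_algebra E\<^esub> g)"
      using P_add homog by blast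
    then show ?case by (simp add: tensor_algebra_def)
  qed
qed

lemma tensor_lift:
  assumes B: "galgebra B" and y: "y \<in> E \<rightarrow> homog B 1"
  obtains h where "h \<in> galgebra_hom (tensor_algebra E) B" "\<And>i. i \<in> E \<Longrightarrow> h (Poly_Mapping.single [i] 1) = y i"
proof
  interpret B: galgebra B by fact
  have yc: "y \<in> E \<rightarrow> carrier B" using y B.homog_carrier by auto
  show "lin_ext B (gmonom B y) \<in> galgebra_hom (tensor_algebra E) B"
    unfolding tensor_algebra_eq
  proof (rule B.lin_ext_hom[OF tensor_algebra_data])
    fix w assume "w \<in> {w. set w \<subseteq> E}"
    then show "gmonom B y w \<in> homog B (length w)" using y by (intro B.gmonom_homog) auto
    fix w' assume "w' \<in> {w. set w \<subseteq> E}"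
    with \<open>w \<in> {w. set w \<subseteq> E}\<close> show "1 \<odot>\<^bsub>B\<^esub> gmonom B y (w @ w') = gmonom B y w \<otimes>\<^bsub>B\<^esub> gmonom B y w'"
      using yc by (subst B.gmonom_append) (auto intro!: B.smult_one B.m_closed B.gmonom_closed)
  qed simp
  show "lin_ext B (gmonom B y) (Poly_Mapping.single [i] 1) = y i" if "i \<in> E" for i
    using that yc by (subst B.lin_ext_single) (auto simp: Pi_iff)
qed

section \<open>The exterior algebra and its universal property\<close>

lemma tensor_ideal: "galgebra_ideal (tensor_algebra E) (exterior_ideal E)"
  by (intro galgebra_ideal.intro galgebra_tensor ideal_exterior_ideal)

lemma galgebra_exterior: "galgebra (exterior_algebra E)"
  unfolding exterior_algebra_def by (rule galgebra_ideal.galgebra_quotient[OF tensor_ideal])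

lemma exterior_proj:
  "(\<lambda>u. exterior_ideal E +>\<^bsub>tensor_algebra E\<^esub> u) \<in> galgebra_hom (tensor_algebra E) (exterior_algebra E)"
  unfolding exterior_algebra_def by (rule galgebra_ideal.quotient_proj[OF tensor_ideal])

lemma exterior_square_zero:
  assumes "u \<in> homog (exterior_algebra E) 1"
  shows "u \<otimes>\<^bsub>exterior_algebra E\<^esub> u = \<zero>\<^bsub>exterior_algebra E\<^esub>"
proof -
  interpret ext: galgebra_ideal "tensor_algebra E" "exterior_ideal E" by (rule tensor_ideal)
  let ?T = "tensor_algebra E"
  obtain v where v: "v \<in> homog ?T 1" "u = exterior_ideal E +>\<^bsub>?T\<^esub> v"
    using assms unfolding exterior_algebra_def ext.quotient_homog by blast
  have vc: "v \<in> carrier ?T" using v(1) by (rule ext.homog_carrier)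
  have gens: "{v \<otimes>\<^bsub>?T\<^esub> v | v. v \<in> homog ?T 1} \<subseteq> carrier ?T"
    using ext.homog_carrier by blast
  have "v \<otimes>\<^bsub>?T\<^esub> v \<in> exterior_ideal E"
    unfolding exterior_ideal_def by (rule subsetD[OF ext.genideal_self[OF gens]]) (use v in blast)
  then have "exterior_ideal E +>\<^bsub>?T\<^esub> (v \<otimes>\<^bsub>?T\<^esub> v) = \<zero>\<^bsub>exterior_algebra E\<^esub>"
    unfolding exterior_algebra_def by (rule ext.coset_zero)
  then show ?thesis
    unfolding v(2) using galgebra_homD(2)[OF exterior_proj vc vc] by simp
qed

text \<open>Polarisation: expand the square of the sum of two generators, which is zero like the
  squares of the generators themselves.\<close>

lemma anticommuting_exterior: "anticommuting (exterior_algebra E) E (ext_gen E)"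
proof -
  interpret ext: galgebra_ideal "tensor_algebra E" "exterior_ideal E" by (rule tensor_ideal)
  interpret X: galgebra "exterior_algebra E" by (rule galgebra_exterior)
  have deg: "ext_gen E i \<in> homog (exterior_algebra E) 1" if "i \<in> E" for i
    unfolding ext_gen_def using galgebra_homD(6)[OF exterior_proj] tensor_gen[OF that] by blast
  show ?thesis
  proof unfold_locales
    show "ext_gen E i \<in> homog (exterior_algebra E) 1" if "i \<in> E" for i using that by (rule deg)
    fix i j assume "i \<in> E" "j \<in> E"
    then have h: "ext_gen E i \<in> homog (exterior_algebra E) 1" "ext_gen E j \<in> homog (exterior_algebra E) 1"
      using deg by blast+
    note c = h[THEN X.homog_carrier]
    let ?ij = "ext_gen E i \<otimes>\<^bsub>exterior_algebra E\<^esub> ext_gen E j"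
    let ?ji = "ext_gen E j \<otimes>\<^bsub>exterior_algebra E\<^esub> ext_gen E i"
    have "?ij \<oplus>\<^bsub>exterior_algebra E\<^esub> ?ji = \<zero>\<^bsub>exterior_algebra E\<^esub>"
      using exterior_square_zero[OF X.homog_add[OF h]] c
      by (simp add: X.l_distr X.r_distr exterior_square_zero[OF h(1)] exterior_square_zero[OF h(2)] X.a_comm)
    then have "\<ominus>\<^bsub>exterior_algebra E\<^esub> ?ji = ?ij"
      using c by (intro X.minus_equality) auto
    then show "?ij = (- 1) \<odot>\<^bsub>exterior_algebra E\<^esub> ?ji" using c by (simp add: X.minus_eq_smult)
  qed
qed

lemma exterior_monom_spanned: "monom_spanned (exterior_algebra E) E (ext_gen E)"
proof -
  interpret ext: galgebra_ideal "tensor_algebra E" "exterior_ideal E" by (rule tensor_ideal)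
  have "monom_spanned (exterior_algebra E) E
      ((\<lambda>u. exterior_ideal E +>\<^bsub>tensor_algebra E\<^esub> u) \<circ> (\<lambda>i. Poly_Mapping.single [i] 1))"
    by (rule monom_spanned_hom[OF galgebra_tensor galgebra_exterior exterior_proj _ tensor_monom_spanned])
       (use ext.homog_carrier[OF tensor_gen] in \<open>auto simp: exterior_algebra_def ext.quotient_homog\<close>)
  then show ?thesis by (simp add: o_def ext_gen_def[abs_def])
qed

text \<open>The exterior ideal is generated by the squares of all degree-one tensors, not just of
  the generators. Two nested inductions extend anticommutation from \<open>y\<close> to the images
  of all degree-one tensors; for equal arguments it makes the square its own negative, hence
  zero.\<close>

lemma exterior_lift:
  assumes y: "anticommuting B E y"
  obtains h where "h \<in> galgebra_hom (exterior_algebra E) B" "\<And>i. i \<in> E \<Longrightarrow> h (ext_gen E i) = y i"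
proof -
  interpret B: anticommuting B E y by fact
  interpret ext: galgebra_ideal "tensor_algebra E" "exterior_ideal E" by (rule tensor_ideal)
  let ?T = "tensor_algebra E"
  have B: "galgebra B" by unfold_locales
  have y1: "y \<in> E \<rightarrow> homog B 1" using B.deg_1 by auto
  obtain h where h: "h \<in> galgebra_hom ?T B" and hy: "\<And>i. i \<in> E \<Longrightarrow> h (Poly_Mapping.single [i] 1) = y i"
    using tensor_lift[OF B y1] by blast
  note hD = galgebra_homD[OF h]
  have h1: "h (gmonom ?T (\<lambda>i. Poly_Mapping.single [i] 1) w) \<in> y ` E"
    if "set w \<subseteq> E" "length w = 1" for w
    unfolding tensor_gmonom using that hy by (cases w) auto
  have comm: "h u \<otimes>\<^bsub>B\<^esub> h v = (- 1) \<odot>\<^bsub>B\<^esub> (h v \<otimes>\<^bsub>B\<^esub> h u)"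
    if u: "u \<in> homog ?T 1" and v: "v \<in> homog ?T 1" for u v
    using tensor_monom_spanned u
  proof (induct rule: monom_spanned_induct)
    case zero
    then show ?case
      using v ext.homog_carrier by (auto simp: galgebra_hom_zero[OF galgebra_tensor B h] hD)
  next
    case (monom w)
    then obtain i where i: "i \<in> E" "h (gmonom ?T (\<lambda>i. Poly_Mapping.single [i] 1) w) = y i"
      using h1 by blast
    have "y i \<otimes>\<^bsub>B\<^esub> h v = (- 1) \<odot>\<^bsub>B\<^esub> (h v \<otimes>\<^bsub>B\<^esub> y i)"
      using tensor_monom_spanned v
    proof (induct rule: monom_spanned_induct)
      case zero
      then show ?case using i by (simp add: galgebra_hom_zero[OF galgebra_tensor B h])
    next
      case (monom w)
      then obtain j where "j \<in> E" "h (gmonom ?T (\<lambda>i. Poly_Mapping.single [i] 1) w) = y j"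
        using h1 by blast
      then show ?case using B.anticomm[OF i(1)] by simp
    next
      case (smult c u)
      then show ?case using i ext.homog_carrier[OF smult(1)]
        by (simp add: hD B.smult_mult_left B.smult_mult_right B.smult_smult mult.commute)
    next
      case (add u v)
      then show ?case using i ext.homog_carrier[OF add(1)] ext.homog_carrier[OF add(2)]
        by (simp add: hD B.l_distr B.r_distr B.smult_r_distr)
    qed
    then show ?case using i by simp
  next
    case (smult c u)
    then show ?case using ext.homog_carrier[OF smult(1)] ext.homog_carrier[OF v]
      by (simp add: hD B.smult_mult_left B.smult_mult_right B.smult_smult mult.commute)
  next
    case (add u u')
    then show ?case using ext.homog_carrier[OF add(1)] ext.homog_carrier[OF add(2)] ext.homog_carrier[OF v]
      by (simp add: hD B.l_distr B.r_distr B.smult_r_distr)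
  qed
  have "h u = \<zero>\<^bsub>B\<^esub>" if "u \<in> exterior_ideal E" for u
  proof (rule galgebra_hom_genideal[OF galgebra_tensor B h _ _ that[unfolded exterior_ideal_def]])
    show "{v \<otimes>\<^bsub>?T\<^esub> v | v. v \<in> homog ?T 1} \<subseteq> carrier ?T"
      using ext.homog_carrier by blast
    fix x assume "x \<in> {v \<otimes>\<^bsub>?T\<^esub> v | v. v \<in> homog ?T 1}"
    then obtain v where v: "v \<in> homog ?T 1" "x = v \<otimes>\<^bsub>?T\<^esub> v" by blast
    then have "h x = h v \<otimes>\<^bsub>B\<^esub> h v" using hD(2) ext.homog_carrier by blast
    moreover have "h v \<in> carrier B" using hD(1) ext.homog_carrier v(1) by blast
    ultimately show "h x = \<zero>\<^bsub>B\<^esub>"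
      using comm[OF v(1) v(1)] by (intro B.smult_eq_self_neg) auto
  qed
  from ext.quotient_lift[OF B h this] obtain k
    where k: "k \<in> galgebra_hom (exterior_algebra E) B"
      "\<And>u. u \<in> carrier ?T \<Longrightarrow> k (exterior_ideal E +>\<^bsub>?T\<^esub> u) = h u"
    unfolding exterior_algebra_def by blast
  show thesis
  proof (rule that[OF k(1)])
    fix i assume i: "i \<in> E"
    then show "k (ext_gen E i) = y i"
      unfolding ext_gen_def using k(2) ext.homog_carrier[OF tensor_gen[OF i]] hy by simp
  qed
qed

lemma ext_boundary_eq:
  assumes "set S \<subseteq> E"
  shows "ext_boundary E S = gboundary (exterior_algebra E) (ext_gen E) S"
proof -
  interpret X: anticommuting "exterior_algebra E" E "ext_gen E" by (rule anticommuting_exterior)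
  have "ext_monom E = gmonom (exterior_algebra E) (ext_gen E)"
    by (intro ext) (simp add: ext_monom_def gmonom_def)
  then show ?thesis using assms by (simp add: ext_boundary_def X.gboundary_finsum)
qed

section \<open>The Orlik-Solomon algebra and its universal property\<close>

locale os_algebra =
  fixes G :: "'a matroid"
begin

abbreviation "E \<equiv> ground G"
abbreviation "X \<equiv> exterior_algebra E"
abbreviation "A \<equiv> orlik_solomon G"
abbreviation "a \<equiv> os_gen G"

sublocale X: anticommuting X E "ext_gen E" by (rule anticommuting_exterior)

lemma galgebra_X: "galgebra X" by (rule galgebra_exterior)

lemma relations_subset:
  "{ext_boundary E S | S. distinct S \<and> set S \<subseteq> E \<and> set S \<notin> indep G} \<subseteq> carrier X"
  by (auto simp: ext_boundary_eq)

sublocale X: galgebra_ideal X "os_ideal G"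
  unfolding os_ideal_def
  by (intro galgebra_ideal.intro galgebra_X X.genideal_ideal relations_subset)

lemma galgebra_A: "galgebra A"
  unfolding orlik_solomon_def by (rule X.galgebra_quotient)

lemma proj_A: "(\<lambda>u. os_ideal G +>\<^bsub>X\<^esub> u) \<in> galgebra_hom X A"
  unfolding orlik_solomon_def by (rule X.quotient_proj)

lemma monom_spanned_A: "monom_spanned A E a"
proof -
  have "monom_spanned A E ((\<lambda>u. os_ideal G +>\<^bsub>X\<^esub> u) \<circ> ext_gen E)"
    by (rule monom_spanned_hom[OF galgebra_X galgebra_A proj_A _ exterior_monom_spanned])
       (auto simp: orlik_solomon_def X.quotient_homog)
  then show ?thesis by (simp add: o_def os_gen_def[abs_def])
qed

sublocale A: anticommuting A E a
proof -
  interpret A: galgebra A by (rule galgebra_A)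
  note hD = galgebra_homD[OF proj_A]
  show "anticommuting A E a"
  proof unfold_locales
    show "a i \<in> homog A 1" if "i \<in> E" for i
      unfolding os_gen_def using hD(6) X.deg_1[OF that] by blast
    fix i j assume "i \<in> E" "j \<in> E"
    then show "a i \<otimes>\<^bsub>A\<^esub> a j = (- 1) \<odot>\<^bsub>A\<^esub> (a j \<otimes>\<^bsub>A\<^esub> a i)"
      using X.anticomm[of i j] hD(2)[of "ext_gen E i" "ext_gen E j"]
        hD(2)[of "ext_gen E j" "ext_gen E i"] hD(5)[of "ext_gen E j \<otimes>\<^bsub>X\<^esub> ext_gen E i" "- 1"]
      unfolding os_gen_def by simp
  qed
qed

lemma boundary_dependent:
  assumes "distinct S" "set S \<subseteq> E" "set S \<notin> indep G"
  shows "gboundary A a S = \<zero>\<^bsub>A\<^esub>"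
proof -
  have "ext_boundary E S \<in> os_ideal G"
    unfolding os_ideal_def by (rule subsetD[OF X.genideal_self[OF relations_subset]]) (use assms in blast)
  then have "os_ideal G +>\<^bsub>X\<^esub> ext_boundary E S = \<zero>\<^bsub>A\<^esub>"
    unfolding orlik_solomon_def by (rule X.coset_zero)
  moreover have "ext_gen E \<in> set S \<rightarrow> carrier X" using assms(2) by auto
  from galgebra_hom_gboundary[OF galgebra_X galgebra_A proj_A this]
  have "os_ideal G +>\<^bsub>X\<^esub> ext_boundary E S = gboundary A a S"
    by (simp add: ext_boundary_eq[OF assms(2)] o_def os_gen_def[abs_def])
  ultimately show ?thesis by simp
qed

text \<open>The two quotients are passed one after the other, first the exterior relations and then
  the dependent boundaries. The retraction onto the pointed subalgebra, the maps induced by the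
  ground set inclusions and the map into the tensor product are all obtained from here.\<close>

lemma lift:
  assumes y: "anticommuting B E y"
    and dep: "\<And>S. distinct S \<Longrightarrow> set S \<subseteq> E \<Longrightarrow> set S \<notin> indep G \<Longrightarrow> gboundary B y S = \<zero>\<^bsub>B\<^esub>"
  obtains h where "h \<in> galgebra_hom A B" "\<And>i. i \<in> E \<Longrightarrow> h (a i) = y i"
proof -
  interpret B: anticommuting B E y by fact
  have B: "galgebra B" by unfold_locales
  obtain h where h: "h \<in> galgebra_hom X B" and hy: "\<And>i. i \<in> E \<Longrightarrow> h (ext_gen E i) = y i"
    using exterior_lift[OF y] by blast
  have "h u = \<zero>\<^bsub>B\<^esub>" if "u \<in> os_ideal G" for u
  proof (rule galgebra_hom_genideal[OF galgebra_X B h relations_subset _ that[unfolded os_ideal_def]])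
    fix u assume "u \<in> {ext_boundary E S | S. distinct S \<and> set S \<subseteq> E \<and> set S \<notin> indep G}"
    then obtain S where S: "u = ext_boundary E S" "distinct S" "set S \<subseteq> E" "set S \<notin> indep G"
      by blast
    have "ext_gen E \<in> set S \<rightarrow> carrier X" using S(3) by auto
    then have "h u = gboundary B (h \<circ> ext_gen E) S"
      unfolding S(1) ext_boundary_eq[OF S(3)] by (rule galgebra_hom_gboundary[OF galgebra_X B h])
    also have "\<dots> = gboundary B y S"
      by (rule gboundary_cong) (use S(3) hy in auto)
    finally show "h u = \<zero>\<^bsub>B\<^esub>" using dep S by simp
  qed
  from X.quotient_lift[OF B h this] obtain k
    where k: "k \<in> galgebra_hom A B" "\<And>u. u \<in> carrier X \<Longrightarrow> k (os_ideal G +>\<^bsub>X\<^esub> u) = h u"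
    unfolding orlik_solomon_def by blast
  show thesis
    by (rule that[OF k(1)]) (simp add: os_gen_def k(2) hy)
qed

end

section \<open>The graded tensor product\<close>

lemma comb_mult_diff_left: "comb_mult m s (f - f') g = comb_mult m s f g - comb_mult m s f' g"
  using comb_mult_add_left[of m s "f - f'" f' g] by (simp add: eq_diff_eq)

lemma comb_mult_diff_right: "comb_mult m s g (f - f') = comb_mult m s g f - comb_mult m s g f'"
  using comb_mult_add_right[of m s g "f - f'" f'] by (simp add: eq_diff_eq)

locale galgebra_pair = A: galgebra A + B: galgebra B
  for A :: "'v graded_algebra" and B :: "'w graded_algebra"
begin

abbreviation "K \<equiv> tensor_keys A B"
abbreviation "mK \<equiv> \<lambda>(i, a, j, b) (i', a', j', b'). (i + i', a \<otimes>\<^bsub>A\<^esub> a', j + j', b \<otimes>\<^bsub>B\<^esub> b')"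
abbreviation "sK \<equiv> \<lambda>(i :: nat, a :: 'v, j :: nat, b :: 'w) (i' :: nat, a' :: 'v, j' :: nat, b' :: 'w). (- 1 :: complex) ^ (j * i')"
abbreviation "eK \<equiv> (0 :: nat, \<one>\<^bsub>A\<^esub>, 0 :: nat, \<one>\<^bsub>B\<^esub>)"
abbreviation "dK \<equiv> \<lambda>(i :: nat, a :: 'v, j :: nat, b :: 'w). i + j"
abbreviation "W \<equiv> pre_tensor A B"
abbreviation "R \<equiv> tensor_relations A B"
abbreviation "N \<equiv> comb.span R"
abbreviation "T \<equiv> graded_tensor A B"

lemma in_K [simp]: "(i, a, j, b) \<in> K \<longleftrightarrow> a \<in> homog A i \<and> b \<in> homog B j"
  by (simp add: tensor_keys_def)

lemma K_cases:
  assumes "k \<in> K"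
  obtains i a j b where "k = (i, a, j, b)" "a \<in> homog A i" "b \<in> homog B j"
  using assms by (auto simp: tensor_keys_def)

text \<open>The cocycle identity for the sign holds because the exponent \<open>j * i'\<close> is
  additive in each of its two degrees.\<close>

lemma tensor_data: "comb_algebra_data K mK sK eK dK"
proof unfold_locales
  fix x y z assume "x \<in> K" "y \<in> K" "z \<in> K"
  then show "mK (mK x y) z = mK x (mK y z)" "sK x y * sK (mK x y) z = sK y z * sK x (mK y z)"
    by (auto elim!: K_cases simp: A.homog_carrier B.homog_carrier A.m_assoc B.m_assoc
        power_add[symmetric] algebra_simps)
qed (auto elim!: K_cases simp: A.homog_mult B.homog_mult A.homog_carrier B.homog_carrier)

lemma pre_tensor_eq: "W = comb_algebra K mK sK eK dK"
proof -
  have "{(i, a, j, b) \<in> K. i + j = p} = {k \<in> K. dK k = p}" for p by auto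
  then show ?thesis by (simp add: pre_tensor_def comb_algebra_def)
qed

lemma galgebra_W: "galgebra W"
  unfolding pre_tensor_eq by (rule comb_algebra_data.galgebra_comb_algebra[OF tensor_data])

lemma W_simps:
  "monoid.mult W = comb_mult mK sK" "add W = (+)" "zero W = 0" "smult W = scale_comb"
  "one W = Poly_Mapping.single eK 1"
  "f \<in> carrier W \<longleftrightarrow> Poly_Mapping.keys f \<subseteq> K"
  "f \<in> homog W p \<longleftrightarrow> Poly_Mapping.keys f \<subseteq> {k \<in> K. dK k = p}"
  by (simp_all add: pre_tensor_eq comb_algebra_def)

lemma span_single:
  assumes "f \<in> R" shows "scale_comb v f \<in> N"
  using assms by (intro comb.span_scale comb.span_base)

lemma scale_comb_diff: "scale_comb v (f - g) = scale_comb v f - scale_comb v g"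
  by (rule comb.scale_right_diff_distrib)

text \<open>The free coefficient \<open>v\<close> is there to absorb the sign that arises when a
  relation is multiplied by a basis element in \<open>mult_rel\<close>.\<close>

lemma rel_add_left:
  assumes "a \<in> homog A i" "a' \<in> homog A i" "b \<in> homog B j"
  shows "Poly_Mapping.single (i, a \<oplus>\<^bsub>A\<^esub> a', j, b) v - Poly_Mapping.single (i, a, j, b) v
    - Poly_Mapping.single (i, a', j, b) v \<in> N"
proof -
  have "pure_tensor i (a \<oplus>\<^bsub>A\<^esub> a') j b - pure_tensor i a j b - pure_tensor i a' j b \<in> R"
    unfolding tensor_relations_def using assms by blast
  from span_single[OF this, of v] show ?thesis by (simp add: scale_comb_diff scale_comb_single)
qed

lemma rel_add_right:
  assumes "a \<in> homog A i" "b \<in> homog B j" "b' \<in> homog B j"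
  shows "Poly_Mapping.single (i, a, j, b \<oplus>\<^bsub>B\<^esub> b') v - Poly_Mapping.single (i, a, j, b) v
    - Poly_Mapping.single (i, a, j, b') v \<in> N"
proof -
  have "pure_tensor i a j (b \<oplus>\<^bsub>B\<^esub> b') - pure_tensor i a j b - pure_tensor i a j b' \<in> R"
    unfolding tensor_relations_def using assms by blast
  from span_single[OF this, of v] show ?thesis by (simp add: scale_comb_diff scale_comb_single)
qed

text \<open>The coefficient \<open>w\<close> is separate from \<open>c * v\<close> so that the rule
  matches the factors of a product in whatever order they occur.\<close>

lemma rel_smult_left:
  assumes "a \<in> homog A i" "b \<in> homog B j" "w = c * v"
  shows "Poly_Mapping.single (i, c \<odot>\<^bsub>A\<^esub> a, j, b) v - Poly_Mapping.single (i, a, j, b) w \<in> N"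
proof -
  have "pure_tensor i (c \<odot>\<^bsub>A\<^esub> a) j b - scale_comb c (pure_tensor i a j b) \<in> R"
    unfolding tensor_relations_def using assms by blast
  from span_single[OF this, of v] show ?thesis
    by (simp add: scale_comb_diff scale_comb_single mult.commute assms(3))
qed

lemma rel_smult_right:
  assumes "a \<in> homog A i" "b \<in> homog B j" "w = c * v"
  shows "Poly_Mapping.single (i, a, j, c \<odot>\<^bsub>B\<^esub> b) v - Poly_Mapping.single (i, a, j, b) w \<in> N"
proof -
  have "pure_tensor i a j (c \<odot>\<^bsub>B\<^esub> b) - scale_comb c (pure_tensor i a j b) \<in> R"
    unfolding tensor_relations_def using assms by blast
  from span_single[OF this, of v] show ?thesis
    by (simp add: scale_comb_diff scale_comb_single mult.commute assms(3))
qed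

lemma rel_cases [consumes 1, case_names add_left add_right smult_left smult_right]:
  assumes "r \<in> R"
  obtains i a a' j b where "a \<in> homog A i" "a' \<in> homog A i" "b \<in> homog B j"
      "r = pure_tensor i (a \<oplus>\<^bsub>A\<^esub> a') j b - pure_tensor i a j b - pure_tensor i a' j b"
  | i a j b b' where "a \<in> homog A i" "b \<in> homog B j" "b' \<in> homog B j"
      "r = pure_tensor i a j (b \<oplus>\<^bsub>B\<^esub> b') - pure_tensor i a j b - pure_tensor i a j b'"
  | c i a j b where "a \<in> homog A i" "b \<in> homog B j"
      "r = pure_tensor i (c \<odot>\<^bsub>A\<^esub> a) j b - scale_comb c (pure_tensor i a j b)"
  | c i a j b where "a \<in> homog A i" "b \<in> homog B j"
      "r = pure_tensor i a j (c \<odot>\<^bsub>B\<^esub> b) - scale_comb c (pure_tensor i a j b)"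
  using assms unfolding tensor_relations_def by blast

lemma mult_rel:
  assumes k: "k \<in> K" and r: "r \<in> R"
  shows "comb_mult mK sK (Poly_Mapping.single k v) r \<in> N"
    and "comb_mult mK sK r (Poly_Mapping.single k v) \<in> N"
proof -
  obtain i0 a0 j0 b0 where k: "k = (i0, a0, j0, b0)" "a0 \<in> homog A i0" "b0 \<in> homog B j0"
    using k by (rule K_cases)
  note c0 = A.homog_carrier[OF k(2)] B.homog_carrier[OF k(3)]
  note simps = comb_mult_diff_left comb_mult_diff_right comb_mult_scale_left comb_mult_scale_right
    comb_mult_single scale_comb_single scale_comb_diff
  from r have "comb_mult mK sK (Poly_Mapping.single k v) r \<in> N \<and>
    comb_mult mK sK r (Poly_Mapping.single k v) \<in> N"
  proof (cases rule: rel_cases)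
    case (add_left i a a' j b)
    note c = add_left(1-2)[THEN A.homog_carrier] add_left(3)[THEN B.homog_carrier]
    show ?thesis unfolding add_left(4) k(1) using c c0 add_left(1-3) k(2,3)
      by (simp add: simps A.l_distr A.r_distr rel_add_left A.homog_mult B.homog_mult)
  next
    case (add_right i a j b b')
    note c = add_right(1)[THEN A.homog_carrier] add_right(2-3)[THEN B.homog_carrier]
    show ?thesis unfolding add_right(4) k(1) using c c0 add_right(1-3) k(2,3)
      by (simp add: simps B.l_distr B.r_distr rel_add_right A.homog_mult B.homog_mult)
  next
    case (smult_left c i a j b)
    note c = smult_left(1)[THEN A.homog_carrier] smult_left(2)[THEN B.homog_carrier]
    show ?thesis unfolding smult_left(3) k(1) using c c0 smult_left(1-2) k(2,3)
      by (simp add: simps A.smult_mult_left A.smult_mult_right rel_smult_left A.homog_mult B.homog_mult mult_ac)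
  next
    case (smult_right c i a j b)
    note c = smult_right(1)[THEN A.homog_carrier] smult_right(2)[THEN B.homog_carrier]
    show ?thesis unfolding smult_right(3) k(1) using c c0 smult_right(1-2) k(2,3)
      by (simp add: simps B.smult_mult_left B.smult_mult_right rel_smult_right A.homog_mult B.homog_mult mult_ac)
  qed
  then show "comb_mult mK sK (Poly_Mapping.single k v) r \<in> N"
    "comb_mult mK sK r (Poly_Mapping.single k v) \<in> N" by auto
qed

text \<open>Linear in both arguments: for a fixed basis element the good \<open>r\<close> form a
  subspace containing the relations, and sums in \<open>f\<close> are covered by induction.\<close>

lemma mult_span:
  assumes f: "Poly_Mapping.keys f \<subseteq> K" and r: "r \<in> N"
  shows "comb_mult mK sK f r \<in> N \<and> comb_mult mK sK r f \<in> N"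
  using f
proof (induct f rule: comb_supported_induct)
  case zero
  then show ?case by (simp add: comb.span_zero)
next
  case (single k v)
  let ?V = "{r. comb_mult mK sK (Poly_Mapping.single k v) r \<in> N \<and>
    comb_mult mK sK r (Poly_Mapping.single k v) \<in> N}"
  have "comb.subspace ?V"
    by (rule comb.subspaceI)
       (auto simp: comb.span_zero comb_mult_add_left comb_mult_add_right comb_mult_scale_left
         comb_mult_scale_right intro: comb.span_add comb.span_scale)
  moreover have "R \<subseteq> ?V" using mult_rel[OF single] by blast
  ultimately have "N \<subseteq> ?V" by (intro comb.span_minimal)
  with r show ?case by blast
next
  case (add f g)
  then show ?case by (simp add: comb_mult_add_left comb_mult_add_right comb.span_add)
qed

lemma subspace_supported: "comb.subspace {f :: _ \<Rightarrow>\<^sub>0 complex. Poly_Mapping.keys f \<subseteq> K}"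
proof (rule comb.subspaceI)
  fix x y :: "_ \<Rightarrow>\<^sub>0 complex"
  assume "x \<in> {f. Poly_Mapping.keys f \<subseteq> K}" "y \<in> {f. Poly_Mapping.keys f \<subseteq> K}"
  then show "x + y \<in> {f. Poly_Mapping.keys f \<subseteq> K}" using keys_add[of x y] by blast
  show "scale_comb c x \<in> {f. Poly_Mapping.keys f \<subseteq> K}" for c
    using \<open>x \<in> _\<close> keys_scale_comb[of c x] by blast
qed simp

lemma keys_diff_subset:
  fixes f g :: "_ \<Rightarrow>\<^sub>0 complex"
  shows "Poly_Mapping.keys f \<subseteq> K \<Longrightarrow> Poly_Mapping.keys g \<subseteq> K \<Longrightarrow> Poly_Mapping.keys (f - g) \<subseteq> K"
  using comb.subspace_diff[OF subspace_supported, of f g] by simp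

lemma keys_rel:
  assumes "r \<in> R" shows "Poly_Mapping.keys r \<subseteq> K"
  using assms
  by (cases rule: rel_cases)
     (simp_all add: keys_diff_subset scale_comb_single keys_single A.homog_add B.homog_add
       A.homog_smult B.homog_smult)

lemma keys_span: "r \<in> N \<Longrightarrow> Poly_Mapping.keys r \<subseteq> K"
  using comb.span_minimal[OF _ subspace_supported, of R] keys_rel by blast

lemma ideal_N: "ideal N W"
proof (rule idealI)
  interpret W: galgebra W by (rule galgebra_W)
  show "ring W" by (rule W.ring_axioms)
  show "subgroup N (add_monoid W)"
  proof (rule W.add.subgroupI)
    show "N \<subseteq> carrier W" using keys_span by (auto simp: W_simps)
    show "N \<noteq> {}" using comb.span_zero by blast
    show "\<ominus>\<^bsub>W\<^esub> r \<in> N" if r: "r \<in> N" for r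
    proof -
      have "r \<in> carrier W" using keys_span[OF r] by (simp add: W_simps)
      then have "\<ominus>\<^bsub>W\<^esub> r = scale_comb (- 1) r" by (simp add: W.minus_eq_smult W_simps)
      then show ?thesis using comb.span_neg[OF r] by simp
    qed
    show "r \<oplus>\<^bsub>W\<^esub> r' \<in> N" if "r \<in> N" "r' \<in> N" for r r'
      using that by (simp add: W_simps comb.span_add)
  qed
qed (auto simp: W_simps mult_span)

sublocale W: galgebra_ideal W N
  by (intro galgebra_ideal.intro galgebra_W ideal_N)

lemma galgebra_T: "galgebra T"
  unfolding graded_tensor_def by (rule W.galgebra_quotient)

sublocale T: galgebra T by (rule galgebra_T)

lemma proj_T: "(\<lambda>f. N +>\<^bsub>W\<^esub> f) \<in> galgebra_hom W T"
  unfolding graded_tensor_def by (rule W.quotient_proj)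

text \<open>The degrees stay arguments because they belong to the key; that the tensor depends only
  on \<open>a\<close> and \<open>b\<close> is not claimed.\<close>

definition pure :: "nat \<Rightarrow> 'v \<Rightarrow> nat \<Rightarrow> 'w \<Rightarrow> ((nat \<times> 'v \<times> nat \<times> 'w) \<Rightarrow>\<^sub>0 complex) set" where
  "pure i a j b = N +>\<^bsub>W\<^esub> pure_tensor i a j b"

lemma single_in_W: "a \<in> homog A i \<Longrightarrow> b \<in> homog B j \<Longrightarrow> Poly_Mapping.single (i, a, j, b) v \<in> carrier W"
  by (simp add: W_simps keys_single)

lemma coset_eq:
  assumes "f \<in> carrier W" "f' \<in> carrier W" "f - f' \<in> N"
  shows "N +>\<^bsub>W\<^esub> f = N +>\<^bsub>W\<^esub> f'"
  using W.coset_add[OF assms(2,3)] by (simp add: W_simps)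

lemma pure_homog: "a \<in> homog A i \<Longrightarrow> b \<in> homog B j \<Longrightarrow> i + j = p \<Longrightarrow> pure i a j b \<in> homog T p"
  unfolding pure_def by (rule galgebra_homD(6)[OF proj_T]) (simp add: W_simps keys_single)

lemma pure_closed [simp]: "a \<in> homog A i \<Longrightarrow> b \<in> homog B j \<Longrightarrow> pure i a j b \<in> carrier T"
  using pure_homog T.homog_carrier by blast

lemma pure_one: "\<one>\<^bsub>T\<^esub> = pure 0 \<one>\<^bsub>A\<^esub> 0 \<one>\<^bsub>B\<^esub>"
  using galgebra_homD(4)[OF proj_T] by (simp add: pure_def W_simps)

lemma pure_mult:
  assumes "a \<in> homog A i" "b \<in> homog B j" "a' \<in> homog A i'" "b' \<in> homog B j'"
  shows "pure i a j b \<otimes>\<^bsub>T\<^esub> pure i' a' j' b' =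
    (- 1) ^ (j * i') \<odot>\<^bsub>T\<^esub> pure (i + i') (a \<otimes>\<^bsub>A\<^esub> a') (j + j') (b \<otimes>\<^bsub>B\<^esub> b')"
proof -
  note hD = galgebra_homD[OF proj_T]
  have "pure i a j b \<otimes>\<^bsub>T\<^esub> pure i' a' j' b' = N +>\<^bsub>W\<^esub> (pure_tensor i a j b \<otimes>\<^bsub>W\<^esub> pure_tensor i' a' j' b')"
    unfolding pure_def using hD(2) single_in_W assms by simp
  also have "pure_tensor i a j b \<otimes>\<^bsub>W\<^esub> pure_tensor i' a' j' b' =
      (- 1) ^ (j * i') \<odot>\<^bsub>W\<^esub> pure_tensor (i + i') (a \<otimes>\<^bsub>A\<^esub> a') (j + j') (b \<otimes>\<^bsub>B\<^esub> b')"
    by (simp add: W_simps comb_mult_single scale_comb_single)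
  finally show ?thesis
    unfolding pure_def using hD(5) single_in_W assms by (simp add: A.homog_mult B.homog_mult)
qed

lemma pure_add_left:
  assumes "a \<in> homog A i" "a' \<in> homog A i" "b \<in> homog B j"
  shows "pure i (a \<oplus>\<^bsub>A\<^esub> a') j b = pure i a j b \<oplus>\<^bsub>T\<^esub> pure i a' j b"
proof -
  note in_W = single_in_W[OF assms(1,3)] single_in_W[OF assms(2,3)]
    single_in_W[OF A.homog_add[OF assms(1,2)] assms(3)]
  have "N +>\<^bsub>W\<^esub> pure_tensor i (a \<oplus>\<^bsub>A\<^esub> a') j b = N +>\<^bsub>W\<^esub> (pure_tensor i a j b \<oplus>\<^bsub>W\<^esub> pure_tensor i a' j b)"
    using rel_add_left[OF assms, of 1] W.add.m_closed[OF in_W(1,2)] in_W(3)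
    by (intro coset_eq) (simp_all add: W_simps(2) diff_diff_eq)
  then show ?thesis
    unfolding pure_def using galgebra_homD(3)[OF proj_T in_W(1,2)] by simp
qed

lemma pure_add_right:
  assumes "a \<in> homog A i" "b \<in> homog B j" "b' \<in> homog B j"
  shows "pure i a j (b \<oplus>\<^bsub>B\<^esub> b') = pure i a j b \<oplus>\<^bsub>T\<^esub> pure i a j b'"
proof -
  note in_W = single_in_W[OF assms(1,2)] single_in_W[OF assms(1,3)]
    single_in_W[OF assms(1) B.homog_add[OF assms(2,3)]]
  have "N +>\<^bsub>W\<^esub> pure_tensor i a j (b \<oplus>\<^bsub>B\<^esub> b') = N +>\<^bsub>W\<^esub> (pure_tensor i a j b \<oplus>\<^bsub>W\<^esub> pure_tensor i a j b')"
    using rel_add_right[OF assms, of 1] W.add.m_closed[OF in_W(1,2)] in_W(3)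
    by (intro coset_eq) (simp_all add: W_simps(2) diff_diff_eq)
  then show ?thesis
    unfolding pure_def using galgebra_homD(3)[OF proj_T in_W(1,2)] by simp
qed

lemma pure_smult_left:
  assumes "a \<in> homog A i" "b \<in> homog B j"
  shows "pure i (c \<odot>\<^bsub>A\<^esub> a) j b = c \<odot>\<^bsub>T\<^esub> pure i a j b"
proof -
  have "N +>\<^bsub>W\<^esub> pure_tensor i (c \<odot>\<^bsub>A\<^esub> a) j b = N +>\<^bsub>W\<^esub> (c \<odot>\<^bsub>W\<^esub> pure_tensor i a j b)"
    using rel_smult_left[OF assms refl, of c 1] single_in_W[OF A.homog_smult[OF assms(1)] assms(2)]
      single_in_W[OF assms]
    by (intro coset_eq) (simp_all add: W_simps(4) scale_comb_single)
  then show ?thesis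
    unfolding pure_def using galgebra_homD(5)[OF proj_T single_in_W[OF assms]] by simp
qed

lemma pure_smult_right:
  assumes "a \<in> homog A i" "b \<in> homog B j"
  shows "pure i a j (c \<odot>\<^bsub>B\<^esub> b) = c \<odot>\<^bsub>T\<^esub> pure i a j b"
proof -
  have "N +>\<^bsub>W\<^esub> pure_tensor i a j (c \<odot>\<^bsub>B\<^esub> b) = N +>\<^bsub>W\<^esub> (c \<odot>\<^bsub>W\<^esub> pure_tensor i a j b)"
    using rel_smult_right[OF assms refl, of c 1] single_in_W[OF assms(1) B.homog_smult[OF assms(2)]]
      single_in_W[OF assms]
    by (intro coset_eq) (simp_all add: W_simps(4) scale_comb_single)
  then show ?thesis
    unfolding pure_def using galgebra_homD(5)[OF proj_T single_in_W[OF assms]] by simp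
qed

lemma tensor_induct [consumes 1, case_names zero pure smult add]:
  assumes "t \<in> carrier T"
    and "P \<zero>\<^bsub>T\<^esub>"
    and pure: "\<And>i a j b. a \<in> homog A i \<Longrightarrow> b \<in> homog B j \<Longrightarrow> P (pure i a j b)"
    and smult: "\<And>c t. t \<in> carrier T \<Longrightarrow> P t \<Longrightarrow> P (c \<odot>\<^bsub>T\<^esub> t)"
    and add: "\<And>t t'. t \<in> carrier T \<Longrightarrow> t' \<in> carrier T \<Longrightarrow> P t \<Longrightarrow> P t' \<Longrightarrow> P (t \<oplus>\<^bsub>T\<^esub> t')"
  shows "P t"
proof -
  obtain f where f: "f \<in> carrier W" "t = N +>\<^bsub>W\<^esub> f"
    using assms(1) unfolding graded_tensor_def W.quotient_carrier by blast
  have proj_closed: "f \<in> carrier W \<Longrightarrow> N +>\<^bsub>W\<^esub> f \<in> carrier T" for f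
    by (rule galgebra_homD(1)[OF proj_T])
  have "Poly_Mapping.keys f \<subseteq> K" using f(1) by (simp add: W_simps)
  then have "P (N +>\<^bsub>W\<^esub> f)"
  proof (induct f rule: comb_supported_induct)
    case zero
    then show ?case
      using galgebra_hom_zero[OF galgebra_W galgebra_T proj_T] assms(2) by (simp add: W_simps)
  next
    case (single k v)
    then obtain i a j b where k: "k = (i, a, j, b)" "a \<in> homog A i" "b \<in> homog B j" by (rule K_cases)
    have "N +>\<^bsub>W\<^esub> Poly_Mapping.single k v = v \<odot>\<^bsub>T\<^esub> pure i a j b"
      using galgebra_homD(5)[OF proj_T single_in_W[OF k(2,3), of 1], of v]
      by (simp add: pure_def k(1) W_simps scale_comb_single)
    with k show ?case using pure smult pure_closed by simp
  next
    case (add f g)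
    then have "f \<in> carrier W" "g \<in> carrier W" by (simp_all add: W_simps)
    with add(3,4) assms(5) proj_closed galgebra_homD(3)[OF proj_T, of f g]
    show ?case by (simp add: W_simps)
  qed
  with f show ?thesis by simp
qed

text \<open>Bilinearity of \<open>g\<close> in each bidegree makes its linear extension vanish on
  the relations; \<open>g_mult\<close>, with the sign of the product in \<open>pre_tensor\<close>,
  makes the extension multiplicative before the quotient is taken.\<close>

lemma tensor_lift:
  assumes C: "galgebra C"
    and g_homog: "\<And>i a j b. a \<in> homog A i \<Longrightarrow> b \<in> homog B j \<Longrightarrow> g i a j b \<in> homog C (i + j)"
    and g_add_left: "\<And>i a a' j b. a \<in> homog A i \<Longrightarrow> a' \<in> homog A i \<Longrightarrow> b \<in> homog B j \<Longrightarrow>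
      g i (a \<oplus>\<^bsub>A\<^esub> a') j b = g i a j b \<oplus>\<^bsub>C\<^esub> g i a' j b"
    and g_add_right: "\<And>i a j b b'. a \<in> homog A i \<Longrightarrow> b \<in> homog B j \<Longrightarrow> b' \<in> homog B j \<Longrightarrow>
      g i a j (b \<oplus>\<^bsub>B\<^esub> b') = g i a j b \<oplus>\<^bsub>C\<^esub> g i a j b'"
    and g_smult_left: "\<And>c i a j b. a \<in> homog A i \<Longrightarrow> b \<in> homog B j \<Longrightarrow>
      g i (c \<odot>\<^bsub>A\<^esub> a) j b = c \<odot>\<^bsub>C\<^esub> g i a j b"
    and g_smult_right: "\<And>c i a j b. a \<in> homog A i \<Longrightarrow> b \<in> homog B j \<Longrightarrow>
      g i a j (c \<odot>\<^bsub>B\<^esub> b) = c \<odot>\<^bsub>C\<^esub> g i a j b"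
    and g_mult: "\<And>i a j b i' a' j' b'. a \<in> homog A i \<Longrightarrow> b \<in> homog B j \<Longrightarrow>
      a' \<in> homog A i' \<Longrightarrow> b' \<in> homog B j' \<Longrightarrow>
      (- 1) ^ (j * i') \<odot>\<^bsub>C\<^esub> g (i + i') (a \<otimes>\<^bsub>A\<^esub> a') (j + j') (b \<otimes>\<^bsub>B\<^esub> b') =
        g i a j b \<otimes>\<^bsub>C\<^esub> g i' a' j' b'"
    and g_one: "g 0 \<one>\<^bsub>A\<^esub> 0 \<one>\<^bsub>B\<^esub> = \<one>\<^bsub>C\<^esub>"
  obtains h where "h \<in> galgebra_hom T C"
    "\<And>i a j b. a \<in> homog A i \<Longrightarrow> b \<in> homog B j \<Longrightarrow> h (pure i a j b) = g i a j b"
proof -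
  interpret C: galgebra C by fact
  define g' where "g' = (\<lambda>(i, a, j, b). g i a j b)"
  have g'_homog: "g' k \<in> homog C (dK k)" if "k \<in> K" for k
    using that by (auto elim!: K_cases simp: g'_def g_homog)
  then have g'_closed: "g' \<in> K \<rightarrow> carrier C" using C.homog_carrier by blast
  have h: "lin_ext C g' \<in> galgebra_hom W C"
    unfolding pre_tensor_eq
    by (rule C.lin_ext_hom[OF tensor_data g'_homog])
       (auto elim!: K_cases simp: g'_def g_mult g_one)
  have single: "lin_ext C g' (Poly_Mapping.single (i, a, j, b) v) = v \<odot>\<^bsub>C\<^esub> g i a j b"
    if "a \<in> homog A i" "b \<in> homog B j" for i a j b v
    using that g_homog[OF that] C.homog_carrier by (subst C.lin_ext_single) (auto simp: g'_def)
  have gc: "g i a j b \<in> carrier C" if "a \<in> homog A i" "b \<in> homog B j" for i a j b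
    using g_homog[OF that] by (rule C.homog_carrier)
  have keys: "Poly_Mapping.keys (Poly_Mapping.single (i, a, j, b) v) \<subseteq> K"
    if "a \<in> homog A i" "b \<in> homog B j" for i a j b and v :: complex
    using that by (simp add: keys_single)
  \<comment> \<open>The support condition is included because the linear extension is known to be
    additive only on combinations supported in \<open>K\<close>.\<close>
  let ?V = "{f. Poly_Mapping.keys f \<subseteq> K \<and> lin_ext C g' f = \<zero>\<^bsub>C\<^esub>}"
  have "comb.subspace ?V"
  proof (rule comb.subspaceI)
    fix x y assume xy: "x \<in> ?V" "y \<in> ?V"
    then show "x + y \<in> ?V"
      using comb.subspace_add[OF subspace_supported, of x y] C.lin_ext_add[OF _ _ g'_closed, of x y]
      by simp
    show "scale_comb c x \<in> ?V" for c
      using xy comb.subspace_scale[OF subspace_supported, of x c] C.lin_ext_scale[OF _ g'_closed, of x c]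
      by simp
  qed simp
  moreover have "R \<subseteq> ?V"
  proof
    fix r assume r: "r \<in> R"
    then have "lin_ext C g' r = \<zero>\<^bsub>C\<^esub>"
    proof (cases rule: rel_cases)
      case (add_left i a a' j b)
      have "lin_ext C g' r = g i (a \<oplus>\<^bsub>A\<^esub> a') j b \<ominus>\<^bsub>C\<^esub> g i a j b \<ominus>\<^bsub>C\<^esub> g i a' j b"
        using add_left(1-3) unfolding add_left(4)
        by (simp add: C.lin_ext_diff[OF _ _ g'_closed] keys_diff_subset keys A.homog_add single gc
            del: keys_single)
      also have "\<dots> = \<zero>\<^bsub>C\<^esub>"
        using add_left(1-3) gc[OF add_left(1,3)] gc[OF add_left(2,3)]
        by (simp add: g_add_left C.minus_eq C.a_ac C.r_neg1 C.r_neg2 C.r_neg)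
      finally show ?thesis .
    next
      case (add_right i a j b b')
      have "lin_ext C g' r = g i a j (b \<oplus>\<^bsub>B\<^esub> b') \<ominus>\<^bsub>C\<^esub> g i a j b \<ominus>\<^bsub>C\<^esub> g i a j b'"
        using add_right(1-3) unfolding add_right(4)
        by (simp add: C.lin_ext_diff[OF _ _ g'_closed] keys_diff_subset keys B.homog_add single gc
            del: keys_single)
      also have "\<dots> = \<zero>\<^bsub>C\<^esub>"
        using add_right(1-3) gc[OF add_right(1,2)] gc[OF add_right(1,3)]
        by (simp add: g_add_right C.minus_eq C.a_ac C.r_neg1 C.r_neg2 C.r_neg)
      finally show ?thesis .
    next
      case (smult_left c i a j b)
      then show ?thesis
        by (simp add: C.lin_ext_diff[OF _ _ g'_closed] keys A.homog_smult single gc scale_comb_single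
            g_smult_left C.minus_eq C.r_neg del: keys_single)
    next
      case (smult_right c i a j b)
      then show ?thesis
        by (simp add: C.lin_ext_diff[OF _ _ g'_closed] keys B.homog_smult single gc scale_comb_single
            g_smult_right C.minus_eq C.r_neg del: keys_single)
    qed
    with keys_rel[OF r] show "r \<in> ?V" by simp
  qed
  ultimately have "N \<subseteq> ?V" by (intro comb.span_minimal)
  then have "lin_ext C g' r = \<zero>\<^bsub>C\<^esub>" if "r \<in> N" for r using that by blast
  from W.quotient_lift[OF C h this] obtain k
    where k: "k \<in> galgebra_hom T C" "\<And>f. f \<in> carrier W \<Longrightarrow> k (N +>\<^bsub>W\<^esub> f) = lin_ext C g' f"
    unfolding graded_tensor_def by blast
  show thesis
    by (rule that[OF k(1)]) (simp add: pure_def k(2) single_in_W single gc)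
qed

end

text \<open>A homomorphism given degree by degree. No agreement is demanded between
  \<open>\<theta> p\<close> and \<open>\<theta> q\<close> on an element lying in both components, so
  that \<open>u\<close> tensored with 1 fits the definition although its key mentions the degree of
  \<open>u\<close>.\<close>

definition graded_map :: "'v graded_algebra \<Rightarrow> 'w graded_algebra \<Rightarrow> (nat \<Rightarrow> 'v \<Rightarrow> 'w) \<Rightarrow> bool" where
  "graded_map A B \<theta> \<longleftrightarrow>
     (\<forall>p. \<forall>x \<in> homog A p. \<theta> p x \<in> homog B p) \<and>
     (\<forall>p. \<forall>x \<in> homog A p. \<forall>y \<in> homog A p. \<theta> p (x \<oplus>\<^bsub>A\<^esub> y) = \<theta> p x \<oplus>\<^bsub>B\<^esub> \<theta> p y) \<and>
     (\<forall>p c. \<forall>x \<in> homog A p. \<theta> p (c \<odot>\<^bsub>A\<^esub> x) = c \<odot>\<^bsub>B\<^esub> \<theta> p x) \<and>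
     (\<forall>p q. \<forall>x \<in> homog A p. \<forall>y \<in> homog A q. \<theta> (p + q) (x \<otimes>\<^bsub>A\<^esub> y) = \<theta> p x \<otimes>\<^bsub>B\<^esub> \<theta> q y) \<and>
     \<theta> 0 \<one>\<^bsub>A\<^esub> = \<one>\<^bsub>B\<^esub>"

lemma graded_mapD:
  assumes "graded_map A B \<theta>"
  shows "x \<in> homog A p \<Longrightarrow> \<theta> p x \<in> homog B p"
    and "x \<in> homog A p \<Longrightarrow> y \<in> homog A p \<Longrightarrow> \<theta> p (x \<oplus>\<^bsub>A\<^esub> y) = \<theta> p x \<oplus>\<^bsub>B\<^esub> \<theta> p y"
    and "x \<in> homog A p \<Longrightarrow> \<theta> p (c \<odot>\<^bsub>A\<^esub> x) = c \<odot>\<^bsub>B\<^esub> \<theta> p x"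
    and "x \<in> homog A p \<Longrightarrow> y \<in> homog A q \<Longrightarrow> \<theta> (p + q) (x \<otimes>\<^bsub>A\<^esub> y) = \<theta> p x \<otimes>\<^bsub>B\<^esub> \<theta> q y"
    and "\<theta> 0 \<one>\<^bsub>A\<^esub> = \<one>\<^bsub>B\<^esub>"
  using assms by (simp_all add: graded_map_def)

lemma graded_map_zero:
  assumes "galgebra A" "galgebra B" "graded_map A B \<theta>"
  shows "\<theta> p \<zero>\<^bsub>A\<^esub> = \<zero>\<^bsub>B\<^esub>"
proof -
  interpret A: galgebra A by fact
  interpret B: galgebra B by fact
  have "\<theta> p (0 \<odot>\<^bsub>A\<^esub> \<zero>\<^bsub>A\<^esub>) = 0 \<odot>\<^bsub>B\<^esub> \<theta> p \<zero>\<^bsub>A\<^esub>"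
    using graded_mapD(3)[OF assms(3) A.homog_zero] .
  then show ?thesis using B.homog_carrier[OF graded_mapD(1)[OF assms(3) A.homog_zero]] by simp
qed

lemma graded_map_gmonom:
  assumes A: "galgebra A" and \<theta>: "graded_map A B \<theta>"
  shows "x \<in> set S \<rightarrow> homog A 1 \<Longrightarrow> gmonom B (\<theta> 1 \<circ> x) S = \<theta> (length S) (gmonom A x S)"
proof (induct S)
  case Nil
  then show ?case by (simp add: graded_mapD[OF \<theta>])
next
  case (Cons i S)
  interpret galgebra A by fact
  have "x \<in> set S \<rightarrow> homog A 1" "x i \<in> homog A 1" using Cons by auto
  with Cons show ?case
    using graded_mapD(4)[OF \<theta> _ gmonom_homog[of x S], of "x i" 1] by simp
qed

lemma graded_map_gboundary:
  assumes A: "galgebra A" and B: "galgebra B" and \<theta>: "graded_map A B \<theta>"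
  shows "x \<in> set S \<rightarrow> homog A 1 \<Longrightarrow>
    gboundary A x S \<in> homog A (length S - 1) \<and>
    gboundary B (\<theta> 1 \<circ> x) S = \<theta> (length S - 1) (gboundary A x S)"
proof (induct S)
  case Nil
  interpret galgebra A by fact
  show ?case by (simp add: graded_map_zero[OF assms])
next
  case (Cons i S)
  interpret A: galgebra A by fact
  interpret B: galgebra B by fact
  have x: "x \<in> set S \<rightarrow> homog A 1" "x i \<in> homog A 1" using Cons by auto
  note IH = Cons(1)[OF x(1)]
  have m: "gmonom A x S \<in> homog A (length S)" using x(1) by (rule A.gmonom_homog)
  have b: "x i \<otimes>\<^bsub>A\<^esub> gboundary A x S \<in> homog A (length S)"
    "\<theta> (length S) (x i \<otimes>\<^bsub>A\<^esub> gboundary A x S) = \<theta> 1 (x i) \<otimes>\<^bsub>B\<^esub> gboundary B (\<theta> 1 \<circ> x) S"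
  proof -
    have "x i \<otimes>\<^bsub>A\<^esub> gboundary A x S \<in> homog A (length S) \<and>
      \<theta> (length S) (x i \<otimes>\<^bsub>A\<^esub> gboundary A x S) = \<theta> 1 (x i) \<otimes>\<^bsub>B\<^esub> gboundary B (\<theta> 1 \<circ> x) S"
    proof (cases S)
      \<comment> \<open>Truncated subtraction spoils the degree count
        \<open>1 + (length S - 1) = length S\<close> exactly here. The boundary of the empty tuple
        is zero, which is homogeneous of every degree.\<close>
      case Nil
      have "\<theta> 1 (x i) \<in> carrier B" using graded_mapD(1)[OF \<theta> x(2)] by (rule B.homog_carrier)
      then show ?thesis using Nil A.homog_carrier[OF x(2)] by (simp add: graded_map_zero[OF assms])
    next
      case (Cons j S')
      then show ?thesis
        using IH A.homog_mult[OF x(2), of "gboundary A x S" "length S - 1"]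
          graded_mapD(4)[OF \<theta> x(2), of "gboundary A x S" "length S - 1"]
        by (simp add: o_def del: gboundary.simps)
    qed
    then show "x i \<otimes>\<^bsub>A\<^esub> gboundary A x S \<in> homog A (length S)"
      "\<theta> (length S) (x i \<otimes>\<^bsub>A\<^esub> gboundary A x S) = \<theta> 1 (x i) \<otimes>\<^bsub>B\<^esub> gboundary B (\<theta> 1 \<circ> x) S" by auto
  qed
  show ?case
    using m b A.homog_smult[OF b(1), of "- 1"] graded_map_gmonom[OF A \<theta> x(1)]
    by (simp add: A.homog_add graded_mapD(2,3)[OF \<theta>] o_def)
qed

section \<open>Pointed Orlik-Solomon algebras\<close>

lemma dependent_contains_circuit:
  assumes "finite X" "X \<subseteq> ground G" "X \<notin> indep G"
  obtains C where "C \<in> circuits G" "C \<subseteq> X"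
proof -
  have "\<exists>C \<in> circuits G. C \<subseteq> X"
    using assms
  proof (induct X rule: finite_psubset_induct)
    case (psubset X)
    show ?case
    proof (cases "\<exists>D. D \<subset> X \<and> D \<notin> indep G")
      case True
      then show ?thesis using psubset by (meson order.trans psubset_imp_subset)
    next
      case False
      then have "X \<in> circuits G" using psubset by (auto simp: circuits_def)
      then show ?thesis by blast
    qed
  qed
  then show thesis using that by blast
qed

lemma circuit_superset_dependent:
  "is_matroid G \<Longrightarrow> C \<in> circuits G \<Longrightarrow> C \<subseteq> X \<Longrightarrow> X \<notin> indep G"
  unfolding is_matroid_def circuits_def by blast

text \<open>Both sides are bilinear, so monomials suffice. This supplies the sign that makes the map
  from the tensor product to the algebra of \<open>P\<close> multiplicative.\<close>

lemma (in os_algebra) homog_comm: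
  assumes u: "u \<in> homog A p" and v: "v \<in> homog A q"
  shows "u \<otimes>\<^bsub>A\<^esub> v = (- 1) ^ (p * q) \<odot>\<^bsub>A\<^esub> (v \<otimes>\<^bsub>A\<^esub> u)"
  using monom_spanned_A u
proof (induct rule: monom_spanned_induct)
  case zero
  then show ?case using v by (simp add: A.homog_carrier)
next
  case (monom w)
  show ?case using monom_spanned_A v
  proof (induct rule: monom_spanned_induct)
    case zero
    then show ?case using monom by simp
  next
    case (monom w')
    then show ?case using A.mon_mult_comm[of w w'] \<open>set w \<subseteq> E\<close> \<open>length w = p\<close> by simp
  next
    case (smult c v)
    then show ?case using monom A.homog_carrier[OF smult(1)]
      by (simp add: A.smult_mult_left A.smult_mult_right A.smult_smult mult.commute)
  next
    case (add v v')
    then show ?case using monom A.homog_carrier[OF add(1)] A.homog_carrier[OF add(2)]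
      by (simp add: A.l_distr A.r_distr A.smult_r_distr)
  qed
next
  case (smult c u)
  then show ?case using A.homog_carrier[OF smult(1)] A.homog_carrier[OF v]
    by (simp add: A.smult_mult_left A.smult_mult_right A.smult_smult mult.commute)
next
  case (add u u')
  then show ?case using A.homog_carrier[OF add(1)] A.homog_carrier[OF add(2)] A.homog_carrier[OF v]
    by (simp add: A.l_distr A.r_distr A.smult_r_distr)
qed

locale pointed_os_algebra = os_algebra G for G :: "nat matroid" +
  assumes base: "0 \<in> E"
begin

abbreviation "Ad \<equiv> pointed_orlik_solomon G"

text \<open>The index 0 is allowed and gives zero, so that the family is indexed by the whole ground
  set, and the form with the scalar -1 is that of \<open>shift\<close>.\<close>

definition z :: "nat \<Rightarrow> (nat list \<Rightarrow>\<^sub>0 complex) set set" where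
  "z i = a i \<oplus>\<^bsub>A\<^esub> (- 1) \<odot>\<^bsub>A\<^esub> a 0"

lemma z_minus: "i \<in> E \<Longrightarrow> a i \<ominus>\<^bsub>A\<^esub> a 0 = z i"
  using base by (simp add: z_def A.minus_eq A.minus_eq_smult)

lemma z_base: "z 0 = \<zero>\<^bsub>A\<^esub>"
  using base by (simp add: z_def)

sublocale z: anticommuting A E z
  using A.anticommuting_shift[OF base] unfolding z_def[abs_def] .

sublocale gen: galgebra_generated A "{a i \<ominus>\<^bsub>A\<^esub> a 0 | i. i \<in> E \<and> i \<noteq> 0}"
  by unfold_locales (use base in auto)

lemma Ad_eq: "Ad = generated_subalgebra A {a i \<ominus>\<^bsub>A\<^esub> a 0 | i. i \<in> E \<and> i \<noteq> 0}"
  by (simp add: pointed_orlik_solomon_def)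

lemmas Ad_simps [simp] = gen.generated_simps[folded Ad_eq]
lemmas Ad_subset = gen.generated_subset[folded Ad_eq]
lemmas Ad_closed = gen.generated_closed(2-6)[folded Ad_eq]
lemmas galgebra_Ad = gen.galgebra_generated[folded Ad_eq]

lemma Ad_induct [consumes 1, case_names gen one smult mult add]:
  assumes "u \<in> carrier Ad"
    and "\<And>i. i \<in> E \<Longrightarrow> i \<noteq> 0 \<Longrightarrow> P (z i)"
    and "P \<one>\<^bsub>A\<^esub>"
    and "\<And>c u. u \<in> carrier A \<Longrightarrow> P u \<Longrightarrow> P (c \<odot>\<^bsub>A\<^esub> u)"
    and "\<And>u v. u \<in> carrier A \<Longrightarrow> v \<in> carrier A \<Longrightarrow> P u \<Longrightarrow> P v \<Longrightarrow> P (u \<otimes>\<^bsub>A\<^esub> v)"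
    and "\<And>u v. u \<in> carrier A \<Longrightarrow> v \<in> carrier A \<Longrightarrow> P u \<Longrightarrow> P v \<Longrightarrow> P (u \<oplus>\<^bsub>A\<^esub> v)"
  shows "P u"
  using assms(1) unfolding Ad_eq
proof (induct rule: gen.generated_induct)
  case (gen u)
  then show ?case using assms(2) z_minus by auto
qed (use assms(3-6) in auto)

sublocale Ad: galgebra Ad by (rule galgebra_Ad)

lemma z_in_Ad: "i \<in> E \<Longrightarrow> z i \<in> carrier Ad"
  using gen.generated_closed(1)[of "z i", folded Ad_eq] z_minus[of i] Ad_closed(2)
  by (cases "i = 0") (auto simp: z_base)

lemma anticommuting_Ad: "anticommuting Ad E z"
proof unfold_locales
  show "z i \<in> homog Ad 1" if "i \<in> E" for i using z.deg_1[OF that] z_in_Ad[OF that] by simp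
  show "z i \<otimes>\<^bsub>Ad\<^esub> z j = (- 1) \<odot>\<^bsub>Ad\<^esub> (z j \<otimes>\<^bsub>Ad\<^esub> z i)" if "i \<in> E" "j \<in> E" for i j
    using z.anticomm[OF that] by simp
qed

sublocale Ad: anticommuting Ad E z by (rule anticommuting_Ad)

lemma z_funcset: "set w \<subseteq> E \<Longrightarrow> z \<in> set w \<rightarrow> homog Ad 1"
  using Ad.deg_1 by blast

lemma gmonom_Ad: "gmonom Ad y S = gmonom A y S"
  by (induct S) auto

lemma gboundary_Ad: "gboundary Ad y S = gboundary A y S"
  by (induct S) (auto simp: gmonom_Ad)

text \<open>Shift invariance with the base point subtracted. Through it the defining relations also
  hold for the family \<open>z\<close> inside the pointed subalgebra.\<close>

lemma gboundary_z: "set S \<subseteq> E \<Longrightarrow> gboundary A z S = gboundary A a S"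
  using A.shift[OF base] unfolding z_def[abs_def] by blast

lemma boundary_dependent_Ad:
  "distinct S \<Longrightarrow> set S \<subseteq> E \<Longrightarrow> set S \<notin> indep G \<Longrightarrow> gboundary Ad z S = \<zero>\<^bsub>A\<^esub>"
  by (simp add: gboundary_Ad gboundary_z boundary_dependent)

text \<open>
  The endomorphism with \<open>a\<^sub>i \<mapsto> a\<^sub>i - a\<^sub>0\<close> is a retraction onto \<open>Ad\<close>. It turns a combination of
  monomials of length \<open>p\<close> in the \<open>a\<^sub>i\<close> into one in the \<open>a\<^sub>i - a\<^sub>0\<close>, which avoids proving that
  the components of the Orlik-Solomon algebra are independent.
\<close>

lemma monom_spanned_Ad: "monom_spanned Ad E z"
proof -
  obtain \<rho> where \<rho>: "\<rho> \<in> galgebra_hom A A" and \<rho>_a: "\<And>i. i \<in> E \<Longrightarrow> \<rho> (a i) = z i"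
    using lift[OF z.anticommuting_axioms] boundary_dependent gboundary_z by metis
  note \<rho>D = galgebra_homD[OF \<rho>]
  \<comment> \<open>The image of \<open>a i\<close> minus \<open>a 0\<close> is \<open>z i\<close>
    minus \<open>z 0\<close>, and \<open>z 0\<close> is zero.\<close>
  have \<rho>_z: "\<rho> (z i) = z i" if "i \<in> E" for i
    using that base by (simp add: z_minus[symmetric] galgebra_hom_minus[OF galgebra_A galgebra_A \<rho>] \<rho>_a)
      (simp add: z_minus z_base A.minus_eq A.r_neg)
  have \<rho>_id: "\<rho> u = u" if "u \<in> carrier Ad" for u
    using that by (induct rule: Ad_induct) (simp_all add: \<rho>_z \<rho>D)
  show ?thesis
    unfolding monom_spanned_def
  proof (intro allI impI ballI)
    fix p P u
    assume P_zero: "P \<zero>\<^bsub>Ad\<^esub>"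
      and P_monom: "\<forall>w. set w \<subseteq> E \<longrightarrow> length w = p \<longrightarrow> P (gmonom Ad z w)"
      and P_smult: "\<forall>c. \<forall>u\<in>homog Ad p. P u \<longrightarrow> P (c \<odot>\<^bsub>Ad\<^esub> u)"
      and P_add: "\<forall>u\<in>homog Ad p. \<forall>v\<in>homog Ad p. P u \<longrightarrow> P v \<longrightarrow> P (u \<oplus>\<^bsub>Ad\<^esub> v)"
      and u: "u \<in> homog Ad p"
    have "u \<in> homog A p" using u by simp
    with monom_spanned_A have "P (\<rho> u) \<and> \<rho> u \<in> homog Ad p"
    proof (induct rule: monom_spanned_induct)
      case zero
      then show ?case
        using P_zero Ad.homog_zero[of p] by (simp add: galgebra_hom_zero[OF galgebra_A galgebra_A \<rho>])
    next
      case (monom w)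
      then have "\<rho> (gmonom A a w) = gmonom A (\<rho> \<circ> a) w"
        by (intro galgebra_hom_gmonom[OF galgebra_A \<rho>]) auto
      also have "\<dots> = gmonom Ad z w"
        unfolding gmonom_Ad by (rule gmonom_cong) (use monom \<rho>_a in auto)
      finally show ?case
        using P_monom monom Ad.gmonom_homog[OF z_funcset[OF monom(1)]] by auto
    next
      case (smult c u)
      then show ?case
        using P_smult Ad.homog_smult[of "\<rho> u" p c] A.homog_carrier[OF smult(1)] by (simp add: \<rho>D)
    next
      case (add u v)
      then show ?case
        using P_add Ad.homog_add[of "\<rho> u" p "\<rho> v"] A.homog_carrier[OF add(1)] A.homog_carrier[OF add(2)]
        by (simp add: \<rho>D)
    qed
    then show "P u" using \<rho>_id u by simp
  qed
qed

text \<open>On \<open>z i\<close> both maps agree because \<open>\<theta> 1 (z 0)\<close> is zero;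
  hence they agree on monomials in \<open>z\<close>, which span each component of the pointed
  algebra. In particular \<open>\<theta> p u\<close> is then the same for every degree
  \<open>p\<close> in which \<open>u\<close> lies.\<close>

lemma hom_eq_graded_map:
  assumes B: "galgebra B" and \<theta>: "graded_map Ad B \<theta>" and \<kappa>: "\<kappa> \<in> galgebra_hom A B"
    and \<kappa>_a: "\<And>i. i \<in> E \<Longrightarrow> \<kappa> (a i) = \<theta> 1 (z i)"
    and u: "u \<in> homog Ad p"
  shows "\<kappa> u = \<theta> p u"
proof -
  interpret B: galgebra B by fact
  note \<kappa>D = galgebra_homD[OF \<kappa>] and \<theta>D = graded_mapD[OF \<theta>]
  note \<theta>_zero = graded_map_zero[OF galgebra_Ad B \<theta>]
  have \<kappa>_z: "\<kappa> (z i) = \<theta> 1 (z i)" if "i \<in> E" for i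
  proof -
    have "\<theta> 1 (z i) \<in> carrier B" using \<theta>D(1)[OF Ad.deg_1[OF that]] by (rule B.homog_carrier)
    moreover have "\<kappa> (z i) = \<theta> 1 (z i) \<ominus>\<^bsub>B\<^esub> \<theta> 1 (z 0)"
      using that base by (simp add: z_minus[symmetric] galgebra_hom_minus[OF galgebra_A B \<kappa>])
        (simp add: z_minus \<kappa>_a)
    ultimately show ?thesis using \<theta>_zero[of 1] by (simp add: z_base B.minus_eq)
  qed
  show ?thesis using monom_spanned_Ad u
  proof (induct rule: monom_spanned_induct)
    case zero
    then show ?case using \<theta>_zero[of p] galgebra_hom_zero[OF galgebra_A B \<kappa>] by simp
  next
    case (monom w)
    have "\<kappa> (gmonom Ad z w) = gmonom B (\<kappa> \<circ> z) w"
      unfolding gmonom_Ad by (rule galgebra_hom_gmonom[OF galgebra_A \<kappa>]) (use monom in auto)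
    also have "\<dots> = gmonom B (\<theta> 1 \<circ> z) w"
      by (rule gmonom_cong) (use monom \<kappa>_z in auto)
    also have "\<dots> = \<theta> p (gmonom Ad z w)"
      using graded_map_gmonom[OF galgebra_Ad \<theta> z_funcset[OF monom(1)]] monom(2) by simp
    finally show ?case .
  next
    case (smult c u)
    then show ?case using A.homog_carrier[of u p] \<theta>D(3)[of u p c] by (simp add: \<kappa>D)
  next
    case (add u v)
    then show ?case
      using A.homog_carrier[of u p] A.homog_carrier[of v p] \<theta>D(2)[of u p v] by (simp add: \<kappa>D)
  qed
qed

text \<open>The boundary of the circuit is zero in the pointed algebra, \<open>\<theta>\<close>
  carries this to the image of the circuit, and \<open>bd_superset\<close> extends it to
  \<open>S\<close>. The circuit is nonempty since the empty set is independent.\<close>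

lemma circuit_image_boundary:
  assumes G: "is_matroid G" and \<theta>: "graded_map Ad B \<theta>" and x: "anticommuting B F x"
    and f: "inj_on f E" "f ` E \<subseteq> F" and x_f: "\<And>i. i \<in> E \<Longrightarrow> x (f i) = \<theta> 1 (z i)"
    and C: "C \<in> circuits G" and S: "distinct S" "f ` C \<subseteq> set S" "set S \<subseteq> F"
  shows "gboundary B x S = \<zero>\<^bsub>B\<^esub>"
proof -
  interpret B: anticommuting B F x by fact
  have B: "galgebra B" by unfold_locales
  have C': "C \<subseteq> E" "C \<notin> indep G" using C by (auto simp: circuits_def)
  then have "finite C" using G by (auto simp: is_matroid_def intro: finite_subset)
  then obtain L where L: "set L = C" "distinct L" using finite_distinct_list by blast
  have "L \<noteq> []" using L C' G by (auto simp: is_matroid_def)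
  have "gboundary B x (map f L) = gboundary B (\<theta> 1 \<circ> z) L"
    unfolding gboundary_map by (rule gboundary_cong) (use L C' x_f in auto)
  also have "\<dots> = \<theta> (length L - 1) (gboundary Ad z L)"
    using graded_map_gboundary[OF galgebra_Ad B \<theta> z_funcset[of L]] L C' by simp
  also have "gboundary Ad z L = \<zero>\<^bsub>Ad\<^esub>"
    using boundary_dependent_Ad[of L] L C' by simp
  finally have "gboundary B x (map f L) = \<zero>\<^bsub>B\<^esub>"
    by (simp only: graded_map_zero[OF galgebra_Ad B \<theta>])
  then show ?thesis
    by (rule B.bd_superset)
       (use L C' S f \<open>L \<noteq> []\<close> in \<open>auto simp: distinct_map intro: inj_on_subset\<close>)
qed

text \<open>A dependent set contains a circuit, whose image is a circuit of \<open>H\<close>, so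
  dependence is preserved and the universal property applies. As base point goes to base point,
  differences with the base generator go to such differences. Injectivity of \<open>h\<close> is not
  asserted.\<close>

lemma pointed_embedding:
  assumes H: "is_matroid H" "0 \<in> ground H" and f: "inj_on f E" "f ` E \<subseteq> ground H" "f 0 = 0"
    and G: "is_matroid G" and circ: "\<And>C. C \<in> circuits G \<Longrightarrow> f ` C \<in> circuits H"
  obtains h where "h \<in> galgebra_hom A (orlik_solomon H)" "\<And>i. i \<in> E \<Longrightarrow> h (a i) = os_gen H (f i)"
    "\<And>u. u \<in> carrier Ad \<Longrightarrow> h u \<in> carrier (pointed_orlik_solomon H)"
proof -
  interpret H: pointed_os_algebra H by unfold_locales fact
  have "anticommuting (orlik_solomon H) E (os_gen H \<circ> f)"
  proof unfold_locales
    fix i j assume "i \<in> E" "j \<in> E"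
    then have ij: "f i \<in> ground H" "f j \<in> ground H" using f(2) by auto
    then show "(os_gen H \<circ> f) i \<in> homog (orlik_solomon H) 1" using H.A.deg_1 by simp
    show "(os_gen H \<circ> f) i \<otimes>\<^bsub>orlik_solomon H\<^esub> (os_gen H \<circ> f) j =
      (- 1) \<odot>\<^bsub>orlik_solomon H\<^esub> ((os_gen H \<circ> f) j \<otimes>\<^bsub>orlik_solomon H\<^esub> (os_gen H \<circ> f) i)"
      unfolding comp_apply using ij by (rule H.A.anticomm)
  qed
  moreover have "gboundary (orlik_solomon H) (os_gen H \<circ> f) S = \<zero>\<^bsub>orlik_solomon H\<^esub>"
    if S: "distinct S" "set S \<subseteq> E" "set S \<notin> indep G" for S
  proof -
    obtain C where C: "C \<in> circuits G" "C \<subseteq> set S"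
      using dependent_contains_circuit[OF _ S(2,3)] by auto
    have "f ` set S \<notin> indep H"
      using circuit_superset_dependent[OF H(1) circ[OF C(1)]] C(2) by (simp add: image_mono)
    then have "gboundary (orlik_solomon H) (os_gen H) (map f S) = \<zero>\<^bsub>orlik_solomon H\<^esub>"
      using S f by (intro H.boundary_dependent) (auto simp: distinct_map intro: inj_on_subset)
    then show ?thesis by (simp add: gboundary_map)
  qed
  ultimately obtain h where h: "h \<in> galgebra_hom A (orlik_solomon H)"
    and h_a: "\<And>i. i \<in> E \<Longrightarrow> h (a i) = (os_gen H \<circ> f) i"
    using lift by blast
  note hD = galgebra_homD[OF h]
  have "h u \<in> carrier (pointed_orlik_solomon H)" if "u \<in> carrier Ad" for u
    using that
  proof (induct rule: Ad_induct)
    case (gen i)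
    then have "h (z i) = H.z (f i)"
      using base f(2,3)
      by (simp add: z_minus[symmetric] galgebra_hom_minus[OF galgebra_A H.galgebra_A h] h_a
          H.z_minus image_subset_iff)
    then show ?case using H.z_in_Ad[of "f i"] gen f(2) by auto
  qed (simp_all add: hD H.Ad_closed)
  with h h_a show thesis by (intro that) auto
qed

end

section \<open>Parallel connections\<close>

locale parallel_connection =
  fixes G0 G1 P :: "nat matroid" and f0 f1 :: "nat \<Rightarrow> nat"
  assumes pointed: "pointed_matroid G0" "pointed_matroid G1" "pointed_matroid P"
    and inj: "inj_on f0 (ground G0)" "inj_on f1 (ground G1)"
    and f_base: "f0 0 = 0" "f1 0 = 0"
    and ground_P: "ground P = f0 ` ground G0 \<union> f1 ` ground G1"
    and ground_inter: "f0 ` ground G0 \<inter> f1 ` ground G1 = {0}"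
    and circuits_P: "circuits P =
          (\<lambda>C. f0 ` C) ` circuits G0 \<union> (\<lambda>C. f1 ` C) ` circuits G1 \<union>
          {(f0 ` C0 - {0}) \<union> (f1 ` C1 - {0}) | C0 C1.
             C0 \<in> circuits G0 \<and> 0 \<in> C0 \<and> C1 \<in> circuits G1 \<and> 0 \<in> C1}"
begin

lemma matroids: "is_matroid G0" "is_matroid G1" "is_matroid P"
  using pointed by (auto simp: pointed_matroid_def simple_matroid_def)

lemma base_mem: "0 \<in> ground G0" "0 \<in> ground G1" "0 \<in> ground P"
  using pointed by (auto simp: pointed_matroid_def)

sublocale O0: pointed_os_algebra G0 by unfold_locales (rule base_mem)
sublocale O1: pointed_os_algebra G1 by unfold_locales (rule base_mem)
sublocale OP: pointed_os_algebra P by unfold_locales (rule base_mem)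

sublocale T: galgebra_pair "pointed_orlik_solomon G0" "pointed_orlik_solomon G1"
  by (intro galgebra_pair.intro O0.galgebra_Ad O1.galgebra_Ad)

abbreviation "E0 \<equiv> ground G0"
abbreviation "E1 \<equiv> ground G1"
abbreviation "EP \<equiv> ground P"
abbreviation "T \<equiv> graded_tensor (pointed_orlik_solomon G0) (pointed_orlik_solomon G1)"

section \<open>The two tensor factors and the images of the generators\<close>

definition \<theta>0 where "\<theta>0 p u = T.pure p u 0 \<one>\<^bsub>O1.A\<^esub>"
definition \<theta>1 where "\<theta>1 q v = T.pure 0 \<one>\<^bsub>O0.A\<^esub> q v"

lemma graded_map_\<theta>: "graded_map O0.Ad T \<theta>0" "graded_map O1.Ad T \<theta>1"
proof -
  note one0 = O0.Ad.homog_one and one1 = O1.Ad.homog_one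
  show "graded_map O0.Ad T \<theta>0"
    unfolding graded_map_def \<theta>0_def
    using T.pure_homog[OF _ one1] T.pure_add_left[OF _ _ one1] T.pure_smult_left[OF _ one1]
      T.pure_mult[OF _ one1 _ one1] T.pure_one T.pure_closed[OF O0.Ad.homog_mult one1]
    by (auto simp del: One_nat_def)
  show "graded_map O1.Ad T \<theta>1"
    unfolding graded_map_def \<theta>1_def
    using T.pure_homog[OF one0] T.pure_add_right[OF one0] T.pure_smult_right[OF one0]
      T.pure_mult[OF one0 _ one0] T.pure_one T.pure_closed[OF one0 O1.Ad.homog_mult]
    by (auto simp del: One_nat_def)
qed

text \<open>The two branches overlap only at the base point, where both values are zero;
  \<open>x_f1\<close> relies on this.\<close>

definition x where
  "x i = (if i \<in> f0 ` E0 then \<theta>0 1 (O0.z (inv_into E0 f0 i)) else \<theta>1 1 (O1.z (inv_into E1 f1 i)))"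

lemma \<theta>_zero: "\<theta>0 p \<zero>\<^bsub>O0.A\<^esub> = \<zero>\<^bsub>T\<^esub>" "\<theta>1 p \<zero>\<^bsub>O1.A\<^esub> = \<zero>\<^bsub>T\<^esub>"
  using graded_map_zero[OF O0.galgebra_Ad T.galgebra_T graded_map_\<theta>(1), of p]
    graded_map_zero[OF O1.galgebra_Ad T.galgebra_T graded_map_\<theta>(2), of p] by simp_all

lemma x_f0: "j \<in> E0 \<Longrightarrow> x (f0 j) = \<theta>0 1 (O0.z j)"
  using inj(1) by (simp add: x_def)

lemma x_zero: "x 0 = \<zero>\<^bsub>T\<^esub>"
  using x_f0[OF base_mem(1)] by (simp add: f_base O0.z_base \<theta>_zero)

lemma x_f1:
  assumes j: "j \<in> E1" shows "x (f1 j) = \<theta>1 1 (O1.z j)"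
proof (cases "f1 j \<in> f0 ` E0")
  case True
  then have "f1 j = f1 0" using ground_inter j f_base by auto
  then have "j = 0" using inj(2) j base_mem(2) by (auto dest: inj_onD)
  then show ?thesis by (simp add: f_base x_zero O1.z_base \<theta>_zero)
next
  case False
  then show ?thesis using inj(2) j by (simp add: x_def)
qed

lemma EP_cases [consumes 1, case_names f0 f1]:
  assumes "i \<in> EP"
  obtains j where "j \<in> E0" "i = f0 j" | j where "j \<in> E1" "i = f1 j"
  using assms ground_P by auto

text \<open>The sign convention of the tensor product gives exponent 0 in one order and exponent 1
  in the other.\<close>

lemma \<theta>_anticomm:
  assumes "u \<in> homog O0.Ad 1" "v \<in> homog O1.Ad 1"
  shows "\<theta>0 1 u \<otimes>\<^bsub>T\<^esub> \<theta>1 1 v = (- 1) \<odot>\<^bsub>T\<^esub> (\<theta>1 1 v \<otimes>\<^bsub>T\<^esub> \<theta>0 1 u)"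
proof -
  have uv: "u \<in> carrier O0.A" "v \<in> carrier O1.A"
    using assms O0.A.homog_carrier O1.A.homog_carrier by auto
  have c: "T.pure 1 u 1 v \<in> carrier T" using assms by (rule T.pure_closed)
  have "\<theta>0 1 u \<otimes>\<^bsub>T\<^esub> \<theta>1 1 v = T.pure 1 u 1 v"
    using T.pure_mult[OF assms(1) O1.Ad.homog_one O0.Ad.homog_one assms(2)] uv c
    unfolding \<theta>0_def \<theta>1_def by simp
  moreover have "\<theta>1 1 v \<otimes>\<^bsub>T\<^esub> \<theta>0 1 u = (- 1) \<odot>\<^bsub>T\<^esub> T.pure 1 u 1 v"
    using T.pure_mult[OF O0.Ad.homog_one assms(2) assms(1) O1.Ad.homog_one] uv c
    unfolding \<theta>0_def \<theta>1_def by simp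
  ultimately show ?thesis using c by (simp add: T.T.smult_smult)
qed

lemma anticommuting_x: "anticommuting T EP x"
proof unfold_locales
  note \<theta>D0 = graded_mapD[OF graded_map_\<theta>(1)] and \<theta>D1 = graded_mapD[OF graded_map_\<theta>(2)]
  note z0 = O0.Ad.deg_1 and z1 = O1.Ad.deg_1
  have h0: "\<theta>0 1 (O0.z j) \<in> homog T 1" if "j \<in> E0" for j using \<theta>D0(1)[OF z0[OF that]] .
  have h1: "\<theta>1 1 (O1.z j) \<in> homog T 1" if "j \<in> E1" for j using \<theta>D1(1)[OF z1[OF that]] .
  show deg: "x i \<in> homog T 1" if "i \<in> EP" for i
    using that by (cases rule: EP_cases) (use h0 h1 x_f0 x_f1 in auto)
  have same: "\<theta> 1 u \<otimes>\<^bsub>T\<^esub> \<theta> 1 v = (- 1) \<odot>\<^bsub>T\<^esub> (\<theta> 1 v \<otimes>\<^bsub>T\<^esub> \<theta> 1 u)"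
    if "graded_map B T \<theta>" "galgebra B" "u \<in> homog B 1" "v \<in> homog B 1"
      "u \<otimes>\<^bsub>B\<^esub> v = (- 1) \<odot>\<^bsub>B\<^esub> (v \<otimes>\<^bsub>B\<^esub> u)"
    for B :: "(nat list \<Rightarrow>\<^sub>0 complex) set set graded_algebra" and \<theta> u v
  proof -
    have "v \<otimes>\<^bsub>B\<^esub> u \<in> homog B (1 + 1)" using that(2,4,3) by (rule galgebra.homog_mult)
    from graded_mapD(3)[OF that(1) this, of "- 1"] show ?thesis
      using graded_mapD(4)[OF that(1,3,4)] graded_mapD(4)[OF that(1,4,3)] that(5) by simp
  qed
  fix i j assume i: "i \<in> EP" and j: "j \<in> EP"
  show "x i \<otimes>\<^bsub>T\<^esub> x j = (- 1) \<odot>\<^bsub>T\<^esub> (x j \<otimes>\<^bsub>T\<^esub> x i)"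
    using i
  proof (cases rule: EP_cases)
    case i: (f0 k)
    from j show ?thesis
    proof (cases rule: EP_cases)
      case j: (f0 l)
      show ?thesis
        using same[OF graded_map_\<theta>(1) O0.galgebra_Ad z0[OF i(1)] z0[OF j(1)] O0.Ad.anticomm[OF i(1) j(1)]]
          x_f0 i j by simp
    next
      case j: (f1 l)
      show ?thesis using \<theta>_anticomm[OF z0[OF i(1)] z1[OF j(1)]] x_f0 x_f1 i j by simp
    qed
  next
    case i: (f1 k)
    from j show ?thesis
    proof (cases rule: EP_cases)
      case j: (f0 l)
      have "x j \<in> carrier T" "x i \<in> carrier T" using deg \<open>i \<in> EP\<close> \<open>j \<in> EP\<close> T.T.homog_carrier by blast+
      then show ?thesis
        using \<theta>_anticomm[OF z0[OF j(1)] z1[OF i(1)]] x_f0 x_f1 i j by (simp add: T.T.smult_smult)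
    next
      case j: (f1 l)
      show ?thesis
        using same[OF graded_map_\<theta>(2) O1.galgebra_Ad z1[OF i(1)] z1[OF j(1)] O1.Ad.anticomm[OF i(1) j(1)]]
          x_f1 i j by simp
    qed
  qed
qed

sublocale x: anticommuting T EP x by (rule anticommuting_x)

section \<open>Dependent sets of the parallel connection\<close>

lemma circuit0_boundary:
  assumes "C \<in> circuits G0" "distinct S" "f0 ` C \<subseteq> set S" "set S \<subseteq> EP"
  shows "gboundary T x S = \<zero>\<^bsub>T\<^esub>"
  by (rule O0.circuit_image_boundary[OF matroids(1) graded_map_\<theta>(1) anticommuting_x inj(1) _ x_f0 assms])
     (use ground_P in auto)

lemma circuit1_boundary:
  assumes "C \<in> circuits G1" "distinct S" "f1 ` C \<subseteq> set S" "set S \<subseteq> EP"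
  shows "gboundary T x S = \<zero>\<^bsub>T\<^esub>"
  by (rule O1.circuit_image_boundary[OF matroids(2) graded_map_\<theta>(2) anticommuting_x inj(2) _ x_f1 assms])
     (use ground_P in auto)

text \<open>
  Since \<open>x 0 = 0\<close>, the boundary of \<open>0 # L\<close> is the monomial of \<open>L\<close>. Both factors of the circuit
  glued along the base point therefore have a vanishing monomial.
\<close>

lemma boundary_P:
  assumes S: "distinct S" "set S \<subseteq> EP" "set S \<notin> indep P"
  shows "gboundary T x S = \<zero>\<^bsub>T\<^esub>"
proof -
  obtain C where C: "C \<in> circuits P" "C \<subseteq> set S"
    using dependent_contains_circuit[OF _ S(2,3)] by auto
  have "C \<noteq> {}" using C(1) matroids(3) by (auto simp: circuits_def is_matroid_def)
  from C(1) consider C0 where "C0 \<in> circuits G0" "C = f0 ` C0"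
    | C1 where "C1 \<in> circuits G1" "C = f1 ` C1"
    | C0 C1 where "C = (f0 ` C0 - {0}) \<union> (f1 ` C1 - {0})"
        "C0 \<in> circuits G0" "0 \<in> C0" "C1 \<in> circuits G1" "0 \<in> C1"
    unfolding circuits_P by blast
  then show ?thesis
  proof cases
    case 1
    then show ?thesis using circuit0_boundary[OF 1(1) S(1) _ S(2)] C(2) by simp
  next
    case 2
    then show ?thesis using circuit1_boundary[OF 2(1) S(1) _ S(2)] C(2) by simp
  next
    case 3
    have sub: "C0 \<subseteq> E0" "C1 \<subseteq> E1" using 3 by (auto simp: circuits_def)
    have "f0 ` C0 - {0} \<subseteq> set S" "f1 ` C1 - {0} \<subseteq> set S" using C(2) 3(1) by auto
    then have "finite (f0 ` C0 - {0})" "finite (f1 ` C1 - {0})"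
      using finite_subset[OF _ finite_set] by blast+
    then obtain L0 L1 where L0: "set L0 = f0 ` C0 - {0}" "distinct L0"
      and L1: "set L1 = f1 ` C1 - {0}" "distinct L1"
      using finite_distinct_list by metis
    have LP: "set L0 \<subseteq> EP" "set L1 \<subseteq> EP" using L0 L1 sub ground_P by auto
    have mon_L: "gmonom T x L = \<zero>\<^bsub>T\<^esub>"
      if "gboundary T x (0 # L) = \<zero>\<^bsub>T\<^esub>" "set L \<subseteq> EP" for L
      using that by (simp add: x_zero)
    \<comment> \<open>Putting the base point back in front makes the tuple list the image of the
      whole circuit \<open>C0\<close>.\<close>
    have "gboundary T x (0 # L0) = \<zero>\<^bsub>T\<^esub>"
      by (rule circuit0_boundary[OF 3(2)]) (use L0 LP base_mem in auto)
    moreover have "gboundary T x (0 # L1) = \<zero>\<^bsub>T\<^esub>"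
      by (rule circuit1_boundary[OF 3(4)]) (use L1 LP base_mem in auto)
    ultimately have "gmonom T x L0 = \<zero>\<^bsub>T\<^esub>" "gmonom T x L1 = \<zero>\<^bsub>T\<^esub>"
      using mon_L LP by blast+
    then have "gboundary T x (L0 @ L1) = \<zero>\<^bsub>T\<^esub>"
      using LP by (simp add: T.T.gboundary_append)
    then show ?thesis
    proof (rule x.bd_superset)
      \<comment> \<open>Otherwise the glued circuit \<open>C\<close> would be empty, although the
        empty set is independent.\<close>
      show "L0 @ L1 \<noteq> []" using \<open>C \<noteq> {}\<close> 3(1) L0(1) L1(1) by auto
      have "f0 ` C0 \<inter> f1 ` C1 \<subseteq> {0}"
        unfolding ground_inter[symmetric] by (intro Int_mono image_mono sub)
      then show "distinct (L0 @ L1)" using L0 L1 by auto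
      show "set (L0 @ L1) \<subseteq> set S" using C(2) 3(1) L0 L1 by auto
    qed (rule S)+
  qed
qed

lemma graded_algebra_isomorphic_P: "graded_algebra_isomorphic OP.Ad T"
proof -
  have T: "galgebra T" by unfold_locales
  obtain \<Psi> where \<Psi>: "\<Psi> \<in> galgebra_hom OP.A T" and \<Psi>_a: "\<And>i. i \<in> EP \<Longrightarrow> \<Psi> (OP.a i) = x i"
    using OP.lift[OF anticommuting_x boundary_P] by blast
  obtain \<alpha> where \<alpha>: "\<alpha> \<in> galgebra_hom O0.A OP.A" and \<alpha>_a: "\<And>i. i \<in> E0 \<Longrightarrow> \<alpha> (O0.a i) = OP.a (f0 i)"
    and \<alpha>_Ad: "\<And>u. u \<in> carrier O0.Ad \<Longrightarrow> \<alpha> u \<in> carrier OP.Ad"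
    by (rule O0.pointed_embedding[OF matroids(3) base_mem(3) inj(1) _ f_base(1) matroids(1)])
       (use ground_P circuits_P in auto)
  obtain \<beta> where \<beta>: "\<beta> \<in> galgebra_hom O1.A OP.A" and \<beta>_a: "\<And>i. i \<in> E1 \<Longrightarrow> \<beta> (O1.a i) = OP.a (f1 i)"
    and \<beta>_Ad: "\<And>u. u \<in> carrier O1.Ad \<Longrightarrow> \<beta> u \<in> carrier OP.Ad"
    by (rule O1.pointed_embedding[OF matroids(3) base_mem(3) inj(2) _ f_base(2) matroids(2)])
       (use ground_P circuits_P in auto)
  note \<Psi>D = galgebra_homD[OF \<Psi>] and \<alpha>D = galgebra_homD[OF \<alpha>] and \<beta>D = galgebra_homD[OF \<beta>]
  note hc0 = O0.A.homog_carrier and hc1 = O1.A.homog_carrier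

  \<comment> \<open>Both sides are determined by the value \<open>x (f0 i)\<close> at the generator
    \<open>O0.a i\<close>, so the comparison lemma applies; likewise for
    \<open>\<beta>\<close>.\<close>
  have \<Psi>\<alpha>: "\<Psi> (\<alpha> u) = \<theta>0 p u" if "u \<in> homog O0.Ad p" for u p
    using O0.hom_eq_graded_map[OF T graded_map_\<theta>(1) galgebra_hom_comp[OF \<alpha> \<Psi>] _ that]
      \<alpha>_a \<Psi>_a x_f0 ground_P by simp
  have \<Psi>\<beta>: "\<Psi> (\<beta> u) = \<theta>1 p u" if "u \<in> homog O1.Ad p" for u p
    using O1.hom_eq_graded_map[OF T graded_map_\<theta>(2) galgebra_hom_comp[OF \<beta> \<Psi>] _ that]
      \<beta>_a \<Psi>_a x_f1 ground_P by simp

  have "\<exists>\<Phi>. \<Phi> \<in> galgebra_hom T OP.A \<and> (\<forall>i u j v. u \<in> homog O0.Ad i \<longrightarrow> v \<in> homog O1.Ad j \<longrightarrow>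
      \<Phi> (T.pure i u j v) = \<alpha> u \<otimes>\<^bsub>OP.A\<^esub> \<beta> v)"
  proof (rule T.tensor_lift[OF OP.galgebra_A, of "\<lambda>i u j v. \<alpha> u \<otimes>\<^bsub>OP.A\<^esub> \<beta> v"])
    fix i u j v u' v' i' j'
    assume "u \<in> homog O0.Ad i" "v \<in> homog O1.Ad j" "u' \<in> homog O0.Ad i'" "v' \<in> homog O1.Ad j'"
    then have h: "u \<in> homog O0.A i" "v \<in> homog O1.A j" "u' \<in> homog O0.A i'" "v' \<in> homog O1.A j'"
      by simp_all
    note c = \<alpha>D(1)[OF hc0[OF h(1)]] \<beta>D(1)[OF hc1[OF h(2)]] \<alpha>D(1)[OF hc0[OF h(3)]] \<beta>D(1)[OF hc1[OF h(4)]]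
    \<comment> \<open>Moving \<open>\<beta> v\<close> past \<open>\<alpha> u'\<close> costs exactly
      the sign in the product of two pure tensors.\<close>
    have comm: "\<beta> v \<otimes>\<^bsub>OP.A\<^esub> \<alpha> u' = (- 1) ^ (j * i') \<odot>\<^bsub>OP.A\<^esub> (\<alpha> u' \<otimes>\<^bsub>OP.A\<^esub> \<beta> v)"
      using \<beta>D(6)[OF h(2)] \<alpha>D(6)[OF h(3)] by (rule OP.homog_comm)
    have "(\<alpha> u \<otimes>\<^bsub>OP.A\<^esub> \<beta> v) \<otimes>\<^bsub>OP.A\<^esub> (\<alpha> u' \<otimes>\<^bsub>OP.A\<^esub> \<beta> v')
        = \<alpha> u \<otimes>\<^bsub>OP.A\<^esub> ((\<beta> v \<otimes>\<^bsub>OP.A\<^esub> \<alpha> u') \<otimes>\<^bsub>OP.A\<^esub> \<beta> v')"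
      using c by (simp add: OP.A.m_assoc)
    also have "\<dots> = (- 1) ^ (j * i') \<odot>\<^bsub>OP.A\<^esub>
        ((\<alpha> u \<otimes>\<^bsub>OP.A\<^esub> \<alpha> u') \<otimes>\<^bsub>OP.A\<^esub> (\<beta> v \<otimes>\<^bsub>OP.A\<^esub> \<beta> v'))"
      unfolding comm using c by (simp add: OP.A.m_assoc OP.A.smult_mult_left OP.A.smult_mult_right)
    finally show "(- 1) ^ (j * i') \<odot>\<^bsub>OP.A\<^esub> (\<alpha> (u \<otimes>\<^bsub>O0.Ad\<^esub> u') \<otimes>\<^bsub>OP.A\<^esub> \<beta> (v \<otimes>\<^bsub>O1.Ad\<^esub> v')) =
        (\<alpha> u \<otimes>\<^bsub>OP.A\<^esub> \<beta> v) \<otimes>\<^bsub>OP.A\<^esub> (\<alpha> u' \<otimes>\<^bsub>OP.A\<^esub> \<beta> v')"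
      using h hc0 hc1 by (simp add: \<alpha>D(2) \<beta>D(2))
  qed (auto simp: \<alpha>D \<beta>D hc0 hc1 OP.A.homog_mult OP.A.l_distr OP.A.r_distr
        OP.A.smult_mult_left OP.A.smult_mult_right)
  then obtain \<Phi> where \<Phi>: "\<Phi> \<in> galgebra_hom T OP.A"
    and \<Phi>_pure: "\<And>i u j v. u \<in> homog O0.Ad i \<Longrightarrow> v \<in> homog O1.Ad j \<Longrightarrow>
      \<Phi> (T.pure i u j v) = \<alpha> u \<otimes>\<^bsub>OP.A\<^esub> \<beta> v" by blast
  note \<Phi>D = galgebra_homD[OF \<Phi>]

  \<comment> \<open>The map was built into the full algebra of \<open>P\<close>; landing in the
    pointed subalgebra is what lets it invert the restriction of \<open>\<Psi>\<close>.\<close>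
  have \<Phi>_Ad: "\<Phi> t \<in> carrier OP.Ad" if "t \<in> carrier T" for t
    using that
  proof (induct rule: T.tensor_induct)
    case zero
    then show ?case by (simp add: galgebra_hom_zero[OF T OP.galgebra_A \<Phi>] OP.Ad_closed)
  next
    case (pure i u j v)
    then show ?case by (simp add: \<Phi>_pure OP.Ad_closed \<alpha>_Ad \<beta>_Ad)
  qed (simp_all add: \<Phi>D OP.Ad_closed)

  have \<Psi>\<Phi>: "\<Psi> (\<Phi> t) = t" if "t \<in> carrier T" for t
    using that
  proof (induct rule: T.tensor_induct)
    case zero
    then show ?case
      by (simp add: galgebra_hom_zero[OF T OP.galgebra_A \<Phi>] galgebra_hom_zero[OF OP.galgebra_A T \<Psi>])
  next
    case (pure i u j v)
    have uv: "u \<in> carrier O0.A" "v \<in> carrier O1.A" using pure hc0 hc1 by auto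
    \<comment> \<open>A pure tensor factors as \<open>u\<close> tensored with 1 times 1 tensored
      with \<open>v\<close>, without a sign because the two inner degrees are 0.\<close>
    have "\<Psi> (\<Phi> (T.pure i u j v)) = \<theta>0 i u \<otimes>\<^bsub>T\<^esub> \<theta>1 j v"
      using pure uv by (simp add: \<Phi>_pure \<Psi>D \<alpha>D \<beta>D \<Psi>\<alpha>[OF pure(1)] \<Psi>\<beta>[OF pure(2)])
    also have "\<dots> = T.pure i u j v"
      using T.pure_mult[OF pure(1) O1.Ad.homog_one O0.Ad.homog_one pure(2)] uv T.pure_closed[OF pure]
      unfolding \<theta>0_def \<theta>1_def by simp
    finally show ?case .
  qed (simp_all add: \<Phi>D \<Psi>D)

  have \<Phi>\<theta>: "\<Phi> (\<theta>0 1 (O0.z j)) = OP.z (f0 j)" if "j \<in> E0" for j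
  proof -
    have "\<Phi> (\<theta>0 1 (O0.z j)) = \<alpha> (O0.z j)"
      unfolding \<theta>0_def using \<Phi>_pure[OF O0.Ad.deg_1[OF that] O1.Ad.homog_one] that
      by (simp add: \<beta>D \<alpha>D)
    also have "\<dots> = OP.z (f0 j)"
      using that base_mem ground_P f_base
      by (simp add: O0.z_minus[symmetric] OP.z_minus[symmetric]
          galgebra_hom_minus[OF O0.galgebra_A OP.galgebra_A \<alpha>] \<alpha>_a)
    finally show ?thesis .
  qed
  have \<Phi>\<theta>': "\<Phi> (\<theta>1 1 (O1.z j)) = OP.z (f1 j)" if "j \<in> E1" for j
  proof -
    have "\<Phi> (\<theta>1 1 (O1.z j)) = \<beta> (O1.z j)"
      unfolding \<theta>1_def using \<Phi>_pure[OF O0.Ad.homog_one O1.Ad.deg_1[OF that]] that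
      by (simp add: \<beta>D \<alpha>D)
    also have "\<dots> = OP.z (f1 j)"
      using that base_mem ground_P f_base
      by (simp add: O1.z_minus[symmetric] OP.z_minus[symmetric]
          galgebra_hom_minus[OF O1.galgebra_A OP.galgebra_A \<beta>] \<beta>_a)
    finally show ?thesis .
  qed

  \<comment> \<open>Since \<open>\<Psi>\<close> sends \<open>OP.a 0\<close> to zero, this can be
    expected only on the pointed subalgebra, where the generators \<open>OP.z i\<close>
    decide.\<close>
  have \<Phi>\<Psi>: "\<Phi> (\<Psi> u) = u" if "u \<in> carrier OP.Ad" for u
    using that
  proof (induct rule: OP.Ad_induct)
    case (gen i)
    have "\<Psi> (OP.z i) = x i \<ominus>\<^bsub>T\<^esub> x 0"
      using gen base_mem
      by (simp add: OP.z_minus[symmetric] galgebra_hom_minus[OF OP.galgebra_A T \<Psi>] \<Psi>_a)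
    also have "\<dots> = x i" using gen by (simp add: x_zero T.T.minus_eq)
    finally have "\<Phi> (\<Psi> (OP.z i)) = \<Phi> (x i)" by simp
    also have "\<dots> = OP.z i"
      using gen(1) by (cases rule: EP_cases) (simp_all add: x_f0 x_f1 \<Phi>\<theta> \<Phi>\<theta>' del: One_nat_def)
    finally show ?case .
  qed (simp_all add: \<Psi>D \<Phi>D)

  have Ad_A: "u \<in> carrier OP.A" if "u \<in> carrier OP.Ad" for u using OP.Ad_subset that by blast
  have "bij_betw \<Psi> (carrier OP.Ad) (carrier T)"
    by (rule bij_betwI[of _ _ _ \<Phi>]) (use \<Psi>D(1) Ad_A \<Phi>_Ad \<Phi>\<Psi> \<Psi>\<Phi> in auto)
  then have "\<Psi> \<in> ring_iso OP.Ad T"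
    by (auto simp: ring_iso_def ring_hom_def \<Psi>D Ad_A)
  moreover have "\<Psi> ` homog OP.Ad p = homog T p" for p
  proof
    show "\<Psi> ` homog OP.Ad p \<subseteq> homog T p" using \<Psi>D(6) by auto
    \<comment> \<open>The preimage is supplied by \<open>\<Phi>\<close>, which preserves
      degrees.\<close>
    show "homog T p \<subseteq> \<Psi> ` homog OP.Ad p"
    proof
      fix t assume t: "t \<in> homog T p"
      then have "t \<in> carrier T" by (rule T.T.homog_carrier)
      with t have "\<Phi> t \<in> homog OP.Ad p" "t = \<Psi> (\<Phi> t)" using \<Phi>D(6) \<Phi>_Ad \<Psi>\<Phi> by auto
      then show "t \<in> \<Psi> ` homog OP.Ad p" by blast
    qed
  qed
  ultimately have "\<Psi> \<in> graded_algebra_iso OP.Ad T"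
    unfolding graded_algebra_iso_def using \<Psi>D(5) Ad_A by simp
  then show ?thesis unfolding graded_algebra_isomorphic_def by blast
qed

end

theorem theorem3p7:
  fixes G0 G1 P :: "nat matroid"
  assumes "pointed_matroid G0"
    and "pointed_matroid G1"
    and "pointed_parallel_connection G0 G1 P"
  shows "graded_algebra_isomorphic
           (pointed_orlik_solomon P)
           (graded_tensor (pointed_orlik_solomon G0) (pointed_orlik_solomon G1))"
proof -
  have "\<exists>f0 f1. parallel_connection G0 G1 P f0 f1"
    using assms unfolding pointed_parallel_connection_def parallel_connection_def
    by (elim conjE exE) (intro exI conjI, assumption+)
  then obtain f0 f1 where "parallel_connection G0 G1 P f0 f1" by blast
  then show ?thesis by (rule parallel_connection.graded_algebra_isomorphic_P)
qed

end
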